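(* Let $\ell\ge1$, $d_1,\dots,d_\ell\ge2$ be integers and $d=d_1+\cdots+d_\ell$. For every $\alpha>d-1$ and $\beta>2(d-1)-\alpha$ there exists $p=p(\alpha,\beta)>1$ such that the following holds. Suppose that $\mu,\nu\in\mathcal{M}(\mathbb{R}^d)$ satisfy (1) $\pi_i(\operatorname{supp}\mu)\cap\pi_i(\operatorname{supp}\nu)=\varnothing$ for all $i=1,\dots,\ell$; (2) $\mu(B(x,r))\le C_\alpha(\mu)r^\alpha$ and $\nu(B(x,r))\le C_\beta(\nu)r^\beta$ for all $x\in\mathbb{R}^d$ and all $r>0$, for some constants $C_\alpha(\mu),C_\beta(\nu)$. Then \[ \int \|P^{(\ell)}_y\mu\|^p_{L^p(S^{d_1-1}\times\cdots\times S^{d_\ell-1})}\,d\nu(y)\le C\, C_\alpha(\mu)^p\,C_\beta(\nu), \] where the constant $C$ depends only on $d$ and the diameter of $\operatorname{supp}\mu\cup\operatorname{supp}\nu$.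
   Context: Write $x=(x_1,\dots,x_\ell)\in\mathbb{R}^{d_1}\times\cdots\times\mathbb{R}^{d_\ell}=\mathbb{R}^d$. $\pi_i:\mathbb{R}^d\to\mathbb{R}^{d_i}$ is the orthogonal projection $x\mapsto x_i$. $\mathcal{M}(\mathbb{R}^d)$ is the space of compactly supported (positive) Radon measures on $\mathbb{R}^d$; $B(x,r)$ is the ball of center $x$ and radius $r$. For $y\in\mathbb{R}^d$, the $\ell$-parameter radial projection $P^{(\ell)}_y:\mathbb{R}^d\setminus\{x: x_i=y_i\text{ for some }i\}\to S^{d_1-1}\times\cdots\times S^{d_\ell-1}$ is \[ P^{(\ell)}_y(x)=\left(\frac{x_1-y_1}{|x_1-y_1|},\dots,\frac{x_\ell-y_\ell}{|x_\ell-y_\ell|}\right). \] $P^{(\ell)}_y\mu$ denotes the pushforward of $\mu$ under $P^{(\ell)}_y$, and its $L^p$ norm is that of its density with respect to the product surface measure $\mathcal{H}^{d_1-1}|_{S^{d_1-1}}\times\cdots\times\mathcal{H}^{d_\ell-1}|_{S^{d_\ell-1}}$ (equal to $+\infty$ if there is no density in $L^p$). *)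

theory Defs
  imports "HOL-Analysis.Analysis"
begin

section \<open>Measures on Euclidean space\<close>

definition msupport :: "'a::topological_space measure \<Rightarrow> 'a set" where
  "msupport M = {x. \<forall>U. open U \<and> x \<in> U \<longrightarrow> emeasure M U > 0}"

(* Compactly supported positive Radon measures.  On a Euclidean space every Borel measure that is
   finite on compact sets is automatically inner and outer regular, and the complement of its
   support is a null set, so such a measure is in particular finite. *)
definition radon_compact_support :: "'a::euclidean_space measure \<Rightarrow> bool" where
  "radon_compact_support M \<longleftrightarrow>
     sets M = sets borel \<and> (\<forall>K. compact K \<longrightarrow> emeasure M K < \<infinity>) \<and> compact (msupport M)"

section \<open>Hausdorff measure\<close>

(* The covering sets are required to be bounded because the library's diameter is meaningless on
   unbounded sets.  The factor unit_ball_vol s / 2 powr s is the usual normalization, for which the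
   s-dimensional Hausdorff measure agrees with s-dimensional Lebesgue measure (surface measure) for
   integer s.  Only meant for s > 0, since 0 powr 0 = 0. *)
definition hausdorff_content :: "real \<Rightarrow> real \<Rightarrow> 'a::metric_space set \<Rightarrow> ennreal" where
  "hausdorff_content s \<delta> A =
     (INF E \<in> {E :: nat \<Rightarrow> 'a set. A \<subseteq> (\<Union>j. E j) \<and> (\<forall>j. bounded (E j) \<and> diameter (E j) \<le> \<delta>)}.
        \<Sum>j. ennreal (unit_ball_vol s / 2 powr s * diameter (E j) powr s))"

definition hausdorff_outer :: "real \<Rightarrow> 'a::metric_space set \<Rightarrow> ennreal" where
  "hausdorff_outer s A = (SUP \<delta> \<in> {0<..}. hausdorff_content s \<delta> A)"

(* Metric outer measures are countably additive on Borel sets, so measure_of does not collapse to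
   the zero measure here. *)
definition hausdorff_measure :: "real \<Rightarrow> 'a::metric_space measure" where
  "hausdorff_measure s = measure_of UNIV (sets borel) (hausdorff_outer s)"

section \<open>L^p norm of a measure\<close>

(* Only meant for a > 0. *)
definition ennreal_powr :: "ennreal \<Rightarrow> real \<Rightarrow> ennreal" where
  "ennreal_powr x a = (if x = \<infinity> then \<infinity> else ennreal (enn2real x powr a))"

(* The L^p(S) norm of the density of M with respect to S.  For a sigma-finite S the density is
   unique almost everywhere, so the infimum is over equal values; it is \<infinity> if there is no density. *)
definition Lp_norm_measure :: "real \<Rightarrow> 'a measure \<Rightarrow> 'a measure \<Rightarrow> ennreal" where
  "Lp_norm_measure p S M =
     (INF f \<in> {f :: 'a \<Rightarrow> real. f \<in> borel_measurable S \<and> (\<forall>x \<in> space S. 0 \<le> f x) \<and>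
                               M = density S (\<lambda>x. ennreal (f x))}.
        ennreal_powr (\<integral>\<^sup>+ x. ennreal (f x powr p) \<partial>S) (1 / p))"

section \<open>Product decompositions and multiparameter radial projections\<close>

(* R^d = R^{d_1} x ... x R^{d_l} is encoded as real^'n, with d = CARD('n), together with a labelling
   b of the coordinates by the block indices 0, ..., l - 1.  The factor R^{d_i} is identified with
   the subspace of vectors that vanish outside the coordinates labelled i. *)
definition block_dim :: "('n::finite \<Rightarrow> nat) \<Rightarrow> nat \<Rightarrow> nat" where
  "block_dim b i = card {k. b k = i}"

definition block_proj :: "('n::finite \<Rightarrow> nat) \<Rightarrow> nat \<Rightarrow> real^'n \<Rightarrow> real^'n" where
  "block_proj b i x = (\<chi> k. if b k = i then x $ k else 0)"

definition block_sphere :: "('n::finite \<Rightarrow> nat) \<Rightarrow> nat \<Rightarrow> (real^'n) set" where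
  "block_sphere b i = range (block_proj b i) \<inter> sphere 0 1"

definition sphere_measure :: "('n::finite \<Rightarrow> nat) \<Rightarrow> nat \<Rightarrow> (real^'n) measure" where
  "sphere_measure b i =
     restrict_space (hausdorff_measure (real (block_dim b i) - 1)) (block_sphere b i)"

definition product_sphere_measure ::
  "nat \<Rightarrow> ('n::finite \<Rightarrow> nat) \<Rightarrow> (nat \<Rightarrow> real^'n) measure" where
  "product_sphere_measure l b = PiM {..<l} (sphere_measure b)"

definition radial_domain ::
  "nat \<Rightarrow> ('n::finite \<Rightarrow> nat) \<Rightarrow> real^'n \<Rightarrow> (real^'n) set" where
  "radial_domain l b y = {x. \<forall>i<l. block_proj b i x \<noteq> block_proj b i y}"

definition radial_proj ::
  "nat \<Rightarrow> ('n::finite \<Rightarrow> nat) \<Rightarrow> real^'n \<Rightarrow> real^'n \<Rightarrow> (nat \<Rightarrow> real^'n)" where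
  "radial_proj l b y x =
     (\<lambda>i \<in> {..<l}. (block_proj b i x - block_proj b i y) /\<^sub>R
                     norm (block_proj b i x - block_proj b i y))"

definition radial_pushforward ::
  "nat \<Rightarrow> ('n::finite \<Rightarrow> nat) \<Rightarrow> real^'n \<Rightarrow> (real^'n) measure \<Rightarrow> (nat \<Rightarrow> real^'n) measure" where
  "radial_pushforward l b y \<mu> =
     distr (restrict_space \<mu> (radial_domain l b y)) (product_sphere_measure l b) (radial_proj l b y)"

end

theory Submission
  imports Defs
begin

text \<open>
  Write \<open>r.u\<close> for the vector with blocks \<open>r_i u_i\<close>. The density of the projection of \<open>\<mu>\<close> from \<open>y\<close> is
  bounded by the plane integrals \<open>X \<mu> u y = \<integral> \<mu>(y + r.u) dr\<close> over all real \<open>r_1, ..., r_l\<close>. Let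
  \<open>\<mu>_j\<close> be \<open>\<mu>\<close> smoothed at scale \<open>2^-j\<close>. For fixed \<open>u\<close> the form
  \<open>(f, g) \<mapsto> \<integral> f X g\<close> is positive semidefinite, so by Cauchy-Schwarz the integral of
  \<open>|X (\<mu>_(j+1) - \<mu>_j)|\<close> against \<open>\<nu>\<close> and a Lipschitz weight in \<open>u\<close> is controlled by the energy of
  \<open>\<mu>_(j+1) - \<mu>_j\<close> and that of \<open>\<nu>_j\<close>. The first is at most \<open>2^(-j (\<alpha> - d + 1 - \<epsilon>))\<close>: one factor costs
  the height \<open>2^(j (d - \<alpha>))\<close>, and the cancellation of the other gains \<open>2^(-j (1 - \<epsilon>))\<close> through the
  Lipschitz weight. Summing the same estimate for \<open>\<nu>\<close>, the second is at most \<open>2^(j \<gamma>)\<close> for all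
  positive \<open>\<gamma> > d - 1 - \<beta>\<close>. Hence the differences of the regularized densities decay exponentially in the
  mean, while the densities themselves are at most a multiple of \<open>2^j\<close>; this bounds their supremum in \<open>L^p\<close>
  for some \<open>p > 1\<close>. Since the pushforwards have bounded mass, interpolating with \<open>L^1\<close> and letting \<open>p\<close>
  tend to 1 makes the constant independent of \<open>\<alpha>\<close> and \<open>\<beta>\<close>.
\<close>

section \<open>Plane integrals and the fundamental domain of the plane translations\<close>

text \<open>By Cauchy-Schwarz the j-th difference has mean at most the square root of the product of
  the energies 2^(-j (\<alpha> - d + 1 - \<epsilon>)) and 2^(j \<gamma>), so its decay rate is half
  of \<alpha> - d + 1 - \<epsilon> - \<gamma>. With \<gamma> just above max(0, d - 1 - \<beta>) and
  \<epsilon> small this can be made positive exactly when \<alpha> > d - 1 and \<alpha> + \<beta> >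
  2 (d - 1), the two hypotheses of the theorem. The loss \<epsilon> has one source: moving the base
  point costs |r|^-1, which fails to be integrable at r = 0 and is traded for |r|^-s with s < 1. The
  regularized density carries two smoothings of the same scale. One turns \<mu> into \<mu>_j, the
  other passes to \<nu> when the density is integrated against \<nu> and turns it into \<nu>_j. The
  passage to the spheres is a domination in one direction: the volume of a cone over a set of
  directions is at most a constant times the Hausdorff measure of that set. Radon-Nikodym then
  supplies a bounded weight, and the same weight serves to bound the density and to integrate its
  p-th power.\<close>

lemma nn_integral_PiM_lborel_affine:
  fixes c t :: "'i \<Rightarrow> real"
  assumes I: "finite I" and c: "\<And>i. i \<in> I \<Longrightarrow> c i \<noteq> 0"
    and f[measurable]: "f \<in> borel_measurable (Pi\<^sub>M I (\<lambda>_. lborel))"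
  shows "(\<integral>\<^sup>+ r. f r \<partial>Pi\<^sub>M I (\<lambda>_. lborel)) =
    (\<Prod>i\<in>I. ennreal \<bar>c i\<bar>) * (\<integral>\<^sup>+ r. f (\<lambda>i\<in>I. t i + c i * r i) \<partial>Pi\<^sub>M I (\<lambda>_. lborel))"
proof -
  interpret product_sigma_finite "\<lambda>_::'i. lborel :: real measure" by standard
  let ?P = "Pi\<^sub>M I (\<lambda>_. lborel) :: ('i \<Rightarrow> real) measure"
  let ?T = "\<lambda>r. \<lambda>i\<in>I. t i + c i * r i"
  have T[measurable]: "?T \<in> measurable ?P ?P"
    by measurable
  have "density (distr ?P ?P ?T) (\<lambda>_. \<Prod>i\<in>I. ennreal \<bar>c i\<bar>) = ?P"
  proof (rule PiM_eqI[OF I])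
    show "sets (density (distr ?P ?P ?T) (\<lambda>_. \<Prod>i\<in>I. ennreal \<bar>c i\<bar>)) = sets ?P" by simp
  next
    fix A :: "'i \<Rightarrow> real set" assume A: "\<And>i. i \<in> I \<Longrightarrow> A i \<in> sets lborel"
    then have A': "Pi\<^sub>E I A \<in> sets ?P" using I by (intro sets_PiM_I_finite) auto
    have pre: "?T -` Pi\<^sub>E I A \<inter> space ?P = Pi\<^sub>E I (\<lambda>i. (\<lambda>x. t i + c i * x) -` A i)"
      by (auto simp: space_PiM PiE_iff extensional_def)
    have "density (distr ?P ?P ?T) (\<lambda>_. \<Prod>i\<in>I. ennreal \<bar>c i\<bar>) (Pi\<^sub>E I A)
       = (\<Prod>i\<in>I. ennreal \<bar>c i\<bar>) * emeasure ?P (Pi\<^sub>E I (\<lambda>i. (\<lambda>x. t i + c i * x) -` A i))"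
      using A' by (simp add: emeasure_density nn_integral_cmult_indicator emeasure_distr pre)
    also have "emeasure ?P (Pi\<^sub>E I (\<lambda>i. (\<lambda>x. t i + c i * x) -` A i))
        = (\<Prod>i\<in>I. emeasure lborel ((\<lambda>x. t i + c i * x) -` A i))"
      using A I by (intro emeasure_PiM) (auto intro!: measurable_sets_borel[of _ borel])
    also have "(\<Prod>i\<in>I. ennreal \<bar>c i\<bar>) * (\<Prod>i\<in>I. emeasure lborel ((\<lambda>x. t i + c i * x) -` A i))
        = (\<Prod>i\<in>I. emeasure lborel (A i))"
      unfolding prod.distrib[symmetric]
    proof (rule prod.cong[OF refl])
      fix i assume i: "i \<in> I"
      then have Ai: "A i \<in> sets borel" using A by auto
      have "emeasure lborel (A i) = emeasure (density (distr lborel borel (\<lambda>x. t i + c i * x)) (\<lambda>_. ennreal \<bar>c i\<bar>)) (A i)"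
        using c[OF i] by (subst lborel_real_affine[of "c i" "t i"]) auto
      also have "\<dots> = ennreal \<bar>c i\<bar> * emeasure lborel ((\<lambda>x. t i + c i * x) -` A i)"
        using Ai by (simp add: emeasure_density nn_integral_cmult_indicator emeasure_distr)
      finally show "ennreal \<bar>c i\<bar> * emeasure lborel ((\<lambda>x. t i + c i * x) -` A i) = emeasure lborel (A i)" ..
    qed
    finally show "density (distr ?P ?P ?T) (\<lambda>_. \<Prod>i\<in>I. ennreal \<bar>c i\<bar>) (Pi\<^sub>E I A) = (\<Prod>i\<in>I. emeasure lborel (A i))" .
  qed
  then have "(\<integral>\<^sup>+ r. f r \<partial>?P) = (\<integral>\<^sup>+ r. f r \<partial>density (distr ?P ?P ?T) (\<lambda>_. \<Prod>i\<in>I. ennreal \<bar>c i\<bar>))"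
    by simp
  also have "\<dots> = (\<Prod>i\<in>I. ennreal \<bar>c i\<bar>) * (\<integral>\<^sup>+ r. f (?T r) \<partial>?P)"
    by (simp add: nn_integral_density nn_integral_cmult nn_integral_distr)
  finally show ?thesis .
qed

lemma nn_integral_lborel_shift:
  fixes f :: "'a::euclidean_space \<Rightarrow> ennreal"
  assumes [measurable]: "f \<in> borel_measurable borel"
  shows "(\<integral>\<^sup>+ z. f (z + v) \<partial>lborel) = (\<integral>\<^sup>+ z. f z \<partial>lborel)"
proof -
  have "(\<integral>\<^sup>+ z. f z \<partial>lborel) = (\<integral>\<^sup>+ z. f z \<partial>distr lborel borel ((+) v))"
    by (simp add: lborel_distr_plus)
  also have "\<dots> = (\<integral>\<^sup>+ z. f (z + v) \<partial>lborel)"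
    by (subst nn_integral_distr) (auto simp: add.commute)
  finally show ?thesis ..
qed

lemma borel_measurable_vecI:
  fixes f :: "'a \<Rightarrow> real^'n"
  assumes "\<And>k. (\<lambda>x. f x $ k) \<in> borel_measurable M"
  shows "f \<in> borel_measurable M"
  unfolding borel_measurable_euclidean_space[of f]
  using assms by (auto simp: Basis_vec_def inner_axis)

definition bscale :: "('n::finite \<Rightarrow> nat) \<Rightarrow> (nat \<Rightarrow> real) \<Rightarrow> real^'n \<Rightarrow> real^'n" where
  "bscale b r u = (\<chi> k. r (b k) * u $ k)"

lemma bscale_nth [simp]: "bscale b r u $ k = r (b k) * u $ k"
  by (simp add: bscale_def)

lemma block_proj_nth [simp]: "block_proj b i x $ k = (if b k = i then x $ k else 0)"
  by (simp add: block_proj_def)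

lemma borel_measurable_block_proj [measurable]: "block_proj b i \<in> borel_measurable borel"
  by (rule borel_measurable_vecI) (auto intro!: borel_measurable_continuous_onI continuous_intros)

lemma block_proj_bscale: "block_proj b i (bscale b r u) = r i *\<^sub>R block_proj b i u"
  by (simp add: vec_eq_iff)

lemma norm_block_proj_le: "norm (block_proj b i x) \<le> norm x"
  by (rule norm_le_componentwise_cart) auto

lemma norm_block_proj_diff: "block_proj b i x - block_proj b i y = block_proj b i (x - y)"
  by (simp add: vec_eq_iff)

definition plane_measure :: "nat \<Rightarrow> (nat \<Rightarrow> real) measure" where
  "plane_measure l = Pi\<^sub>M {..<l} (\<lambda>_. lborel)"

lemma sigma_finite_plane_measure: "sigma_finite_measure (plane_measure l)"
proof -
  interpret product_sigma_finite "\<lambda>_::nat. lborel :: real measure" by standard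
  show ?thesis unfolding plane_measure_def by (rule sigma_finite) simp
qed

interpretation plane_measure: sigma_finite_measure "plane_measure l"
  by (rule sigma_finite_plane_measure)

lemma measurable_prod_indicator_plane:
  assumes "\<And>i. i < l \<Longrightarrow> J i \<in> sets borel"
  shows "(\<lambda>r. \<Prod>i<l. indicator (J i) (r i) :: ennreal) \<in> borel_measurable (plane_measure l)"
proof (rule borel_measurable_prod_ennreal)
  fix i assume "i \<in> {..<l}"
  then have [measurable]: "(\<lambda>r. r i) \<in> borel_measurable (plane_measure l)" "J i \<in> sets borel"
    unfolding plane_measure_def using measurable_component_singleton[of i "{..<l}" "\<lambda>_. lborel"] assms by simp_all
  show "(\<lambda>r. indicator (J i) (r i) :: ennreal) \<in> borel_measurable (plane_measure l)" by measurable
qed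

locale blocks =
  fixes l :: nat and b :: "'n::finite \<Rightarrow> nat"
  assumes b_less: "b k < l" and block_nonempty: "i < l \<Longrightarrow> \<exists>k. b k = i"
begin

lemma measurable_component_plane [measurable]: "(\<lambda>r. r (b k)) \<in> borel_measurable (plane_measure l)"
  unfolding plane_measure_def using measurable_component_singleton[of "b k" "{..<l}" "\<lambda>_. lborel"] b_less by simp

lemma measurable_bscale [measurable (raw)]:
  assumes [measurable]: "f \<in> measurable M (plane_measure l)" "g \<in> borel_measurable M"
  shows "(\<lambda>x. bscale b (f x) (g x)) \<in> borel_measurable M"
proof (rule borel_measurable_vecI)
  fix k
  have [measurable]: "(\<lambda>x. f x (b k)) \<in> borel_measurable M"
    using measurable_compose[OF assms(1) measurable_component_plane] .
  have [measurable]: "(\<lambda>x. g x $ k) \<in> borel_measurable M"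
    by (rule measurable_compose[OF assms(2)]) (auto intro!: borel_measurable_continuous_onI continuous_intros)
  show "(\<lambda>x. bscale b (f x) (g x) $ k) \<in> borel_measurable M"
    by simp
qed

text \<open>The integrand is stated as a function of k -> r (b k), so that the arbitrary values of r
  outside {..<l} cannot enter.\<close>

lemma plane_shift:
  assumes "(\<lambda>r. f (\<lambda>k. r (b k))) \<in> borel_measurable (plane_measure l)"
  shows "(\<integral>\<^sup>+ r. f (\<lambda>k. r (b k) + t (b k)) \<partial>plane_measure l) = (\<integral>\<^sup>+ r. f (\<lambda>k. r (b k)) \<partial>plane_measure l)"
  using nn_integral_PiM_lborel_affine[of "{..<l}" "\<lambda>_. 1" "\<lambda>r. f (\<lambda>k. r (b k))" t] assms b_less
  by (simp add: plane_measure_def add.commute)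

lemma plane_scale:
  assumes "(\<lambda>r. f (\<lambda>k. r (b k))) \<in> borel_measurable (plane_measure l)" "\<And>i. i < l \<Longrightarrow> s i > 0"
  shows "(\<integral>\<^sup>+ r. f (\<lambda>k. r (b k)) \<partial>plane_measure l)
    = (\<Prod>i<l. ennreal (s i)) * (\<integral>\<^sup>+ r. f (\<lambda>k. s (b k) * r (b k)) \<partial>plane_measure l)"
proof -
  have "(\<Prod>i<l. ennreal \<bar>s i\<bar>) = (\<Prod>i<l. ennreal (s i))"
    using assms(2) by (intro prod.cong) (auto simp: abs_of_pos)
  moreover have "s i \<noteq> 0" if "i < l" for i using assms(2)[OF that] by simp
  ultimately show ?thesis
    using nn_integral_PiM_lborel_affine[of "{..<l}" s "\<lambda>r. f (\<lambda>k. r (b k))" "\<lambda>_. 0"] assms(1) b_less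
    by (simp add: plane_measure_def)
qed

definition Xray :: "(real^'n \<Rightarrow> ennreal) \<Rightarrow> real^'n \<Rightarrow> real^'n \<Rightarrow> ennreal" where
  "Xray f u z = (\<integral>\<^sup>+ r. f (z + bscale b r u) \<partial>plane_measure l)"

lemma measurable_Xray [measurable (raw)]:
  assumes [measurable]: "f \<in> borel_measurable borel" "g \<in> borel_measurable M" "h \<in> borel_measurable M"
  shows "(\<lambda>x. Xray f (g x) (h x)) \<in> borel_measurable M"
proof -
  have "(\<lambda>x. \<integral>\<^sup>+ r. (case x of (u, z) \<Rightarrow> f (z + bscale b r u)) \<partial>plane_measure l) \<in> borel_measurable (borel \<Otimes>\<^sub>M borel)"
    by measurable
  then have [measurable]: "(\<lambda>(u, z). Xray f u z) \<in> borel_measurable (borel \<Otimes>\<^sub>M borel)"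
    by (simp add: Xray_def case_prod_beta')
  have "(\<lambda>x. (case (g x, h x) of (u, z) \<Rightarrow> Xray f u z)) \<in> borel_measurable M"
    by measurable
  then show ?thesis by simp
qed

lemma Xray_invariant:
  assumes [measurable]: "f \<in> borel_measurable borel"
  shows "Xray f u (z + bscale b s u) = Xray f u z"
proof -
  let ?f = "\<lambda>r. f (z + (\<chi> k. r k * u $ k))"
  have e: "z + bscale b s u + bscale b r u = z + (\<chi> k. (r (b k) + s (b k)) * u $ k)" for r
    by (simp add: vec_eq_iff algebra_simps)
  have "?f (\<lambda>k. r (b k)) = f (z + bscale b r u)" for r by (simp add: bscale_def)
  then show ?thesis
    unfolding Xray_def e using plane_shift[of ?f s] by (simp add: bscale_def[symmetric])
qed

text \<open>Substitution of s_i r_i for r_i: plane integrals are homogeneous of degree -1 in each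
  block of u. This later compares the value at u with the value at its normalized direction.\<close>

lemma Xray_scale:
  assumes [measurable]: "f \<in> borel_measurable borel" and s: "\<And>i. i < l \<Longrightarrow> s i > 0"
  shows "Xray f u z = (\<Prod>i<l. ennreal (s i)) * Xray f (bscale b s u) z"
proof -
  let ?f = "\<lambda>r. f (z + (\<chi> k. r k * u $ k))"
  have e: "z + bscale b r (bscale b s u) = z + (\<chi> k. (s (b k) * r (b k)) * u $ k)" for r
    by (simp add: vec_eq_iff algebra_simps)
  have "?f (\<lambda>k. r (b k)) = f (z + bscale b r u)" for r by (simp add: bscale_def)
  then show ?thesis
    unfolding Xray_def e using plane_scale[of ?f s] s by (simp add: bscale_def[symmetric])
qed

text \<open>Each quotient is the coefficient of z along the i-th block of u, and translating z by
  r.u raises it by r_i, since distinct blocks are orthogonal. Half-open unit intervals therefore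
  give every translation orbit parameter volume exactly 1.\<close>

definition slab :: "real^'n \<Rightarrow> real^'n \<Rightarrow> ennreal" where
  "slab u z = (\<Prod>i<l. indicator {0..<1} ((z \<bullet> block_proj b i u) / (norm (block_proj b i u))\<^sup>2))"

lemma measurable_slab [measurable (raw)]:
  assumes [measurable]: "g \<in> borel_measurable M" "h \<in> borel_measurable M"
  shows "(\<lambda>x. slab (g x) (h x)) \<in> borel_measurable M"
  unfolding slab_def by measurable

lemma inner_bscale_block_proj: "bscale b r u \<bullet> block_proj b i u = r i * (norm (block_proj b i u))\<^sup>2"
  unfolding power2_norm_eq_inner inner_vec_def sum_distrib_left
  by (rule sum.cong) (auto simp: algebra_simps)

lemma nn_integral_slab:
  assumes u: "\<And>i. i < l \<Longrightarrow> block_proj b i u \<noteq> 0"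
  shows "(\<integral>\<^sup>+ r. slab u (z - bscale b r u) \<partial>plane_measure l) = 1"
proof -
  interpret product_sigma_finite "\<lambda>_::nat. lborel :: real measure" by standard
  define \<tau> where "\<tau> i = (z \<bullet> block_proj b i u) / (norm (block_proj b i u))\<^sup>2" for i
  have "slab u (z - bscale b r u) = (\<Prod>i<l. indicator {\<tau> i - 1<..\<tau> i} (r i))" for r
    unfolding slab_def
  proof (rule prod.cong[OF refl])
    fix i assume "i \<in> {..<l}"
    then have "block_proj b i u \<noteq> 0" using u by auto
    then have "((z - bscale b r u) \<bullet> block_proj b i u) / (norm (block_proj b i u))\<^sup>2 = \<tau> i - r i"
      by (simp add: inner_diff_left inner_bscale_block_proj \<tau>_def diff_divide_distrib)
    then show "indicator {0..<1} (((z - bscale b r u) \<bullet> block_proj b i u) / (norm (block_proj b i u))\<^sup>2)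
       = (indicator {\<tau> i - 1<..\<tau> i} (r i) :: ennreal)"
      by (auto simp: indicator_def)
  qed
  then have "(\<integral>\<^sup>+ r. slab u (z - bscale b r u) \<partial>plane_measure l)
     = (\<integral>\<^sup>+ r. (\<Prod>i<l. indicator {\<tau> i - 1<..\<tau> i} (r i)) \<partial>Pi\<^sub>M {..<l} (\<lambda>_. lborel))"
    by (simp add: plane_measure_def)
  also have "\<dots> = (\<Prod>i<l. \<integral>\<^sup>+ x. indicator {\<tau> i - 1<..\<tau> i} x \<partial>lborel)"
    by (rule product_nn_integral_prod) auto
  also have "\<dots> = 1" by simp
  finally show ?thesis .
qed

text \<open>The slab is a fundamental domain for the translations along the planes, so that pairing an
  invariant function with \<open>n\<close> is the same as pairing it with the plane integrals of \<open>n\<close>.\<close>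

lemma nn_integral_invariant_mult:
  assumes [measurable]: "G \<in> borel_measurable borel" "n \<in> borel_measurable borel"
    and u: "\<And>i. i < l \<Longrightarrow> block_proj b i u \<noteq> 0"
    and G: "\<And>z s. G (z + bscale b s u) = G z"
  shows "(\<integral>\<^sup>+ z. G z * n z \<partial>lborel) = (\<integral>\<^sup>+ z. slab u z * (G z * Xray n u z) \<partial>lborel)"
proof -
  have G': "G (z - bscale b r u) = G z" for z r
    using G[of "z - bscale b r u" r] by simp
  interpret pair_sigma_finite "lborel :: (real^'n) measure" "plane_measure l" by standard
  have "(\<integral>\<^sup>+ z. slab u z * (G z * Xray n u z) \<partial>lborel)
      = (\<integral>\<^sup>+ z. \<integral>\<^sup>+ r. slab u z * G z * n (z + bscale b r u) \<partial>plane_measure l \<partial>lborel)"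
    unfolding Xray_def by (simp add: nn_integral_cmult[symmetric] mult.assoc)
  also have "\<dots> = (\<integral>\<^sup>+ r. \<integral>\<^sup>+ z. slab u z * G z * n (z + bscale b r u) \<partial>lborel \<partial>plane_measure l)"
    by (rule Fubini'[symmetric]) measurable
  \<comment> \<open>The substitution z -> z - r.u moves the translation from \<open>n\<close> onto
    \<open>slab\<close> and leaves the invariant \<open>G\<close> alone. Only \<open>slab\<close>
    still depends on r, and its integral over r is 1.\<close>
  also have "\<dots> = (\<integral>\<^sup>+ r. \<integral>\<^sup>+ z. slab u (z - bscale b r u) * (G z * n z) \<partial>lborel \<partial>plane_measure l)"
  proof (rule nn_integral_cong)
    fix r
    have "(\<integral>\<^sup>+ z. slab u z * G z * n (z + bscale b r u) \<partial>lborel)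
       = (\<integral>\<^sup>+ z. (\<lambda>z. slab u (z - bscale b r u) * (G z * n z)) (z + bscale b r u) \<partial>lborel)"
      by (simp add: G mult.assoc)
    also have "\<dots> = (\<integral>\<^sup>+ z. slab u (z - bscale b r u) * (G z * n z) \<partial>lborel)"
      by (rule nn_integral_lborel_shift) measurable
    finally show "(\<integral>\<^sup>+ z. slab u z * G z * n (z + bscale b r u) \<partial>lborel)
       = (\<integral>\<^sup>+ z. slab u (z - bscale b r u) * (G z * n z) \<partial>lborel)" .
  qed
  also have "\<dots> = (\<integral>\<^sup>+ z. \<integral>\<^sup>+ r. slab u (z - bscale b r u) * (G z * n z) \<partial>plane_measure l \<partial>lborel)"
    by (rule Fubini') measurable
  also have "\<dots> = (\<integral>\<^sup>+ z. G z * n z \<partial>lborel)"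
    by (simp add: nn_integral_multc nn_integral_slab u)
  finally show ?thesis ..
qed

end

section \<open>Smoothing at dyadic scales and the energy\<close>

definition bump :: "nat \<Rightarrow> real^'n::finite \<Rightarrow> ennreal" where
  "bump j v = ennreal ((2 ^ j / 2) ^ CARD('n)) * indicator {v. \<forall>k. \<bar>v $ k\<bar> \<le> (1/2) ^ j} v"

lemma cube_eq_cbox: "{v :: real^'n::finite. \<forall>k. \<bar>v $ k\<bar> \<le> a} = cbox (\<chi> k. - a) (\<chi> k. a)"
  by (auto simp: mem_box_cart abs_le_iff minus_le_iff)

lemma emeasure_cube:
  assumes "0 \<le> a"
  shows "emeasure lborel {v :: real^'n::finite. \<forall>k. \<bar>v $ k\<bar> \<le> a} = ennreal ((2 * a) ^ CARD('n))"
proof -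
  have *: "((\<chi> k. a) - (\<chi> k. - a) :: real^'n) \<bullet> b = 2 * a"
     "((\<chi> k. - a) :: real^'n) \<bullet> b \<le> (\<chi> k. a) \<bullet> b" if "b \<in> Basis" for b
    using that assms by (auto simp: Basis_vec_def inner_axis)
  have "emeasure lborel (cbox (\<chi> k. - a) (\<chi> k. a) :: (real^'n) set)
      = ennreal (\<Prod>b\<in>Basis. ((\<chi> k. a) - (\<chi> k. - a) :: real^'n) \<bullet> b)"
    using * by (intro emeasure_lborel_cbox)
  also have "(\<Prod>b\<in>Basis. ((\<chi> k. a) - (\<chi> k. - a) :: real^'n) \<bullet> b) = (\<Prod>b\<in>(Basis :: (real^'n) set). 2 * a)"
    by (intro prod.cong refl *)
  finally show ?thesis unfolding cube_eq_cbox by simp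
qed

lemma sets_cube [measurable]: "{v :: real^'n::finite. \<forall>k. \<bar>v $ k\<bar> \<le> a} \<in> sets borel"
  unfolding cube_eq_cbox by simp

lemma borel_measurable_bump [measurable]: "bump j \<in> borel_measurable borel"
  unfolding bump_def by measurable

lemma bump_minus: "bump j (- v) = bump j v"
  by (simp add: bump_def indicator_def)

lemma bump_eq_0: "\<not> \<bar>v $ k\<bar> \<le> (1/2) ^ j \<Longrightarrow> bump j v = 0"
  by (auto simp: bump_def indicator_def)

lemma nn_integral_bump: "(\<integral>\<^sup>+ v. bump j (v :: real^'n::finite) \<partial>lborel) = 1"
proof -
  have e: "(2 ^ j / 2) ^ CARD('n) * (2 * (1/2) ^ j) ^ CARD('n) = (1::real)"
    by (simp add: power_mult_distrib[symmetric] power_one_over)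
  have "(\<integral>\<^sup>+ v. bump j (v :: real^'n) \<partial>lborel)
      = ennreal ((2 ^ j / 2) ^ CARD('n)) * emeasure lborel {v :: real^'n. \<forall>k. \<bar>v $ k\<bar> \<le> (1/2) ^ j}"
    unfolding bump_def by (rule nn_integral_cmult_indicator) simp
  also have "\<dots> = ennreal ((2 ^ j / 2) ^ CARD('n)) * ennreal ((2 * (1/2) ^ j) ^ CARD('n))"
    by (subst emeasure_cube) auto
  also have "\<dots> = ennreal ((2 ^ j / 2) ^ CARD('n) * (2 * (1/2) ^ j) ^ CARD('n))"
    by (rule ennreal_mult[symmetric]) auto
  finally show ?thesis unfolding e by simp
qed

definition smooth :: "(real^'n::finite) measure \<Rightarrow> nat \<Rightarrow> real^'n \<Rightarrow> ennreal" where
  "smooth \<mu> j z = (\<integral>\<^sup>+ x. bump j (z - x) \<partial>\<mu>)"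

text \<open>Ordinary convolution with the even function \<open>bump j\<close>. Written with z + v it
  is the adjoint of smoothing, without any reflection.\<close>

definition conv :: "nat \<Rightarrow> (real^'n::finite \<Rightarrow> ennreal) \<Rightarrow> real^'n \<Rightarrow> ennreal" where
  "conv j f z = (\<integral>\<^sup>+ v. bump j v * f (z + v) \<partial>lborel)"

lemma measurable_conv [measurable (raw)]:
  assumes [measurable]: "f \<in> borel_measurable borel" "g \<in> borel_measurable M"
  shows "(\<lambda>x. conv j f (g x)) \<in> borel_measurable M"
  unfolding conv_def by measurable

lemma conv_mono: "(\<And>z. f z \<le> g z) \<Longrightarrow> conv j f z \<le> conv j g z"
  unfolding conv_def by (intro nn_integral_mono mult_left_mono) auto

lemma conv_add:
  assumes [measurable]: "f \<in> borel_measurable borel" "g \<in> borel_measurable borel"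
  shows "conv j (\<lambda>z. f z + g z) z = conv j f z + conv j g z"
  unfolding conv_def by (simp add: distrib_left nn_integral_add)

lemma conv_le:
  fixes f :: "real^'n::finite \<Rightarrow> ennreal"
  assumes "\<And>z. f z \<le> M"
  shows "conv j f z \<le> M"
proof -
  have "conv j f z \<le> (\<integral>\<^sup>+ v. bump j (v :: real^'n) * M \<partial>lborel)"
    unfolding conv_def by (intro nn_integral_mono mult_left_mono assms) auto
  also have "\<dots> = M"
    by (simp add: nn_integral_multc nn_integral_bump)
  finally show ?thesis .
qed

text \<open>An average over a cube differs from the central value by at most the oscillation. The
  second inequality uses the hypothesis at z + v with increment -v.\<close>

lemma nn_integral_conv_osc:
  fixes \<Phi> :: "real^'n::finite \<Rightarrow> ennreal"
  assumes [measurable]: "\<Phi> \<in> borel_measurable borel"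
    and osc: "\<And>z v. (\<And>k. \<bar>v $ k\<bar> \<le> (1/2) ^ j) \<Longrightarrow> \<Phi> (z + v) \<le> \<Phi> z + e"
  shows "conv j \<Phi> z \<le> \<Phi> z + e" "\<Phi> z \<le> conv j \<Phi> z + e"
proof -
  have "conv j \<Phi> z \<le> (\<integral>\<^sup>+ v. bump j (v :: real^'n) * (\<Phi> z + e) \<partial>lborel)"
    unfolding conv_def
  proof (rule nn_integral_mono)
    fix v :: "real^'n"
    show "bump j v * \<Phi> (z + v) \<le> bump j v * (\<Phi> z + e)"
      using osc[of v z] bump_eq_0[of v _ j] by (cases "\<forall>k. \<bar>v $ k\<bar> \<le> (1/2) ^ j") (auto intro: mult_left_mono)
  qed
  then show "conv j \<Phi> z \<le> \<Phi> z + e"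
    by (simp add: nn_integral_multc nn_integral_bump)
  have "(\<integral>\<^sup>+ v. bump j (v :: real^'n) * \<Phi> z \<partial>lborel) \<le> (\<integral>\<^sup>+ v. bump j v * \<Phi> (z + v) + bump j v * e \<partial>lborel)"
  proof (rule nn_integral_mono)
    fix v :: "real^'n"
    show "bump j v * \<Phi> z \<le> bump j v * \<Phi> (z + v) + bump j v * e"
      using osc[of "- v" "z + v"] bump_eq_0[of v _ j]
      by (cases "\<forall>k. \<bar>v $ k\<bar> \<le> (1/2) ^ j") (auto simp: distrib_left[symmetric] intro: mult_left_mono)
  qed
  also have "\<dots> = conv j \<Phi> z + e"
    by (simp add: nn_integral_add nn_integral_multc nn_integral_bump conv_def)
  finally show "\<Phi> z \<le> conv j \<Phi> z + e"
    by (simp add: nn_integral_multc nn_integral_bump)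
qed

locale finite_borel = finite_measure \<mu> for \<mu> :: "(real^'n::finite) measure" +
  assumes sets_eq [measurable_cong]: "sets \<mu> = sets borel"
begin

lemma measurable_smooth [measurable (raw)]:
  assumes [measurable]: "g \<in> borel_measurable M"
  shows "(\<lambda>x. smooth \<mu> j (g x)) \<in> borel_measurable M"
proof -
  have "(\<lambda>z. smooth \<mu> j z) \<in> borel_measurable borel"
    unfolding smooth_def by measurable
  from measurable_compose[OF assms this] show ?thesis .
qed

lemma nn_integral_smooth_mult:
  assumes [measurable]: "f \<in> borel_measurable borel"
  shows "(\<integral>\<^sup>+ z. smooth \<mu> j z * f z \<partial>lborel) = (\<integral>\<^sup>+ x. conv j f x \<partial>\<mu>)"
proof -
  interpret pair_sigma_finite "lborel :: (real^'n) measure" \<mu> by standard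
  have "(\<integral>\<^sup>+ z. smooth \<mu> j z * f z \<partial>lborel) = (\<integral>\<^sup>+ z. \<integral>\<^sup>+ x. bump j (z - x) * f z \<partial>\<mu> \<partial>lborel)"
    unfolding smooth_def by (simp add: nn_integral_multc)
  also have "\<dots> = (\<integral>\<^sup>+ x. \<integral>\<^sup>+ z. bump j (z - x) * f z \<partial>lborel \<partial>\<mu>)"
    by (rule Fubini'[symmetric]) measurable
  also have "\<dots> = (\<integral>\<^sup>+ x. conv j f x \<partial>\<mu>)"
  proof (rule nn_integral_cong)
    fix x
    have "(\<integral>\<^sup>+ z. bump j (z - x) * f z \<partial>lborel) = (\<integral>\<^sup>+ z. (\<lambda>z. bump j (z - x) * f z) (z + x) \<partial>lborel)"
      by (rule nn_integral_lborel_shift[symmetric]) measurable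
    then show "(\<integral>\<^sup>+ z. bump j (z - x) * f z \<partial>lborel) = conv j f x"
      by (simp add: conv_def add.commute)
  qed
  finally show ?thesis .
qed

end

text \<open>For 0 < s \<le> 1 and t \<ge> 0 one has min 1 t \<le> t^s, and truncation at 1 is
  subadditive. This trades a Lipschitz bound for a Hoelder bound with a locally integrable
  singularity.\<close>

lemma min_one_sum_le_powr:
  assumes "finite K" "\<And>k. k \<in> K \<Longrightarrow> 0 \<le> t k" "0 < s" "s \<le> 1"
  shows "min 1 (\<Sum>k\<in>K. t k) \<le> (\<Sum>k\<in>K. t k powr s :: real)"
  using assms(1,2)
proof (induction K rule: finite_induct)
  case (insert x F)
  have "min 1 (t x) \<le> t x powr s"
  proof (cases "t x \<le> 1")
    case True
    then show ?thesis
      using powr_mono'[of s 1 "t x"] assms(3,4) insert.prems[of x] by (cases "t x = 0") auto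
  next
    case False
    then show ?thesis using assms(3) ge_one_powr_ge_zero[of "t x" s] by auto
  qed
  moreover have "min 1 (t x + sum t F) \<le> min 1 (t x) + min 1 (sum t F)"
  proof -
    have "0 \<le> t x" "0 \<le> sum t F" using insert.prems by (auto intro: sum_nonneg)
    then show ?thesis by (auto simp: min_def)
  qed
  ultimately show ?case using insert by auto
qed simp

section \<open>The Lipschitz weight on directions, averaged translates and the energy form\<close>

context blocks
begin

definition shell :: "(real^'n) set" where
  "shell = {u. \<forall>i<l. 2 \<le> norm (block_proj b i u) \<and> norm (block_proj b i u) \<le> 3}"

text \<open>A cutoff of Lipschitz constant 1 that equals 1 on \<open>shell\<close>. It vanishes at
  distance 1 from \<open>shell\<close>, so block norms between 2 and 3 there stay between 1 and 4 on
  its support, away from the degenerate directions.\<close>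

definition wt :: "real^'n \<Rightarrow> real" where
  "wt u = max 0 (1 - infdist u shell)"

lemma shell_nonempty: "shell \<noteq> {}"
proof -
  define rep where "rep i = (SOME k. b k = i)" for i
  have rep: "b (rep i) = i" if "i < l" for i
    unfolding rep_def using block_nonempty[OF that] by (rule someI_ex)
  define u :: "real^'n" where "u = (\<chi> k. if k = rep (b k) then 2 else 0)"
  have "block_proj b i u = axis (rep i) 2" if "i < l" for i
    using rep[OF that] by (auto simp: vec_eq_iff u_def axis_def)
  moreover have "norm (axis k (2::real) :: real^'n) = 2" for k
  proof -
    have "axis k (2::real) = 2 *\<^sub>R (axis k 1 :: real^'n)" by (simp add: axis_def vec_eq_iff)
    then show ?thesis by simp
  qed
  ultimately have "u \<in> shell"
    by (auto simp: shell_def)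
  then show ?thesis by auto
qed

lemma borel_measurable_wt [measurable]: "wt \<in> borel_measurable borel"
  unfolding wt_def by (intro borel_measurable_continuous_onI continuous_intros)

lemma wt_nonneg: "0 \<le> wt u" and wt_le_1: "wt u \<le> 1"
  by (auto simp: wt_def infdist_nonneg)

lemma wt_shell: "u \<in> shell \<Longrightarrow> wt u = 1"
  by (simp add: wt_def)

lemma wt_lipschitz: "wt u \<le> wt v + norm (u - v)"
proof -
  have "infdist v shell \<le> infdist u shell + dist v u" by (rule infdist_triangle)
  then show ?thesis by (auto simp: wt_def dist_norm norm_minus_commute max_def)
qed

lemma wt_support:
  assumes "wt u \<noteq> 0" "i < l"
  shows "1 \<le> norm (block_proj b i u)" "norm (block_proj b i u) \<le> 4"
proof -
  have "infdist u shell < 1" using assms(1) by (auto simp: wt_def max_def split: if_splits)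
  then obtain a where a: "a \<in> shell" "dist u a < 1"
    using shell_nonempty by (auto simp: infdist_def cInf_less_iff)
  have "norm (block_proj b i u - block_proj b i a) \<le> norm (u - a)"
    by (simp add: norm_block_proj_diff norm_block_proj_le)
  also have "\<dots> < 1" using a by (simp add: dist_norm)
  finally have *: "norm (block_proj b i u - block_proj b i a) < 1" .
  have "2 \<le> norm (block_proj b i a)" "norm (block_proj b i a) \<le> 3"
    using a(1) assms(2) by (auto simp: shell_def)
  moreover have "norm (block_proj b i a) \<le> norm (block_proj b i u) + norm (block_proj b i u - block_proj b i a)"
    using norm_triangle_ineq4[of "block_proj b i u" "block_proj b i u - block_proj b i a"] by simp
  moreover have "norm (block_proj b i u) \<le> norm (block_proj b i a) + norm (block_proj b i u - block_proj b i a)"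
    using norm_triangle_ineq[of "block_proj b i a" "block_proj b i u - block_proj b i a"] by simp
  ultimately show "1 \<le> norm (block_proj b i u)" "norm (block_proj b i u) \<le> 4"
    using * by linarith+
qed

lemma wt_support_nth: "wt u \<noteq> 0 \<Longrightarrow> \<bar>u $ k\<bar> \<le> 4"
  using wt_support(2)[of u "b k"] b_less[of k] component_le_norm_cart[of "block_proj b (b k) u" k]
  by simp

lemma wt_support_nonzero: "wt u \<noteq> 0 \<Longrightarrow> i < l \<Longrightarrow> block_proj b i u \<noteq> 0"
  using wt_support(1)[of u i] by auto

text \<open>The increase is at most |v| by the Lipschitz bound and at most 1 because the weight is.
  It occurs only where wt (u - v) is nonzero, and the resulting indicator makes the error integrable
  in u.\<close>

lemma wt_shift_le:
  "wt (u - v) \<le> wt u + min 1 (norm v) * indicator {w. \<forall>k. \<bar>w $ k\<bar> \<le> 4} (u - v)"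
proof (cases "wt (u - v) = 0")
  case True
  then show ?thesis using wt_nonneg[of u] by auto
next
  case False
  then have "\<forall>k. \<bar>(u - v) $ k\<bar> \<le> 4" using wt_support_nth by blast
  then show ?thesis
    using wt_lipschitz[of "u - v" u] wt_le_1[of "u - v"] wt_nonneg[of u] by (auto simp: min_def)
qed

text \<open>What is left inside the energy once r is integrated last. For fixed r the average over u
  smooths f at a scale comparable to the |r_i|.\<close>

definition Phi :: "(real^'n \<Rightarrow> ennreal) \<Rightarrow> (nat \<Rightarrow> real) \<Rightarrow> real^'n \<Rightarrow> ennreal" where
  "Phi f r z = (\<integral>\<^sup>+ u. ennreal (wt u) * f (z + bscale b r u) \<partial>lborel)"

lemma measurable_Phi [measurable (raw)]:
  assumes [measurable]: "f \<in> borel_measurable borel" "g \<in> measurable M (plane_measure l)" "h \<in> borel_measurable M"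
  shows "(\<lambda>x. Phi f (g x) (h x)) \<in> borel_measurable M"
  unfolding Phi_def by measurable

text \<open>The value at 0 is infinite, so that the estimates below need no exceptional null set.\<close>

definition inv_powr :: "real \<Rightarrow> real \<Rightarrow> ennreal" where
  "inv_powr s x = (if x = 0 then \<infinity> else ennreal (\<bar>x\<bar> powr - s))"

lemma borel_measurable_inv_powr [measurable]: "inv_powr s \<in> borel_measurable borel"
  unfolding inv_powr_def by measurable

text \<open>Moving the base point by \<open>v\<close> is the same as moving the direction \<open>u\<close> by \<open>v / r\<close>, which the Lipschitz
  weight absorbs. All the decay in the argument comes from here.\<close>

lemma Phi_osc:
  assumes [measurable]: "f \<in> borel_measurable borel" and M: "\<And>z. f z \<le> ennreal M" "M \<ge> 0"
    and s: "0 < s" "s \<le> 1" and d: "\<delta> > 0" and v: "\<And>k. \<bar>v $ k\<bar> \<le> \<delta>"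
    and [measurable]: "r \<in> space (plane_measure l)"
  shows "Phi f r (z + v) \<le> Phi f r z
     + ennreal (M * 8 ^ CARD('n) * \<delta> powr s) * (\<Sum>k\<in>UNIV. inv_powr s (r (b k)))"
proof (cases "\<exists>k. r (b k) = 0")
  case True
  then obtain k where k: "r (b k) = 0" by blast
  have inf: "(\<Sum>k\<in>UNIV. inv_powr s (r (b k))) = \<infinity>"
    using k by (auto simp: inv_powr_def ennreal_sum_eq_top)
  show ?thesis
  \<comment> \<open>In \<open>ennreal\<close>, 0 times infinity is 0, so the infinite sum settles
    the claim only for M \<noteq> 0. For M = 0 the function f vanishes.\<close>
  proof (cases "M = 0")
    case True
    then have "f z = 0" for z using M(1)[of z] by simp
    then show ?thesis by (simp add: Phi_def)
  next
    case False
    then have "M * 8 ^ CARD('n) * \<delta> powr s > 0" using M(2) d by simp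
    then have "ennreal (M * 8 ^ CARD('n) * \<delta> powr s) \<noteq> 0" by (simp add: ennreal_eq_0_iff not_le)
    then show ?thesis unfolding inf by (simp add: ennreal_mult_top)
  qed
next
  case False
  then have nz: "r (b k) \<noteq> 0" for k by auto
  define w :: "real^'n" where "w = (\<chi> k. v $ k / r (b k))"
  have w: "bscale b r w = v" using nz by (simp add: vec_eq_iff w_def)
  have bs: "bscale b r (u + w) = bscale b r u + v" for u
    unfolding w[symmetric] by (simp add: vec_eq_iff algebra_simps)
  let ?Q = "{w :: real^'n. \<forall>k. \<bar>w $ k\<bar> \<le> 4}"
  have "Phi f r (z + v) = (\<integral>\<^sup>+ u. (\<lambda>u. ennreal (wt (u - w)) * f (z + bscale b r u)) (u + w) \<partial>lborel)"
    unfolding Phi_def by (simp add: bs algebra_simps)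
  also have "\<dots> = (\<integral>\<^sup>+ u. ennreal (wt (u - w)) * f (z + bscale b r u) \<partial>lborel)"
    by (rule nn_integral_lborel_shift) measurable
  also have "\<dots> \<le> (\<integral>\<^sup>+ u. ennreal (wt u) * f (z + bscale b r u)
      + ennreal (M * min 1 (norm w)) * indicator ?Q (u - w) \<partial>lborel)"
  proof (rule nn_integral_mono)
    fix u
    have "ennreal (wt (u - w)) \<le> ennreal (wt u) + ennreal (min 1 (norm w)) * indicator ?Q (u - w)"
    proof (cases "u - w \<in> ?Q")
      case True
      then show ?thesis using wt_shift_le[of u w] wt_nonneg[of u]
        by (simp add: ennreal_plus[symmetric] ennreal_leI del: ennreal_plus)
    next
      case False
      then show ?thesis using wt_shift_le[of u w] by (simp add: ennreal_leI)
    qed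
    then have "ennreal (wt (u - w)) * f (z + bscale b r u)
       \<le> (ennreal (wt u) + ennreal (min 1 (norm w)) * indicator ?Q (u - w)) * f (z + bscale b r u)"
      by (rule mult_right_mono) simp
    also have "\<dots> \<le> ennreal (wt u) * f (z + bscale b r u)
         + (ennreal (min 1 (norm w)) * indicator ?Q (u - w)) * ennreal M"
      unfolding distrib_right by (intro add_mono mult_left_mono M) auto
    also have "(ennreal (min 1 (norm w)) * indicator ?Q (u - w)) * ennreal M
       = ennreal (M * min 1 (norm w)) * indicator ?Q (u - w)"
      using M(2) by (simp add: ennreal_mult mult_ac)
    finally show "ennreal (wt (u - w)) * f (z + bscale b r u) \<le> ennreal (wt u) * f (z + bscale b r u)
         + ennreal (M * min 1 (norm w)) * indicator ?Q (u - w)" .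
  qed
  also have "\<dots> = Phi f r z + ennreal (M * min 1 (norm w)) * (\<integral>\<^sup>+ u. indicator ?Q (u - w) \<partial>lborel)"
    by (simp add: nn_integral_add nn_integral_cmult Phi_def)
  also have "(\<integral>\<^sup>+ u. indicator ?Q (u - w) \<partial>lborel) = ennreal (8 ^ CARD('n))"
    using nn_integral_lborel_shift[of "indicator ?Q" "- w"] emeasure_cube[of 4, where 'n='n] by simp
  also have "ennreal (M * min 1 (norm w)) * ennreal (8 ^ CARD('n))
     \<le> ennreal (M * 8 ^ CARD('n) * \<delta> powr s) * (\<Sum>k\<in>UNIV. inv_powr s (r (b k)))"
  proof -
    have "min 1 (norm w) \<le> min 1 (\<Sum>k\<in>UNIV. \<delta> * (1 / \<bar>r (b k)\<bar>))"
    proof -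
      have "norm w \<le> (\<Sum>k\<in>UNIV. \<bar>w $ k\<bar>)" by (rule norm_le_l1_cart)
      also have "\<dots> \<le> (\<Sum>k\<in>UNIV. \<delta> * (1 / \<bar>r (b k)\<bar>))"
        using v by (intro sum_mono) (auto simp: w_def abs_divide intro!: divide_right_mono)
      finally show ?thesis by auto
    qed
    also have "\<dots> \<le> (\<Sum>k\<in>UNIV. (\<delta> * (1 / \<bar>r (b k)\<bar>)) powr s)"
      using d s by (intro min_one_sum_le_powr) auto
    also have "\<dots> = \<delta> powr s * (\<Sum>k\<in>UNIV. \<bar>r (b k)\<bar> powr - s)"
      unfolding sum_distrib_left using d nz
      by (intro sum.cong refl) (simp add: powr_mult powr_divide powr_minus_divide)
    finally have m: "min 1 (norm w) \<le> \<delta> powr s * (\<Sum>k\<in>UNIV. \<bar>r (b k)\<bar> powr - s)" .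
    have "(\<Sum>k\<in>UNIV. inv_powr s (r (b k))) = ennreal (\<Sum>k\<in>UNIV. \<bar>r (b k)\<bar> powr - s)"
      using nz by (simp add: inv_powr_def sum_ennreal)
    then show ?thesis
      using m M(2) by (auto simp: ennreal_mult'[symmetric] sum_nonneg mult_ac intro!: ennreal_leI mult_left_mono)
  qed
  finally show ?thesis by (simp add: add_left_mono)
qed

text \<open>Two points of the cube [-3, 3]^d differ by at most 6 in each coordinate, hence by at
  most 6 d in norm. Since the blocks of u have norm at least 1 where the weight lives, this bounds
  every |r_i|.\<close>

definition rbound :: real where "rbound = 6 * real CARD('n)"

definition rbox :: "(nat \<Rightarrow> real) \<Rightarrow> ennreal" where
  "rbox r = (\<Prod>i<l. indicator {- rbound..rbound} (r i))"

lemma borel_measurable_rbox [measurable]: "rbox \<in> borel_measurable (plane_measure l)"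
  unfolding rbox_def[abs_def] by (rule measurable_prod_indicator_plane) simp

text \<open>The unit ball lies in [-1, 1]^d, and each of at most two smoothings enlarges the support
  by at most 1 in every coordinate.\<close>

definition supp3 :: "(real^'n \<Rightarrow> ennreal) \<Rightarrow> bool" where
  "supp3 f \<longleftrightarrow> (\<forall>z k. f z \<noteq> 0 \<longrightarrow> \<bar>z $ k\<bar> \<le> 3)"

lemma rbox_eq_1:
  assumes "wt u \<noteq> 0" "\<And>k. \<bar>z $ k\<bar> \<le> 3" "\<And>k. \<bar>(z + bscale b r u) $ k\<bar> \<le> 3"
  shows "rbox r = 1"
proof -
  have "\<bar>r i\<bar> \<le> rbound" if "i < l" for i
  proof -
    have "\<bar>r i\<bar> * 1 \<le> \<bar>r i\<bar> * norm (block_proj b i u)"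
      using wt_support(1)[OF assms(1) that] by (intro mult_left_mono) auto
    also have "\<dots> = norm (block_proj b i (bscale b r u))"
      by (simp add: block_proj_bscale)
    also have "\<dots> \<le> norm (bscale b r u)" by (rule norm_block_proj_le)
    also have "\<dots> \<le> (\<Sum>k\<in>UNIV. \<bar>bscale b r u $ k\<bar>)" by (rule norm_le_l1_cart)
    also have "\<dots> \<le> (\<Sum>k\<in>(UNIV::'n set). 6)"
    proof (rule sum_mono)
      fix k show "\<bar>bscale b r u $ k\<bar> \<le> 6"
        using assms(2)[of k] assms(3)[of k] by (simp del: bscale_nth)
    qed
    finally show ?thesis by (simp add: rbound_def)
  qed
  then show ?thesis by (auto simp: rbox_def abs_le_iff minus_le_iff intro!: prod.neutral)
qed

lemma nn_integral_inv_powr: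
  assumes "s < 1"
  shows "(\<integral>\<^sup>+ x. indicator {- rbound..rbound} x * inv_powr s x \<partial>lborel) < \<infinity>"
proof -
  have R: "rbound > 0" by (simp add: rbound_def)
  have hi: "((\<lambda>x. x powr - s) has_integral (rbound powr (- s + 1) / (- s + 1))) {0..rbound}"
    using assms R by (intro has_integral_powr_from_0) auto
  have nn: "(\<integral>\<^sup>+ x. indicator {0..rbound} x * ennreal (x powr - s) \<partial>lborel) = ennreal (rbound powr (- s + 1) / (- s + 1))"
  proof -
    have "((\<lambda>x. indicator {0..rbound} x * x powr - s) has_integral (rbound powr (- s + 1) / (- s + 1))) UNIV"
    proof -
      have "(\<lambda>x. indicator {0..rbound} x * x powr - s) = (\<lambda>x. if x \<in> {0..rbound} then x powr - s else 0)"
        by (auto simp: indicator_def)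
      then show ?thesis using hi by (simp only: has_integral_restrict_UNIV)
    qed
    then have "(\<integral>\<^sup>+ x. ennreal (indicator {0..rbound} x * x powr - s) \<partial>lborel) = ennreal (rbound powr (- s + 1) / (- s + 1))"
      by (intro nn_integral_has_integral_lborel) auto
    then show ?thesis
      by (simp add: ennreal_mult' ennreal_indicator)
  qed
  have "(\<integral>\<^sup>+ x. indicator {- rbound..rbound} x * inv_powr s x \<partial>lborel)
     = (\<integral>\<^sup>+ x. indicator {- rbound..rbound} x * ennreal (\<bar>x\<bar> powr - s) \<partial>lborel)"
  proof (rule nn_integral_cong_AE)
    show "AE x in lborel. indicator {- rbound..rbound} x * inv_powr s x = indicator {- rbound..rbound} x * ennreal (\<bar>x\<bar> powr - s)"
      using AE_lborel_singleton[of "0::real"] by eventually_elim (simp add: inv_powr_def)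
  qed
  also have "\<dots> \<le> (\<integral>\<^sup>+ x. indicator {0..rbound} x * ennreal (x powr - s)
      + indicator {0..rbound} (- x) * ennreal ((- x) powr - s) \<partial>lborel)"
    by (rule nn_integral_mono) (auto simp: indicator_def)
  also have "\<dots> = (\<integral>\<^sup>+ x. indicator {0..rbound} x * ennreal (x powr - s) \<partial>lborel)
      + (\<integral>\<^sup>+ x. indicator {0..rbound} (- x) * ennreal ((- x) powr - s) \<partial>lborel)"
    by (intro nn_integral_add) auto
  also have "(\<integral>\<^sup>+ x. indicator {0..rbound} (- x) * ennreal ((- x) powr - s) \<partial>lborel)
     = (\<integral>\<^sup>+ x. indicator {0..rbound} x * ennreal (x powr - s) \<partial>lborel)"
    using nn_integral_real_affine[of "\<lambda>x. indicator {0..rbound} x * ennreal (x powr - s)" "-1" 0] by simp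
  also note nn
  finally show ?thesis by (rule le_less_trans) (simp add: less_top[symmetric])
qed

definition inv_powr_const :: "real \<Rightarrow> real" where
  "inv_powr_const s = enn2real (\<integral>\<^sup>+ r. rbox r * (\<Sum>k\<in>UNIV. inv_powr s (r (b k))) \<partial>plane_measure l)"

lemma nn_integral_rbox_inv_powr:
  assumes "s < 1"
  shows "(\<integral>\<^sup>+ r. rbox r * (\<Sum>k\<in>UNIV. inv_powr s (r (b k))) \<partial>plane_measure l) = ennreal (inv_powr_const s)"
proof -
  interpret product_sigma_finite "\<lambda>_::nat. lborel :: real measure" by standard
  have fin: "(\<integral>\<^sup>+ r. rbox r * inv_powr s (r (b k)) \<partial>plane_measure l) < \<infinity>" for k
  proof -
    \<comment> \<open>Only the block of k carries the singular factor, so the integral splits into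
      one-dimensional integrals.\<close>
    let ?g = "\<lambda>i x. indicator {- rbound..rbound} x * (if i = b k then inv_powr s x else 1)"
    have "rbox r * inv_powr s (r (b k)) = (\<Prod>i<l. ?g i (r i))" for r
      unfolding prod.distrib rbox_def using b_less[of k] by (simp add: prod.delta')
    then have "(\<integral>\<^sup>+ r. rbox r * inv_powr s (r (b k)) \<partial>plane_measure l) = (\<Prod>i<l. \<integral>\<^sup>+ x. ?g i x \<partial>lborel)"
      by (simp only: plane_measure_def) (intro product_nn_integral_prod; auto)
    also have "\<dots> < \<infinity>"
    proof -
      have "(\<integral>\<^sup>+ x. ?g i x \<partial>lborel) \<noteq> top" for i
        using nn_integral_inv_powr[OF assms] by (cases "i = b k") (auto simp: less_top[symmetric] rbound_def)
      then show ?thesis by (auto simp: less_top[symmetric] ennreal_prod_eq_top)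
    qed
    finally show ?thesis .
  qed
  have "(\<integral>\<^sup>+ r. rbox r * (\<Sum>k\<in>UNIV. inv_powr s (r (b k))) \<partial>plane_measure l)
     = (\<Sum>k\<in>UNIV. \<integral>\<^sup>+ r. rbox r * inv_powr s (r (b k)) \<partial>plane_measure l)"
    unfolding sum_distrib_left by (rule nn_integral_sum) measurable
  also have "\<dots> < \<infinity>" using fin by (simp add: less_top[symmetric])
  finally show ?thesis by (simp add: inv_powr_const_def less_top[symmetric])
qed

text \<open>Up to the weight, the energy is the pairing of \<open>f\<close> and \<open>g\<close> through the product Riesz kernel with
  entries \<open>|w_i|\<close> to the power \<open>1 - d_i\<close>, which is never computed.\<close>

definition energy :: "(real^'n \<Rightarrow> ennreal) \<Rightarrow> (real^'n \<Rightarrow> ennreal) \<Rightarrow> ennreal" where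
  "energy f g = (\<integral>\<^sup>+ u. ennreal (wt u) * (\<integral>\<^sup>+ z. f z * Xray g u z \<partial>lborel) \<partial>lborel)"

text \<open>By \<open>rbox_eq_1\<close> the factor \<open>rbox r\<close> is 1 wherever the integrand
  is nonzero, so it may be inserted, and three uses of Fubini bring r outermost. The truncation
  matters because |r|^-s with s < 1 is integrable near 0 but not at infinity.\<close>

lemma energy_eq_Phi:
  assumes [measurable]: "f \<in> borel_measurable borel" "g \<in> borel_measurable borel"
    and "supp3 f" "supp3 g"
  shows "energy f g = (\<integral>\<^sup>+ r. rbox r * (\<integral>\<^sup>+ z. f z * Phi g r z \<partial>lborel) \<partial>plane_measure l)"
proof -
  interpret p1: pair_sigma_finite "lborel :: (real^'n) measure" "plane_measure l" by standard
  let ?F = "\<lambda>u z r. rbox r * (f z * (ennreal (wt u) * g (z + bscale b r u)))"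
  have r: "ennreal (wt u) * f z * g (z + bscale b r u) = ?F u z r" for u z r
  proof (cases "wt u = 0 \<or> f z = 0 \<or> g (z + bscale b r u) = 0")
    case False
    then have "rbox r = 1" using rbox_eq_1[of u z r] assms(3,4) unfolding supp3_def by blast
    then show ?thesis by (simp add: mult_ac)
  qed auto
  have "energy f g = (\<integral>\<^sup>+ u. \<integral>\<^sup>+ z. \<integral>\<^sup>+ r. ?F u z r \<partial>plane_measure l \<partial>lborel \<partial>lborel)"
    unfolding energy_def Xray_def r[symmetric]
    by (simp add: nn_integral_cmult[symmetric] mult.assoc)
  also have "\<dots> = (\<integral>\<^sup>+ u. \<integral>\<^sup>+ r. \<integral>\<^sup>+ z. ?F u z r \<partial>lborel \<partial>plane_measure l \<partial>lborel)"
    by (intro nn_integral_cong p1.Fubini'[symmetric]) measurable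
  also have "\<dots> = (\<integral>\<^sup>+ r. \<integral>\<^sup>+ u. \<integral>\<^sup>+ z. ?F u z r \<partial>lborel \<partial>lborel \<partial>plane_measure l)"
    by (intro p1.Fubini'[symmetric]) measurable
  also have "\<dots> = (\<integral>\<^sup>+ r. \<integral>\<^sup>+ z. \<integral>\<^sup>+ u. ?F u z r \<partial>lborel \<partial>lborel \<partial>plane_measure l)"
    by (intro nn_integral_cong lborel_pair.Fubini') measurable
  also have "\<dots> = (\<integral>\<^sup>+ r. rbox r * (\<integral>\<^sup>+ z. f z * Phi g r z \<partial>lborel) \<partial>plane_measure l)"
  proof (rule nn_integral_cong)
    fix r assume [measurable]: "r \<in> space (plane_measure l)"
    show "(\<integral>\<^sup>+ z. \<integral>\<^sup>+ u. ?F u z r \<partial>lborel \<partial>lborel) = rbox r * (\<integral>\<^sup>+ z. f z * Phi g r z \<partial>lborel)"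
      unfolding Phi_def by (simp add: nn_integral_cmult)
  qed
  finally show ?thesis .
qed

text \<open>Pairing \<open>smooth \<mu> j\<close> with a function means integrating its
  \<open>conv j\<close> against \<mu>. Both \<open>conv j\<close> and \<open>conv j'\<close> of
  \<open>Phi f r\<close> stay within its oscillation at scale 2^-i, once each, whence the factor 2.
  Changing the scale of one argument thus gains 2^(-s i), and only the height of the other argument
  is paid.\<close>

lemma energy_smooth_le:
  assumes \<mu>: "finite_borel \<mu>" "emeasure \<mu> UNIV \<le> 1" and sp: "supp3 (smooth \<mu> j)" "supp3 (smooth \<mu> j')"
    and f: "f \<in> borel_measurable borel" "supp3 f" and M: "\<And>z. f z \<le> ennreal M" "M \<ge> 0"
    and s: "0 < s" "s < 1" and jj: "i \<le> j" "i \<le> j'"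
  shows "energy (smooth \<mu> j) f \<le> energy (smooth \<mu> j') f
      + ennreal (2 * 8 ^ CARD('n) * inv_powr_const s * M * (1/2) powr (s * i))"
proof -
  interpret finite_borel \<mu> by fact
  note f(1)[measurable]
  define e where "e r = ennreal (M * 8 ^ CARD('n) * ((1/2) ^ i) powr s) * (\<Sum>k\<in>UNIV. inv_powr s (r (b k)))" for r
  have [measurable]: "e \<in> borel_measurable (plane_measure l)" unfolding e_def by measurable
  have osc: "Phi f r (z + v) \<le> Phi f r z + e r" if "i \<le> m" "\<And>k. \<bar>v $ k\<bar> \<le> (1/2) ^ m"
    "r \<in> space (plane_measure l)" for r z v m
  proof -
    have "(1/2::real) ^ m \<le> (1/2) ^ i" using that(1) by (intro power_decreasing) auto
    then have "\<bar>v $ k\<bar> \<le> (1/2) ^ i" for k using that(2)[of k] by linarith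
    then show ?thesis unfolding e_def using that(3) s
      by (intro Phi_osc f M) auto
  qed
  have c: "conv j (Phi f r) z \<le> conv j' (Phi f r) z + 2 * e r" if [measurable]: "r \<in> space (plane_measure l)" for r z
  proof -
    have [measurable]: "Phi f r \<in> borel_measurable borel"
      by (rule measurable_Phi[where g = "\<lambda>_. r" and h="\<lambda>x. x"]) auto
    have "conv j (Phi f r) z \<le> Phi f r z + e r"
      by (rule nn_integral_conv_osc(1)) (auto intro!: osc[of j] jj that)
    also have "\<dots> \<le> (conv j' (Phi f r) z + e r) + e r"
      by (intro add_right_mono nn_integral_conv_osc(2)) (auto intro!: osc[of j'] jj that)
    finally show ?thesis by (simp add: mult_2 add.assoc)
  qed
  have *: "energy (smooth \<mu> m) f = (\<integral>\<^sup>+ r. rbox r * (\<integral>\<^sup>+ x. conv m (Phi f r) x \<partial>\<mu>) \<partial>plane_measure l)"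
    if "supp3 (smooth \<mu> m)" for m
    by (subst energy_eq_Phi) (auto simp: that f nn_integral_smooth_mult intro!: nn_integral_cong)
  have sp1: "space \<mu> = UNIV" using sets_eq_imp_space_eq[OF sets_eq] by simp
  have "energy (smooth \<mu> j) f \<le> (\<integral>\<^sup>+ r. rbox r * (\<integral>\<^sup>+ x. conv j' (Phi f r) x + 2 * e r \<partial>\<mu>) \<partial>plane_measure l)"
    unfolding *[OF sp(1)] by (intro nn_integral_mono mult_left_mono c) auto
  also have "\<dots> \<le> (\<integral>\<^sup>+ r. rbox r * (\<integral>\<^sup>+ x. conv j' (Phi f r) x \<partial>\<mu>) + 2 * (rbox r * e r) \<partial>plane_measure l)"
  proof (rule nn_integral_mono)
    fix r assume r: "r \<in> space (plane_measure l)"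
    have [measurable]: "Phi f r \<in> borel_measurable borel"
      by (rule measurable_Phi[where g = "\<lambda>_. r" and h="\<lambda>x. x"]) (auto simp: r)
    have "(\<integral>\<^sup>+ x. conv j' (Phi f r) x + 2 * e r \<partial>\<mu>) = (\<integral>\<^sup>+ x. conv j' (Phi f r) x \<partial>\<mu>) + 2 * e r * emeasure \<mu> UNIV"
      by (subst nn_integral_add) (auto simp: sp1)
    also have "\<dots> \<le> (\<integral>\<^sup>+ x. conv j' (Phi f r) x \<partial>\<mu>) + 2 * e r * 1"
      by (intro add_left_mono mult_left_mono \<mu>) auto
    finally have "rbox r * (\<integral>\<^sup>+ x. conv j' (Phi f r) x + 2 * e r \<partial>\<mu>) \<le> rbox r * ((\<integral>\<^sup>+ x. conv j' (Phi f r) x \<partial>\<mu>) + 2 * e r * 1)"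
      by (rule mult_left_mono) simp
    then show "rbox r * (\<integral>\<^sup>+ x. conv j' (Phi f r) x + 2 * e r \<partial>\<mu>) \<le> rbox r * (\<integral>\<^sup>+ x. conv j' (Phi f r) x \<partial>\<mu>) + 2 * (rbox r * e r)"
      by (simp add: distrib_left mult_ac)
  qed
  also have "\<dots> = energy (smooth \<mu> j') f + 2 * (\<integral>\<^sup>+ r. rbox r * e r \<partial>plane_measure l)"
  proof -
    have "(\<lambda>r. \<integral>\<^sup>+ x. conv j' (Phi f r) x \<partial>\<mu>) \<in> borel_measurable (plane_measure l)"
      unfolding conv_def by measurable
    then show ?thesis unfolding *[OF sp(2)] by (simp add: nn_integral_add nn_integral_cmult)
  qed
  also have "(\<integral>\<^sup>+ r. rbox r * e r \<partial>plane_measure l) = ennreal (M * 8 ^ CARD('n) * ((1/2) ^ i) powr s) * ennreal (inv_powr_const s)"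
    unfolding nn_integral_rbox_inv_powr[OF s(2), symmetric] e_def
    by (subst nn_integral_cmult[symmetric]) (auto simp: mult_ac intro!: nn_integral_cong)
  also have "2 * (ennreal (M * 8 ^ CARD('n) * ((1/2) ^ i) powr s) * ennreal (inv_powr_const s))
     = ennreal (2 * 8 ^ CARD('n) * inv_powr_const s * M * (1/2) powr (s * i))"
  proof -
    have "((1/2::real) ^ i) powr s = (1/2) powr (s * i)"
      by (simp add: powr_realpow[symmetric] powr_powr mult.commute)
    moreover have "inv_powr_const s \<ge> 0" by (simp add: inv_powr_const_def)
    ultimately show ?thesis using M(2)
      by (simp add: ennreal_mult'[symmetric] ennreal_numeral[symmetric] mult_ac del: ennreal_numeral)
  qed
  finally show ?thesis .
qed

end

section \<open>Frostman measures and energy differences\<close>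

text \<open>Since \<open>enn2real\<close> sends infinity to 0, this is a distance only between
  finite arguments. Its value is always finite.\<close>

definition adiff :: "ennreal \<Rightarrow> ennreal \<Rightarrow> ennreal" where
  "adiff x y = ennreal \<bar>enn2real x - enn2real y\<bar>"

lemma measurable_adiff [measurable (raw)]:
  assumes [measurable]: "f \<in> borel_measurable M" "g \<in> borel_measurable M"
  shows "(\<lambda>x. adiff (f x) (g x)) \<in> borel_measurable M"
  unfolding adiff_def by measurable

text \<open>The cross term stays on the left because subtraction in \<open>ennreal\<close> is
  truncated.\<close>

lemma adiff_sq:
  assumes "x \<noteq> \<infinity>" "y \<noteq> \<infinity>"
  shows "adiff x y * adiff x y + 2 * (x * y) = x * x + y * y"
proof -
  obtain a c where ac: "x = ennreal a" "0 \<le> a" "y = ennreal c" "0 \<le> c"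
    using assms by (cases x; cases y) auto
  have "\<bar>a - c\<bar> * \<bar>a - c\<bar> + 2 * (a * c) = a * a + c * c"
    by (simp add: abs_mult_self_eq algebra_simps)
  then have "ennreal (\<bar>a - c\<bar> * \<bar>a - c\<bar> + 2 * (a * c)) = ennreal (a * a + c * c)" by (rule arg_cong)
  then have "ennreal \<bar>a - c\<bar> * ennreal \<bar>a - c\<bar> + 2 * (ennreal a * ennreal c) = ennreal a * ennreal a + ennreal c * ennreal c"
    using ac by (simp only: ennreal_mult ennreal_plus ennreal_numeral abs_ge_zero mult_nonneg_nonneg zero_le_numeral)
  then show ?thesis
    using ac by (simp add: adiff_def)
qed

lemma le_add_adiff: "x \<noteq> \<infinity> \<Longrightarrow> y \<noteq> \<infinity> \<Longrightarrow> x \<le> y + adiff x y"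
  by (cases x; cases y) (auto simp: adiff_def ennreal_plus[symmetric] simp del: ennreal_plus intro!: ennreal_leI)

lemma ennreal_am_gm:
  assumes "x \<noteq> \<infinity>" "y \<noteq> \<infinity>" "a > 0"
  shows "2 * (x * y) \<le> ennreal a * (x * x) + ennreal (1 / a) * (y * y)"
proof -
  obtain g n where gn: "x = ennreal g" "0 \<le> g" "y = ennreal n" "0 \<le> n"
    using assms by (cases x; cases y) auto
  have "2 * (g * n) = 2 * (sqrt a * g) * (n / sqrt a)" using assms(3) by simp
  also have "\<dots> \<le> (sqrt a * g)\<^sup>2 + (n / sqrt a)\<^sup>2" by (rule sum_squares_bound)
  also have "\<dots> = a * (g * g) + 1 / a * (n * n)"
    using assms(3) by (simp add: power_mult_distrib power_divide power2_eq_square[of g] power2_eq_square[of n])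
  finally have "ennreal (2 * (g * n)) \<le> ennreal (a * (g * g) + 1 / a * (n * n))" by (rule ennreal_leI)
  moreover have "ennreal (2 * (g * n)) = 2 * (x * y)"
    "ennreal (a * (g * g) + 1 / a * (n * n)) = ennreal a * (x * x) + ennreal (1 / a) * (y * y)"
    using gn assms(3) ennreal_mult[of "1 / a" "n * n"] by (simp_all add: ennreal_mult)
  ultimately show ?thesis by simp
qed

text \<open>The cross term is absorbed by the arithmetic-geometric mean inequality. A small a keeps
  the factor of y^2 close to 1 and charges 1/a to d^2.\<close>

lemma ennreal_sq_le_weighted:
  assumes "x \<le> y + d" "y \<noteq> \<infinity>" "d \<noteq> \<infinity>" "a > 0"
  shows "x * x \<le> ennreal (1 + a) * (y * y) + ennreal (1 + 1 / a) * (d * d)"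
proof -
  have "x * x \<le> (y + d) * (y + d)" by (intro mult_mono assms(1)) auto
  also have "\<dots> = y * y + d * d + 2 * (y * d)"
    by (simp only: distrib_left distrib_right mult_2 add_ac mult.commute[of d y])
  also have "\<dots> \<le> y * y + d * d + (ennreal a * (y * y) + ennreal (1 / a) * (d * d))"
    by (intro add_left_mono ennreal_am_gm assms)
  also have "\<dots> = ennreal (1 + a) * (y * y) + ennreal (1 + 1 / a) * (d * d)"
    using assms(4) by (simp add: ennreal_plus distrib_right add_ac)
  finally show ?thesis .
qed

lemma ennreal_weight_eq:
  fixes a c e f w :: ennreal
  assumes "a + 2 * c = e + f"
  shows "w * a + 2 * (w * c) = w * e + w * f"
proof -
  have "w * a + 2 * (w * c) = w * (a + 2 * c)" by (simp add: distrib_left mult.left_commute[of w 2 c])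
  also have "\<dots> = w * e + w * f" unfolding assms by (rule distrib_left)
  finally show ?thesis .
qed

lemma ennreal_weight_le:
  fixes a c e f g w :: ennreal
  assumes "a \<le> c * e + f * g"
  shows "w * a \<le> c * (w * e) + f * (w * g)"
proof -
  have "w * a \<le> w * (c * e + f * g)" by (rule mult_left_mono[OF assms]) simp
  also have "\<dots> = c * (w * e) + f * (w * g)" by (simp add: distrib_left mult.left_commute[of w])
  finally show ?thesis .
qed

text \<open>The normalized situation: unit ball and Frostman constant 1. General measures are
  brought here by rescaling, so that the constants depend on the exponents and the blocks
  alone.\<close>

locale frostman = finite_borel \<mu> for \<mu> :: "(real^'n::finite) measure" +
  fixes \<alpha> :: real
  assumes in_ball: "AE x in \<mu>. x \<in> ball 0 1"
    and ball_le: "r > 0 \<Longrightarrow> emeasure \<mu> (ball x r) \<le> ennreal (r powr \<alpha>)"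
    and exponent_nonneg: "0 \<le> \<alpha>"
begin

lemma space_eq [simp]: "space \<mu> = UNIV"
  using sets_eq_imp_space_eq[OF sets_eq] by simp

lemma emeasure_UNIV_le: "emeasure \<mu> UNIV \<le> 1"
proof -
  have "emeasure \<mu> UNIV = emeasure \<mu> (ball 0 1)"
    using in_ball by (intro emeasure_eq_AE) auto
  then show ?thesis using ball_le[of 1 0] by simp
qed

lemma smooth_support:
  assumes "smooth \<mu> j z \<noteq> 0"
  shows "\<bar>z $ k\<bar> \<le> 2"
proof (rule ccontr)
  assume n: "\<not> \<bar>z $ k\<bar> \<le> 2"
  have "AE x in \<mu>. bump j (z - x) = 0"
    using in_ball
  proof eventually_elim
    case (elim x)
    then have "\<bar>x $ k\<bar> < 1" using component_le_norm_cart[of x k] by simp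
    then have "\<bar>(z - x) $ k\<bar> > 1" using n by auto
    moreover have "(1/2::real) ^ j \<le> 1" by (simp add: power_le_one)
    ultimately show ?case by (intro bump_eq_0[of _ k]) auto
  qed
  then have "smooth \<mu> j z = (\<integral>\<^sup>+ x. 0 \<partial>\<mu>)"
    unfolding smooth_def by (rule nn_integral_cong_AE)
  then show False using assms by simp
qed

text \<open>The mass bound (2 d 2^-j)^\<alpha> for a ball containing the cube of the bump, times the
  bound 2^(j d) for the value of the bump.\<close>

definition height :: "nat \<Rightarrow> real" where
  "height j = (2 * real CARD('n)) powr \<alpha> * 2 powr (real j * (real CARD('n) - \<alpha>))"

lemma height_nonneg: "0 \<le> height j" by (simp add: height_def)

lemma height_Suc: "height (Suc j) \<le> 2 ^ CARD('n) * height j"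
proof -
  have "height (Suc j) = 2 powr (real CARD('n) - \<alpha>) * height j"
    by (simp add: height_def algebra_simps powr_add[symmetric] powr_diff)
  also have "\<dots> \<le> 2 powr (real CARD('n)) * height j"
    using exponent_nonneg height_nonneg by (intro mult_right_mono) auto
  finally show ?thesis by (simp add: powr_realpow)
qed

lemma smooth_le: "smooth \<mu> j z \<le> ennreal (height j)"
proof -
  let ?d = "CARD('n)"
  have dpos: "0 < real ?d" by simp
  have "smooth \<mu> j z \<le> (\<integral>\<^sup>+ x. ennreal ((2 ^ j / 2) ^ ?d) * indicator (ball z (2 * real ?d * (1/2) ^ j)) x \<partial>\<mu>)"
    unfolding smooth_def
  proof (rule nn_integral_mono)
    fix x
    show "bump j (z - x) \<le> ennreal ((2 ^ j / 2) ^ ?d) * indicator (ball z (2 * real ?d * (1/2) ^ j)) x"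
    proof (cases "\<forall>k. \<bar>(z - x) $ k\<bar> \<le> (1/2) ^ j")
      case True
      have "norm (z - x) \<le> (\<Sum>k\<in>UNIV. \<bar>(z - x) $ k\<bar>)" by (rule norm_le_l1_cart)
      also have "\<dots> \<le> (\<Sum>k\<in>(UNIV::'n set). (1/2) ^ j)" using True by (intro sum_mono) blast
      also have "\<dots> = real ?d * (1/2) ^ j" by simp
      \<comment> \<open>The extra factor 2 makes the inequality strict, as membership in the open
        ball requires.\<close>
      also have "\<dots> < 2 * real ?d * (1/2) ^ j" using dpos by simp
      finally show ?thesis by (simp add: bump_def indicator_def dist_norm)
    next
      case False
      then show ?thesis using bump_eq_0[of "z - x"] by auto
    qed
  qed
  also have "\<dots> = ennreal ((2 ^ j / 2) ^ ?d) * emeasure \<mu> (ball z (2 * real ?d * (1/2) ^ j))"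
    by (rule nn_integral_cmult_indicator) simp
  also have "\<dots> \<le> ennreal ((2 ^ j / 2) ^ ?d) * ennreal ((2 * real ?d * (1/2) ^ j) powr \<alpha>)"
    by (intro mult_left_mono ball_le) auto
  also have "\<dots> = ennreal ((2 ^ j / 2) ^ ?d * (2 * real ?d * (1/2) ^ j) powr \<alpha>)"
    by (simp add: ennreal_mult)
  also have "\<dots> \<le> ennreal (height j)"
  proof (rule ennreal_leI)
    have "(2 ^ j / 2 :: real) ^ ?d \<le> (2 ^ j) ^ ?d" by (intro power_mono) auto
    also have "\<dots> = 2 powr (real j * real ?d)" by (simp add: powr_realpow[symmetric] powr_powr power_mult[symmetric])
    finally have 1: "(2 ^ j / 2 :: real) ^ ?d \<le> 2 powr (real j * real ?d)" .
    have "((1/2::real) ^ j) = 2 powr (- real j)" by (simp add: powr_minus powr_realpow power_one_over inverse_eq_divide)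
    then have 2: "(2 * real ?d * (1/2) ^ j) powr \<alpha> = (2 * real ?d) powr \<alpha> * 2 powr (- real j * \<alpha>)"
      by (simp only: powr_mult powr_powr)
    have "(2 ^ j / 2) ^ ?d * (2 * real ?d * (1/2) ^ j) powr \<alpha>
       \<le> 2 powr (real j * real ?d) * ((2 * real ?d) powr \<alpha> * 2 powr (- real j * \<alpha>))"
      unfolding 2 by (intro mult_right_mono 1) auto
    also have "\<dots> = height j" by (simp add: height_def algebra_simps powr_diff powr_minus powr_add divide_inverse)
    finally show "(2 ^ j / 2) ^ ?d * (2 * real ?d * (1/2) ^ j) powr \<alpha> \<le> height j" .
  qed
  finally show ?thesis .
qed

end

text \<open>Both sides are \<mu> convolved with the two even bumps. The identity lets the outer and
  the inner scale of a double smoothing exchange places.\<close>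

lemma conv_smooth_commute:
  assumes "finite_borel \<mu>"
  shows "conv i (smooth \<mu> j) z = conv j (smooth \<mu> i) (z :: real^'n::finite)"
proof -
  interpret finite_borel \<mu> by fact
  interpret p: pair_sigma_finite "lborel :: (real^'n) measure" \<mu> by standard
  define I where "I i j w = (\<integral>\<^sup>+ v. bump i v * bump j (w + v) \<partial>lborel)" for i j and w :: "real^'n"
  have I: "conv i (smooth \<mu> j) z = (\<integral>\<^sup>+ x. I i j (z - x) \<partial>\<mu>)" for i j
  proof -
    have "conv i (smooth \<mu> j) z = (\<integral>\<^sup>+ v. \<integral>\<^sup>+ x. bump i v * bump j (z + v - x) \<partial>\<mu> \<partial>lborel)"
      unfolding conv_def smooth_def by (simp add: nn_integral_cmult)
    also have "\<dots> = (\<integral>\<^sup>+ x. \<integral>\<^sup>+ v. bump i v * bump j (z + v - x) \<partial>lborel \<partial>\<mu>)"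
      by (rule p.Fubini'[symmetric]) measurable
    finally show ?thesis by (simp add: I_def algebra_simps)
  qed
  have "I i j w = I j i w" for w
  proof -
    have "I i j w = (\<integral>\<^sup>+ v. (\<lambda>v. bump i (v - w) * bump j v) (v + w) \<partial>lborel)"
      by (simp add: I_def add.commute)
    also have "\<dots> = (\<integral>\<^sup>+ v. bump i (v - w) * bump j v \<partial>lborel)"
      by (rule nn_integral_lborel_shift) measurable
    also have "\<dots> = (\<integral>\<^sup>+ v. bump i (- v - w) * bump j (- v) \<partial>lborel)"
    proof -
      have "(lborel :: (real^'n) measure) = distr lborel borel (\<lambda>v. - v)"
        using lborel_affine[of "-1" "0 :: real^'n"] by (simp add: density_1)
      then have "(\<integral>\<^sup>+ v. bump i (v - w) * bump j v \<partial>lborel)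
          = (\<integral>\<^sup>+ v. bump i (v - w) * bump j v \<partial>distr (lborel :: (real^'n) measure) borel (\<lambda>v. - v))"
        by (rule arg_cong)
      then show ?thesis by (subst (asm) nn_integral_distr) auto
    qed
    also have "\<dots> = I j i w"
      unfolding I_def using bump_minus[of i "w + v" for v]
      by (intro nn_integral_cong) (metis bump_minus minus_add_distrib add.commute mult.commute uminus_add_conv_diff diff_conv_add_uminus)
    finally show ?thesis .
  qed
  then show ?thesis unfolding I by simp
qed

section \<open>Size, symmetry and positivity of the energy form\<close>

context blocks
begin

lemma nn_integral_rbox: "(\<integral>\<^sup>+ r. rbox r \<partial>plane_measure l) = ennreal ((2 * rbound) ^ l)"
proof -
  interpret product_sigma_finite "\<lambda>_::nat. lborel :: real measure" by standard
  have "(\<integral>\<^sup>+ r. rbox r \<partial>plane_measure l) = (\<Prod>i<l. \<integral>\<^sup>+ x. indicator {- rbound..rbound} x \<partial>lborel)"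
    unfolding rbox_def plane_measure_def by (rule product_nn_integral_prod) auto
  also have "\<dots> = ennreal (2 * rbound) ^ l" by (simp add: rbound_def)
  finally show ?thesis by (simp add: ennreal_power rbound_def)
qed

text \<open>From a base point in the cube only the parameters in \<open>rbox\<close> reach the
  support, and their volume is (2 \<open>rbound\<close>)^l. Any other base point either sees nothing
  or can be moved along its own plane into the cube, by invariance.\<close>

lemma Xray_le:
  assumes [measurable]: "f \<in> borel_measurable borel" and f: "supp3 f" "\<And>z. f z \<le> ennreal M" and u: "wt u \<noteq> 0" and M: "0 \<le> M"
  shows "Xray f u z \<le> ennreal (M * (2 * rbound) ^ l)"
proof -
  have *: "Xray f u z \<le> ennreal (M * (2 * rbound) ^ l)" if z: "\<And>k. \<bar>z $ k\<bar> \<le> 3" for z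
  proof -
    have "Xray f u z \<le> (\<integral>\<^sup>+ r. ennreal M * rbox r \<partial>plane_measure l)"
      unfolding Xray_def
    proof (rule nn_integral_mono)
      fix r
      show "f (z + bscale b r u) \<le> ennreal M * rbox r"
      proof (cases "f (z + bscale b r u) = 0")
        case False
        then have "\<bar>(z + bscale b r u) $ k\<bar> \<le> 3" for k using f(1) unfolding supp3_def by blast
        then have "rbox r = 1" by (rule rbox_eq_1[OF u z])
        then show ?thesis using f(2) by simp
      qed simp
    qed
    also have "\<dots> = ennreal (M * (2 * rbound) ^ l)"
      using M by (simp add: nn_integral_cmult nn_integral_rbox ennreal_mult rbound_def)
    finally show ?thesis .
  qed
  show ?thesis
  proof (cases "\<exists>r. f (z + bscale b r u) \<noteq> 0")
    case True
    then obtain r where "f (z + bscale b r u) \<noteq> 0" by blast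
    then have "\<bar>(z + bscale b r u) $ k\<bar> \<le> 3" for k using f(1) unfolding supp3_def by blast
    then have "Xray f u (z + bscale b r u) \<le> ennreal (M * (2 * rbound) ^ l)" by (rule *)
    then show ?thesis by (simp add: Xray_invariant)
  next
    case False
    then show ?thesis by (simp add: Xray_def)
  qed
qed

text \<open>The plane integral of g is invariant along the planes, so on the fundamental domain f
  may be replaced by its own plane integral. In this form the energy is visibly symmetric and a sum
  of squares on the diagonal.\<close>

lemma energy_eq_slab:
  assumes [measurable]: "f \<in> borel_measurable borel" "g \<in> borel_measurable borel"
  shows "energy f g = (\<integral>\<^sup>+ u. ennreal (wt u) * (\<integral>\<^sup>+ z. slab u z * (Xray f u z * Xray g u z) \<partial>lborel) \<partial>lborel)"
  unfolding energy_def
proof (rule nn_integral_cong)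
  fix u
  show "ennreal (wt u) * (\<integral>\<^sup>+ z. f z * Xray g u z \<partial>lborel) =
      ennreal (wt u) * (\<integral>\<^sup>+ z. slab u z * (Xray f u z * Xray g u z) \<partial>lborel)"
  proof (cases "wt u = 0")
    case False
    then show ?thesis
      using nn_integral_invariant_mult[of "Xray g u" f u] wt_support_nonzero Xray_invariant
      by (simp add: mult.commute)
  qed simp
qed

lemma energy_commute:
  assumes "f \<in> borel_measurable borel" "g \<in> borel_measurable borel"
  shows "energy f g = energy g f"
  using assms by (simp add: energy_eq_slab mult.commute)

text \<open>The volumes 8^d and 6^d are those of the cubes carrying the weight and f. The bound
  gives the finiteness required to cancel energies, and the start of the induction on the
  scale.\<close>

lemma energy_le:
  assumes f[measurable]: "f \<in> borel_measurable borel" "supp3 f" "\<And>z. f z \<le> ennreal M" and M: "0 \<le> M"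
    and g[measurable]: "g \<in> borel_measurable borel" "supp3 g" "\<And>z. g z \<le> ennreal N" "0 \<le> N"
  shows "energy f g \<le> ennreal (8 ^ CARD('n) * (M * 6 ^ CARD('n) * (N * (2 * rbound) ^ l)))"
proof -
  let ?Q = "\<lambda>a. {z :: real^'n. \<forall>k. \<bar>z $ k\<bar> \<le> a}"
  let ?C = "M * (N * (2 * rbound) ^ l)"
  have C: "0 \<le> ?C" using M g by (simp add: rbound_def)
  have "energy f g \<le> (\<integral>\<^sup>+ u. indicator (?Q 4) u * (\<integral>\<^sup>+ z. ennreal ?C * indicator (?Q 3) z \<partial>lborel) \<partial>lborel)"
    unfolding energy_def
  proof (intro nn_integral_mono)
    fix u
    show "ennreal (wt u) * (\<integral>\<^sup>+ z. f z * Xray g u z \<partial>lborel)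
       \<le> indicator (?Q 4) u * (\<integral>\<^sup>+ z. ennreal ?C * indicator (?Q 3) z \<partial>lborel)"
    proof (cases "wt u = 0")
      case False
      then have "ennreal (wt u) \<le> 1" "indicator (?Q 4) u = (1::ennreal)"
        using wt_le_1[of u] wt_support_nth[of u] by (auto simp: ennreal_le_1)
      moreover have "(\<integral>\<^sup>+ z. f z * Xray g u z \<partial>lborel) \<le> (\<integral>\<^sup>+ z. ennreal ?C * indicator (?Q 3) z \<partial>lborel)"
      proof (rule nn_integral_mono)
        fix z
        show "f z * Xray g u z \<le> ennreal ?C * indicator (?Q 3) z"
        proof (cases "f z = 0")
          case f0: False
          then have "z \<in> ?Q 3" using f(2) by (auto simp: supp3_def)
          moreover have "f z * Xray g u z \<le> ennreal M * ennreal (N * (2 * rbound) ^ l)"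
            using f g False by (intro mult_mono Xray_le) auto
          moreover have "ennreal M * ennreal (N * (2 * rbound) ^ l) = ennreal ?C"
            by (rule ennreal_mult[symmetric]) (use M g in \<open>auto simp: rbound_def\<close>)
          ultimately show ?thesis by simp
        qed simp
      qed
      ultimately show ?thesis
        using mult_mono[of "ennreal (wt u)" 1] by simp
    qed simp
  qed
  also have "\<dots> = ennreal (8 ^ CARD('n)) * (ennreal ?C * ennreal (6 ^ CARD('n)))"
    using emeasure_cube[of 3, where 'n='n] emeasure_cube[of 4, where 'n='n]
    by (simp add: nn_integral_multc nn_integral_cmult)
  also have "\<dots> = ennreal (8 ^ CARD('n) * (M * 6 ^ CARD('n) * (N * (2 * rbound) ^ l)))"
    using C by (simp add: ennreal_mult'[symmetric] mult_ac)
  finally show ?thesis .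
qed

definition Xdiff :: "(real^'n) measure \<Rightarrow> nat \<Rightarrow> real^'n \<Rightarrow> real^'n \<Rightarrow> ennreal" where
  "Xdiff \<mu> j u z = adiff (Xray (smooth \<mu> (Suc j)) u z) (Xray (smooth \<mu> j) u z)"

text \<open>The energy of the signed function \<mu>_(j+1) - \<mu>_j with itself, expressed through
  absolute differences of plane integrals because all functions here take values in
  \<open>ennreal\<close>.\<close>

definition Ediff :: "(real^'n) measure \<Rightarrow> nat \<Rightarrow> ennreal" where
  "Ediff \<mu> j = (\<integral>\<^sup>+ u. ennreal (wt u) * (\<integral>\<^sup>+ z. slab u z * (Xdiff \<mu> j u z * Xdiff \<mu> j u z) \<partial>lborel) \<partial>lborel)"

text \<open>The factor 4 counts two oscillations for each of two diagonal energies; 16^d is 8^d from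
  \<open>Phi_osc\<close> times 2^d from \<open>height_Suc\<close>.\<close>

definition diff_const :: "real \<Rightarrow> real \<Rightarrow> real" where
  "diff_const s \<alpha> = 4 * 16 ^ CARD('n) * inv_powr_const s * (2 * real CARD('n)) powr \<alpha>"

end

locale blocks_frostman = blocks l b + frostman \<mu> \<alpha>
  for l :: nat and b :: "'n::finite \<Rightarrow> nat" and \<mu> :: "(real^'n) measure" and \<alpha> :: real
begin

lemma measurable_Xdiff [measurable (raw)]:
  assumes [measurable]: "g \<in> borel_measurable M" "h \<in> borel_measurable M"
  shows "(\<lambda>x. Xdiff \<mu> j (g x) (h x)) \<in> borel_measurable M"
  unfolding Xdiff_def by measurable

lemma supp3_smooth: "supp3 (smooth \<mu> j)"
  using smooth_support by (auto simp: supp3_def intro: order_trans[where y=2])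

lemma Xray_smooth_finite:
  assumes "wt u \<noteq> 0"
  shows "Xray (smooth \<mu> j) u z \<noteq> \<infinity>"
proof -
  have "Xray (smooth \<mu> j) u z \<le> ennreal (height j * (2 * rbound) ^ l)"
    by (rule Xray_le) (auto simp: supp3_smooth smooth_le assms height_nonneg)
  then show ?thesis by (auto simp: top_unique)
qed

lemma Xdiff_invariant: "Xdiff \<mu> j u (z + bscale b s u) = Xdiff \<mu> j u z"
  unfolding Xdiff_def by (simp add: Xray_invariant)

lemma Xdiff_finite: "Xdiff \<mu> j u z \<noteq> \<infinity>"
  by (simp add: Xdiff_def adiff_def)

lemma energy_smooth_finite: "energy (smooth \<mu> i) (smooth \<mu> j) < \<infinity>"
  using energy_le[of "smooth \<mu> i" "height i" "smooth \<mu> j" "height j"]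
  by (auto simp: supp3_smooth smooth_le height_nonneg intro: le_less_trans)

text \<open>Write a and a' for the two scales and E for the energy. Then \<open>Ediff\<close> + 2
  E(a', a) = E(a', a') + E(a, a), and each diagonal energy exceeds the mixed one by no more than the
  error of \<open>energy_smooth_le\<close>. The mixed terms are finite and cancel, which leaves the
  height times 2^(-s j).\<close>

lemma Ediff_le:
  assumes s: "0 < s" "s < 1"
  shows "Ediff \<mu> j \<le> ennreal (diff_const s \<alpha> * 2 powr (real j * (real CARD('n) - \<alpha> - s)))"
proof -
  let ?a = "smooth \<mu> j" and ?a' = "smooth \<mu> (Suc j)"
  define e where "e M = ennreal (2 * 8 ^ CARD('n) * inv_powr_const s * M * (1/2) powr (s * j))" for M
  have K: "0 \<le> inv_powr_const s" by (simp add: inv_powr_const_def)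
  have "Ediff \<mu> j + 2 * energy ?a' ?a
     = (\<integral>\<^sup>+ u. ennreal (wt u) * (\<integral>\<^sup>+ z. slab u z * (Xdiff \<mu> j u z * Xdiff \<mu> j u z) \<partial>lborel)
         + 2 * (ennreal (wt u) * (\<integral>\<^sup>+ z. slab u z * (Xray ?a' u z * Xray ?a u z) \<partial>lborel)) \<partial>lborel)"
    unfolding Ediff_def by (subst energy_eq_slab) (simp_all add: nn_integral_add nn_integral_cmult)
  also have "\<dots> = (\<integral>\<^sup>+ u. ennreal (wt u) * (\<integral>\<^sup>+ z. slab u z * (Xray ?a' u z * Xray ?a' u z) \<partial>lborel)
         + ennreal (wt u) * (\<integral>\<^sup>+ z. slab u z * (Xray ?a u z * Xray ?a u z) \<partial>lborel) \<partial>lborel)"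
  proof (rule nn_integral_cong)
    fix u
    show "ennreal (wt u) * (\<integral>\<^sup>+ z. slab u z * (Xdiff \<mu> j u z * Xdiff \<mu> j u z) \<partial>lborel)
         + 2 * (ennreal (wt u) * (\<integral>\<^sup>+ z. slab u z * (Xray ?a' u z * Xray ?a u z) \<partial>lborel))
      = ennreal (wt u) * (\<integral>\<^sup>+ z. slab u z * (Xray ?a' u z * Xray ?a' u z) \<partial>lborel)
         + ennreal (wt u) * (\<integral>\<^sup>+ z. slab u z * (Xray ?a u z * Xray ?a u z) \<partial>lborel)"
    proof (cases "wt u = 0")
      case False
      have "(\<integral>\<^sup>+ z. slab u z * (Xdiff \<mu> j u z * Xdiff \<mu> j u z) \<partial>lborel)
          + 2 * (\<integral>\<^sup>+ z. slab u z * (Xray ?a' u z * Xray ?a u z) \<partial>lborel)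
        = (\<integral>\<^sup>+ z. slab u z * (Xdiff \<mu> j u z * Xdiff \<mu> j u z) + 2 * (slab u z * (Xray ?a' u z * Xray ?a u z)) \<partial>lborel)"
        by (simp add: nn_integral_add nn_integral_cmult)
      also have "\<dots> = (\<integral>\<^sup>+ z. slab u z * (Xray ?a' u z * Xray ?a' u z) + slab u z * (Xray ?a u z * Xray ?a u z) \<partial>lborel)"
      proof (rule nn_integral_cong)
        fix z
        have "Xdiff \<mu> j u z * Xdiff \<mu> j u z + 2 * (Xray ?a' u z * Xray ?a u z)
           = Xray ?a' u z * Xray ?a' u z + Xray ?a u z * Xray ?a u z"
          unfolding Xdiff_def by (rule adiff_sq) (rule Xray_smooth_finite[OF False])+
        then show "slab u z * (Xdiff \<mu> j u z * Xdiff \<mu> j u z) + 2 * (slab u z * (Xray ?a' u z * Xray ?a u z))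
          = slab u z * (Xray ?a' u z * Xray ?a' u z) + slab u z * (Xray ?a u z * Xray ?a u z)"
          by (rule ennreal_weight_eq)
      qed
      also have "\<dots> = (\<integral>\<^sup>+ z. slab u z * (Xray ?a' u z * Xray ?a' u z) \<partial>lborel)
          + (\<integral>\<^sup>+ z. slab u z * (Xray ?a u z * Xray ?a u z) \<partial>lborel)"
        by (rule nn_integral_add) auto
      finally show ?thesis by (rule ennreal_weight_eq)
    qed simp
  qed
  also have "\<dots> = energy ?a' ?a' + energy ?a ?a"
    by (subst (1 2) energy_eq_slab) (simp_all add: nn_integral_add)
  also have "\<dots> \<le> (energy ?a ?a' + e (height (Suc j))) + (energy ?a' ?a + e (height j))"
    unfolding e_def
    by (intro add_mono energy_smooth_le)
       (auto simp: finite_borel_axioms emeasure_UNIV_le supp3_smooth smooth_le height_nonneg s)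
  also have "\<dots> = 2 * energy ?a' ?a + (e (height (Suc j)) + e (height j))"
    by (subst energy_commute[of ?a ?a']) (simp_all add: mult_2 add_ac)
  finally have "2 * energy ?a' ?a + Ediff \<mu> j \<le> 2 * energy ?a' ?a + (e (height (Suc j)) + e (height j))"
    by (simp add: add.commute)
  moreover have "2 * energy ?a' ?a \<noteq> \<infinity>"
    using energy_smooth_finite[of "Suc j" j] by (simp add: ennreal_mult_eq_top_iff)
  ultimately have "Ediff \<mu> j \<le> e (height (Suc j)) + e (height j)"
    by (simp add: ennreal_add_left_cancel_le)
  also have "\<dots> \<le> e (2 ^ CARD('n) * height j) + e (2 ^ CARD('n) * height j)"
  proof -
    have "1 * height j \<le> 2 ^ CARD('n) * height j" by (intro mult_right_mono height_nonneg) auto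
    then show ?thesis
      unfolding e_def using height_Suc K
      by (intro add_mono ennreal_leI mult_right_mono mult_left_mono) auto
  qed
  also have "\<dots> = ennreal (diff_const s \<alpha> * 2 powr (real j * (real CARD('n) - \<alpha> - s)))"
  proof -
    have "(1/2::real) = 2 powr (- 1)" by (simp add: powr_minus_divide)
    then have "(1/2::real) powr (s * j) = 2 powr (- (s * j))"
      by (simp only: powr_powr) simp
    then have T: "2 powr (real j * (real CARD('n) - \<alpha> - s)) = 2 powr (real j * (real CARD('n) - \<alpha>)) * (1/2) powr (s * j)"
      by (simp only: powr_add[symmetric]) (simp add: algebra_simps)
    have "(16::real) ^ CARD('n) = 8 ^ CARD('n) * 2 ^ CARD('n)"
      by (simp only: power_mult_distrib[symmetric]) simp
    then have D: "diff_const s \<alpha> * 2 powr (real j * (real CARD('n) - \<alpha> - s))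
       = 2 * (2 * 8 ^ CARD('n) * inv_powr_const s * (2 ^ CARD('n) * height j) * (1/2) powr (s * j))"
      unfolding T diff_const_def height_def by (simp only: mult_ac)
    have "0 \<le> 2 * 8 ^ CARD('n) * inv_powr_const s * (2 ^ CARD('n) * height j) * (1/2) powr (s * j)"
      using K height_nonneg[of j] by simp
    then show ?thesis
      unfolding e_def D by (subst mult_2) (rule ennreal_plus[symmetric])
  qed
  finally show ?thesis .
qed

text \<open>The parameter a stays free so that the factor of the old energy can be brought below any
  prescribed growth factor larger than 1.\<close>

lemma energy_growth_step:
  assumes "a > 0"
  shows "energy (smooth \<mu> (Suc j)) (smooth \<mu> (Suc j))
    \<le> ennreal (1 + a) * energy (smooth \<mu> j) (smooth \<mu> j) + ennreal (1 + 1 / a) * Ediff \<mu> j"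
proof -
  let ?a = "smooth \<mu> j" and ?a' = "smooth \<mu> (Suc j)"
  have "energy ?a' ?a' = (\<integral>\<^sup>+ u. ennreal (wt u) * (\<integral>\<^sup>+ z. slab u z * (Xray ?a' u z * Xray ?a' u z) \<partial>lborel) \<partial>lborel)"
    by (rule energy_eq_slab) auto
  also have "\<dots> \<le> (\<integral>\<^sup>+ u. ennreal (1 + a) * (ennreal (wt u) * (\<integral>\<^sup>+ z. slab u z * (Xray ?a u z * Xray ?a u z) \<partial>lborel))
      + ennreal (1 + 1 / a) * (ennreal (wt u) * (\<integral>\<^sup>+ z. slab u z * (Xdiff \<mu> j u z * Xdiff \<mu> j u z) \<partial>lborel)) \<partial>lborel)"
  proof (rule nn_integral_mono)
    fix u
    show "ennreal (wt u) * (\<integral>\<^sup>+ z. slab u z * (Xray ?a' u z * Xray ?a' u z) \<partial>lborel)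
       \<le> ennreal (1 + a) * (ennreal (wt u) * (\<integral>\<^sup>+ z. slab u z * (Xray ?a u z * Xray ?a u z) \<partial>lborel))
      + ennreal (1 + 1 / a) * (ennreal (wt u) * (\<integral>\<^sup>+ z. slab u z * (Xdiff \<mu> j u z * Xdiff \<mu> j u z) \<partial>lborel))"
    proof (cases "wt u = 0")
      case False
      have "(\<integral>\<^sup>+ z. slab u z * (Xray ?a' u z * Xray ?a' u z) \<partial>lborel)
         \<le> (\<integral>\<^sup>+ z. ennreal (1 + a) * (slab u z * (Xray ?a u z * Xray ?a u z))
              + ennreal (1 + 1 / a) * (slab u z * (Xdiff \<mu> j u z * Xdiff \<mu> j u z)) \<partial>lborel)"
      proof (rule nn_integral_mono)
        fix z
        have "Xray ?a' u z * Xray ?a' u z \<le> ennreal (1 + a) * (Xray ?a u z * Xray ?a u z)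
              + ennreal (1 + 1 / a) * (Xdiff \<mu> j u z * Xdiff \<mu> j u z)"
          using Xray_smooth_finite[OF False] Xdiff_finite assms
          by (intro ennreal_sq_le_weighted) (auto simp: Xdiff_def intro: le_add_adiff)
        then show "slab u z * (Xray ?a' u z * Xray ?a' u z) \<le> ennreal (1 + a) * (slab u z * (Xray ?a u z * Xray ?a u z))
              + ennreal (1 + 1 / a) * (slab u z * (Xdiff \<mu> j u z * Xdiff \<mu> j u z))"
          by (rule ennreal_weight_le)
      qed
      also have "\<dots> = ennreal (1 + a) * (\<integral>\<^sup>+ z. slab u z * (Xray ?a u z * Xray ?a u z) \<partial>lborel)
          + ennreal (1 + 1 / a) * (\<integral>\<^sup>+ z. slab u z * (Xdiff \<mu> j u z * Xdiff \<mu> j u z) \<partial>lborel)"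
        by (subst nn_integral_add) (auto simp: nn_integral_cmult)
      finally show ?thesis by (rule ennreal_weight_le)
    qed simp
  qed
  also have "\<dots> = ennreal (1 + a) * energy ?a ?a + ennreal (1 + 1 / a) * Ediff \<mu> j"
    unfolding Ediff_def by (subst energy_eq_slab) (auto simp: nn_integral_add nn_integral_cmult)
  finally show ?thesis .
qed

end

section \<open>Growth of the energy and summable differences\<close>

text \<open>Mean value theorem: the slope of the p-th power below B is at most p B^(p-1). Only an
  increase has to be paid for.\<close>

lemma powr_le_tangent:
  fixes x x' d B p :: real
  assumes x: "0 \<le> x" "0 \<le> x'" "x' \<le> x + d" "x' \<le> B" and d: "0 \<le> d" and p: "1 \<le> p"
  shows "x' powr p \<le> x powr p + p * B powr (p - 1) * d"
proof (cases "x' \<le> x")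
  case True
  then have "x' powr p \<le> x powr p" using x p by (intro powr_mono2) auto
  moreover have "0 \<le> p * B powr (p - 1) * d" using d p by simp
  ultimately show ?thesis by linarith
next
  case False
  have "x' powr p - x powr p \<le> p * B powr (p - 1) * (x' - x)"
  \<comment> \<open>The derivative of \<open>powr\<close> is used at positive base points, so an
    interval starting at 0 is treated by direct computation.\<close>
  proof (cases "x = 0")
    case True
    then have "x' > 0" using False by auto
    then have "x' powr p = x' powr (p - 1) * x'" by (simp add: powr_diff)
    also have "\<dots> \<le> B powr (p - 1) * x'" using x p \<open>x' > 0\<close> by (intro mult_right_mono powr_mono2) auto
    also have "\<dots> \<le> p * (B powr (p - 1) * x')"
      using p \<open>x' > 0\<close> mult_right_mono[of 1 p "B powr (p - 1) * x'"] by simp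
    finally show ?thesis using True by simp
  next
    case x0: False
    have "\<exists>z. x < z \<and> z < x' \<and> x' powr p - x powr p = (x' - x) * (p * z powr (p - 1))"
      using x x0 False by (intro MVT2) (auto intro!: has_real_derivative_powr)
    then obtain z where z: "x < z" "z < x'" "x' powr p - x powr p = (x' - x) * (p * z powr (p - 1))" by blast
    have "z powr (p - 1) \<le> B powr (p - 1)" using z x p by (intro powr_mono2) auto
    then have "(x' - x) * (p * z powr (p - 1)) \<le> (x' - x) * (p * B powr (p - 1))"
      using False p by (intro mult_left_mono) auto
    then show ?thesis using z(3) by (simp add: mult_ac)
  qed
  also have "\<dots> \<le> p * B powr (p - 1) * d" using x p by (intro mult_left_mono) auto
  finally show ?thesis by simp
qed

lemma ennreal_powr_SUP_le:
  assumes p: "p > 0" and le: "\<And>j. ennreal_powr (X j) p \<le> G"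
  shows "ennreal_powr (SUP j::nat. X j) p \<le> G"
proof (cases "G = \<infinity>")
  case False
  then obtain g where g: "G = ennreal g" "0 \<le> g" by (cases G) auto
  have X: "X j \<le> ennreal (g powr (1 / p))" for j
  proof -
    have "X j \<noteq> \<infinity>" using le[of j] g by (auto simp: ennreal_powr_def top_unique)
    then obtain x where x: "X j = ennreal x" "0 \<le> x" by (cases "X j") auto
    then have "x powr p \<le> g" using le[of j] g by (simp add: ennreal_powr_def)
    then have "(x powr p) powr (1 / p) \<le> g powr (1 / p)" using p by (intro powr_mono2) auto
    then show ?thesis using x p by (simp add: powr_powr ennreal_leI)
  qed
  then have S: "(SUP j. X j) \<le> ennreal (g powr (1 / p))" by (rule SUP_least)
  then obtain y where y: "(SUP j. X j) = ennreal y" "0 \<le> y"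
    by (cases "SUP j. X j") (auto simp: top_unique)
  then have "y \<le> g powr (1 / p)" using S by simp
  then have "y powr p \<le> (g powr (1 / p)) powr p" using y p by (intro powr_mono2) auto
  also have "\<dots> = g" using g p by (simp add: powr_powr)
  finally show ?thesis using y g by (simp add: ennreal_powr_def)
qed simp

lemma measurable_ennreal_powr [measurable (raw)]:
  assumes [measurable]: "f \<in> borel_measurable M"
  shows "(\<lambda>x. ennreal_powr (f x) p) \<in> borel_measurable M"
  unfolding ennreal_powr_def by measurable

context blocks
begin

text \<open>The first summand bounds the energy at scale 0, where the height is h. The second is
  what the induction of \<open>energy_growth\<close> demands, namely C a \<ge> (1 + 1/a)
  \<open>diff_const\<close> for the constant C defined here.\<close>

definition growth_const :: "real \<Rightarrow> real \<Rightarrow> real \<Rightarrow> real" where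
  "growth_const s \<gamma> \<beta> =
     (let h = (2 * real CARD('n)) powr \<beta>; a = (2 powr \<gamma> - 1) / 2 in
       8 ^ CARD('n) * (h * 6 ^ CARD('n) * (h * (2 * rbound) ^ l)) + (1 + 1 / a) * diff_const s \<beta> / a)"

lemma diff_const_nonneg: "0 \<le> diff_const s \<beta>"
  by (simp add: diff_const_def inv_powr_const_def)

lemma Xray_conv:
  assumes [measurable]: "f \<in> borel_measurable borel"
  shows "Xray (conv j f) u z = conv j (Xray f u) z"
proof -
  interpret pair_sigma_finite "lborel :: (real^'n) measure" "plane_measure l" by standard
  have "Xray (conv j f) u z = (\<integral>\<^sup>+ r. \<integral>\<^sup>+ v. bump j v * f (z + bscale b r u + v) \<partial>lborel \<partial>plane_measure l)"
    by (simp add: Xray_def conv_def)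
  also have "\<dots> = (\<integral>\<^sup>+ v. \<integral>\<^sup>+ r. bump j v * f (z + bscale b r u + v) \<partial>plane_measure l \<partial>lborel)"
    by (rule Fubini') measurable
  also have "\<dots> = conv j (Xray f u) z"
    by (simp add: Xray_def conv_def nn_integral_cmult add.assoc add.commute[of _ "bscale b _ _"])
  finally show ?thesis .
qed

end

context blocks_frostman
begin

text \<open>Induction on the scale with a fixed by 1 + 2 a = 2^\<gamma>. One a pays for the cross
  term of the old energy, the other for the new difference; \<gamma> > 0 is what makes a
  positive.\<close>

lemma energy_growth:
  assumes s: "0 < s" "s < 1" and \<gamma>: "\<gamma> > 0" "\<gamma> \<ge> real CARD('n) - \<alpha> - s"
  shows "energy (smooth \<mu> j) (smooth \<mu> j) \<le> ennreal (growth_const s \<gamma> \<alpha> * 2 powr (real j * \<gamma>))"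
proof -
  define q where "q = 2 powr \<gamma>"
  define a where "a = (q - 1) / 2"
  define C where "C = growth_const s \<gamma> \<alpha>"
  define K where "K = diff_const s \<alpha>"
  have q: "q > 1" using \<gamma> by (simp add: q_def)
  then have a: "a > 0" by (simp add: a_def)
  have K: "0 \<le> K" by (simp add: K_def diff_const_nonneg)
  define h where "h = (2 * real CARD('n)) powr \<alpha>"
  define C0 where "C0 = 8 ^ CARD('n) * (h * 6 ^ CARD('n) * (h * (2 * rbound) ^ l))"
  have C: "C = C0 + (1 + 1 / a) * K / a"
    by (simp add: C_def growth_const_def Let_def C0_def h_def a_def q_def K_def)
  have C0: "0 \<le> C0" by (simp add: C0_def h_def rbound_def)
  have "C0 \<le> C" using a K by (simp add: C)
  then have Cnn: "0 \<le> C" using C0 by simp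
  have "(1 + 1 / a) * K = ((1 + 1 / a) * K / a) * a" using a by simp
  also have "\<dots> \<le> C * a" using C0 a by (intro mult_right_mono) (auto simp: C)
  finally have "(1 + a) * C + (1 + 1 / a) * K \<le> C * (1 + 2 * a)"
    by (simp only: distrib_left distrib_right) (simp add: mult.commute)
  moreover have "1 + 2 * a = q" unfolding a_def by (simp add: field_simps)
  ultimately have Ca: "(1 + a) * C + (1 + 1 / a) * K \<le> C * q" by simp
  have "energy (smooth \<mu> j) (smooth \<mu> j) \<le> ennreal (C * q ^ j)"
  proof (induction j)
    case 0
    have "energy (smooth \<mu> 0) (smooth \<mu> 0) \<le> ennreal C0"
      unfolding C0_def h_def using smooth_le[of 0]
      by (intro energy_le) (auto simp: supp3_smooth height_def)
    then show ?case using \<open>C0 \<le> C\<close> by (auto intro: order_trans ennreal_leI)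
  next
    case (Suc j)
    have E: "Ediff \<mu> j \<le> ennreal (K * q ^ j)"
    proof -
      have "2 powr (real j * (real CARD('n) - \<alpha> - s)) \<le> 2 powr (real j * \<gamma>)"
        using \<gamma> by (intro powr_mono mult_left_mono) auto
      also have "\<dots> = q ^ j" unfolding q_def by (simp add: powr_powr[symmetric] mult.commute powr_realpow)
      finally have "K * 2 powr (real j * (real CARD('n) - \<alpha> - s)) \<le> K * q ^ j" using K by (rule mult_left_mono)
      then show ?thesis using Ediff_le[OF s, of j] unfolding K_def by (auto intro: order_trans ennreal_leI)
    qed
    have "energy (smooth \<mu> (Suc j)) (smooth \<mu> (Suc j))
        \<le> ennreal (1 + a) * ennreal (C * q ^ j) + ennreal (1 + 1 / a) * ennreal (K * q ^ j)"
      by (rule order_trans[OF energy_growth_step[OF a]]) (intro add_mono mult_left_mono Suc E, auto)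
    also have "\<dots> = ennreal ((1 + a) * (C * q ^ j) + (1 + 1 / a) * (K * q ^ j))"
      using a q K Cnn by (simp add: ennreal_mult)
    also have "\<dots> \<le> ennreal (C * q ^ Suc j)"
    proof (rule ennreal_leI)
      have "(1 + a) * (C * q ^ j) + (1 + 1 / a) * (K * q ^ j) = ((1 + a) * C + (1 + 1 / a) * K) * q ^ j"
        by (simp add: algebra_simps)
      also have "\<dots> \<le> (C * q) * q ^ j" using q by (intro mult_right_mono Ca) auto
      finally show "(1 + a) * (C * q ^ j) + (1 + 1 / a) * (K * q ^ j) \<le> C * q ^ Suc j" by simp
    qed
    finally show ?case .
  qed
  also have "q ^ j = 2 powr (real j * \<gamma>)"
    unfolding q_def by (simp add: powr_powr[symmetric] mult.commute powr_realpow)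
  finally show ?thesis by (simp add: C_def)
qed

text \<open>The outer \<open>conv j\<close> is there to be handed over to \<nu>: integrating it
  against \<nu> pairs the inner function with \<open>smooth \<nu> j\<close>.\<close>

definition Xreg :: "nat \<Rightarrow> real^'n \<Rightarrow> real^'n \<Rightarrow> ennreal" where
  "Xreg j y u = Xray (conv j (smooth \<mu> j)) u y"

lemma measurable_Xreg [measurable (raw)]:
  assumes [measurable]: "g \<in> borel_measurable M" "h \<in> borel_measurable M"
  shows "(\<lambda>x. Xreg j (g x) (h x)) \<in> borel_measurable M"
  unfolding Xreg_def by (rule measurable_Xray) measurable

definition Delta :: "nat \<Rightarrow> real^'n \<Rightarrow> real^'n \<Rightarrow> ennreal" where
  "Delta j y u = conv j (Xdiff \<mu> j u) y + conv (Suc j) (Xdiff \<mu> j u) y"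

lemma measurable_Delta [measurable (raw)]:
  assumes [measurable]: "g \<in> borel_measurable M" "h \<in> borel_measurable M"
  shows "(\<lambda>x. Delta j (g x) (h x)) \<in> borel_measurable M"
  unfolding Delta_def conv_def by measurable

text \<open>With (outer, inner) scales the route is (j+1, j+1), (j+1, j), (j, j+1), (j, j). The
  first and last moves lower the inner scale and cost one \<open>Xdiff\<close> each, seen through
  the current outer smoothing; the middle move is \<open>conv_smooth_commute\<close>. These two
  costs make up \<open>Delta\<close>.\<close>

lemma Xreg_Suc_le:
  assumes u: "wt u \<noteq> 0"
  shows "Xreg (Suc j) y u \<le> Xreg j y u + Delta j y u"
proof -
  let ?a = "smooth \<mu> j" and ?a' = "smooth \<mu> (Suc j)"
  have le: "Xray ?a' u z \<le> Xray ?a u z + Xdiff \<mu> j u z" for z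
    unfolding Xdiff_def using Xray_smooth_finite[OF u] by (intro le_add_adiff)
  have [measurable]: "Xray f u \<in> borel_measurable borel" if [measurable]: "f \<in> borel_measurable borel" for f
    by (rule measurable_Xray) measurable
  have [measurable]: "Xdiff \<mu> j u \<in> borel_measurable borel"
    by (rule measurable_Xdiff) measurable
  have [measurable]: "smooth \<mu> i \<in> borel_measurable borel" for i by (rule measurable_smooth) measurable
  have "Xreg (Suc j) y u = conv (Suc j) (Xray ?a' u) y"
    unfolding Xreg_def by (rule Xray_conv) measurable
  also have "\<dots> \<le> conv (Suc j) (\<lambda>z. Xray ?a u z + Xdiff \<mu> j u z) y"
    by (rule conv_mono) (rule le)
  also have "\<dots> = conv (Suc j) (Xray ?a u) y + conv (Suc j) (Xdiff \<mu> j u) y"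
    by (rule conv_add) measurable
  also have "conv (Suc j) (Xray ?a u) y = Xray (conv (Suc j) ?a) u y"
    by (rule Xray_conv[symmetric]) measurable
  also have "conv (Suc j) ?a = conv j ?a'"
    using conv_smooth_commute[OF finite_borel_axioms] by (intro ext)
  also have "Xray (conv j ?a') u y = conv j (Xray ?a' u) y"
    by (rule Xray_conv) measurable
  also have "\<dots> \<le> conv j (\<lambda>z. Xray ?a u z + Xdiff \<mu> j u z) y"
    by (rule conv_mono) (rule le)
  also have "\<dots> = conv j (Xray ?a u) y + conv j (Xdiff \<mu> j u) y"
    by (rule conv_add) measurable
  also have "conv j (Xray ?a u) y = Xreg j y u"
    unfolding Xreg_def by (rule Xray_conv[symmetric]) measurable
  finally show ?thesis by (simp add: Delta_def add_ac)
qed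

definition sup_const :: real where
  "sup_const = (2 * real CARD('n)) powr \<alpha> * (2 * rbound) ^ l"

lemma sup_const_nonneg: "0 \<le> sup_const"
  by (simp add: sup_const_def rbound_def)

lemma supp3_conv_smooth: "supp3 (conv j (smooth \<mu> j))"
  unfolding supp3_def
proof (intro allI impI)
  fix z :: "real^'n" and k assume nz: "conv j (smooth \<mu> j) z \<noteq> 0"
  have "\<not> (\<forall>v. bump j v * smooth \<mu> j (z + v) = 0)"
  proof
    assume "\<forall>v. bump j v * smooth \<mu> j (z + v) = 0"
    then have "conv j (smooth \<mu> j) z = (\<integral>\<^sup>+ v. 0 \<partial>(lborel :: (real^'n) measure))"
      unfolding conv_def by (intro nn_integral_cong) blast
    then show False using nz by simp
  qed
  then obtain v where v: "bump j v * smooth \<mu> j (z + v) \<noteq> 0" by blast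
  have "(1/2::real) ^ j \<le> 1" by (simp add: power_le_one)
  moreover have "\<bar>v $ k\<bar> \<le> (1/2) ^ j" using v bump_eq_0[of v k j] by auto
  moreover have "\<bar>(z + v) $ k\<bar> \<le> 2" using v by (intro smooth_support[of j]) auto
  ultimately show "\<bar>z $ k\<bar> \<le> 3" by simp
qed

text \<open>The exponent d - \<alpha> in the height is below 1 and is rounded up to 1, which keeps
  the later choice of p simple.\<close>

lemma Xreg_le:
  assumes u: "wt u \<noteq> 0" and \<alpha>: "\<alpha> > real CARD('n) - 1"
  shows "Xreg j y u \<le> ennreal (sup_const * 2 ^ j)"
proof -
  have "Xreg j y u \<le> ennreal (height j * (2 * rbound) ^ l)"
    unfolding Xreg_def using u by (intro Xray_le supp3_conv_smooth conv_le smooth_le height_nonneg) measurable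
  also have "\<dots> \<le> ennreal (sup_const * 2 ^ j)"
  proof (rule ennreal_leI)
    have "2 powr (real j * (real CARD('n) - \<alpha>)) \<le> 2 powr (real j * 1)"
      using \<alpha> by (intro powr_mono mult_left_mono) auto
    then have "height j \<le> (2 * real CARD('n)) powr \<alpha> * 2 ^ j"
      by (auto simp: height_def powr_realpow intro!: mult_left_mono)
    then have "height j * (2 * rbound) ^ l \<le> ((2 * real CARD('n)) powr \<alpha> * 2 ^ j) * (2 * rbound) ^ l"
      by (rule mult_right_mono) (simp add: rbound_def)
    then show "height j * (2 * rbound) ^ l \<le> sup_const * 2 ^ j" by (simp add: sup_const_def mult_ac)
  qed
  finally show ?thesis .
qed

text \<open>Telescoping of p-th powers by the tangent inequality with B = \<open>sup_const\<close>
  2^(i+1). Raising to the power p costs the i-th difference a factor of order 2^(i (p - 1)), which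
  is harmless for p near 1.\<close>

lemma Xreg_powr_le:
  assumes u: "wt u \<noteq> 0" and \<alpha>: "\<alpha> > real CARD('n) - 1" and p: "p > 1"
  shows "ennreal_powr (Xreg j y u) p \<le> ennreal (sup_const powr p)
    + (\<Sum>i<j. ennreal (p * (sup_const * 2 ^ Suc i) powr (p - 1)) * Delta i y u)"
proof (induction j)
  case 0
  obtain x where x: "Xreg 0 y u = ennreal x" "0 \<le> x" "x \<le> sup_const"
    using Xreg_le[OF u \<alpha>, of 0 y] sup_const_nonneg by (cases "Xreg 0 y u") (auto simp: top_unique)
  then have "x powr p \<le> sup_const powr p" using p by (intro powr_mono2) auto
  then show ?case using x by (simp add: ennreal_powr_def ennreal_leI)
next
  case (Suc j)
  let ?c = "p * (sup_const * 2 ^ Suc j) powr (p - 1)"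
  have c: "?c > 0 \<or> sup_const = 0" using p sup_const_nonneg by auto
  obtain x where x: "Xreg j y u = ennreal x" "0 \<le> x"
    using Xreg_le[OF u \<alpha>, of j y] by (cases "Xreg j y u") (auto simp: top_unique)
  obtain x' where x': "Xreg (Suc j) y u = ennreal x'" "0 \<le> x'" "x' \<le> sup_const * 2 ^ Suc j"
    using Xreg_le[OF u \<alpha>, of "Suc j" y] sup_const_nonneg by (cases "Xreg (Suc j) y u") (auto simp: top_unique)
  have "ennreal (x' powr p) \<le> ennreal (x powr p) + ennreal ?c * Delta j y u"
  proof (cases "Delta j y u")
    case (real d)
    then have "ennreal x' \<le> ennreal (x + d)" using Xreg_Suc_le[OF u, of j y] x x' by simp
    then have "x' \<le> x + d" using x real ennreal_le_iff[of "x + d" x'] by linarith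
    then have "x' powr p \<le> x powr p + ?c * d"
      using x x' p real by (intro powr_le_tangent) auto
    then have "ennreal (x' powr p) \<le> ennreal (x powr p + ?c * d)" by (rule ennreal_leI)
    also have "\<dots> = ennreal (x powr p) + ennreal (?c * d)" using p real by (intro ennreal_plus) auto
    also have "ennreal (?c * d) = ennreal ?c * ennreal d" using p real by (intro ennreal_mult) auto
    finally show ?thesis using real by simp
  next
    case top
    show ?thesis
    proof (cases "sup_const = 0")
      case True
      then show ?thesis using x' by simp
    next
      case False
      then have "ennreal ?c \<noteq> 0" using c by (simp add: ennreal_eq_0_iff not_le)
      then show ?thesis using top by (simp add: ennreal_mult_top)
    qed
  qed
  also have "\<dots> \<le> (ennreal (sup_const powr p)
    + (\<Sum>i<j. ennreal (p * (sup_const * 2 ^ Suc i) powr (p - 1)) * Delta i y u)) + ennreal ?c * Delta j y u"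
    using Suc x by (intro add_right_mono) (simp add: ennreal_powr_def)
  finally show ?case using x' by (simp add: ennreal_powr_def add.assoc)
qed

end

section \<open>Pairing the differences with the second measure\<close>

locale blocks_pair = blocks_frostman l b \<mu> \<alpha> + nu: blocks_frostman l b \<nu> \<beta>
  for l :: nat and b :: "'n::finite \<Rightarrow> nat" and \<mu> :: "(real^'n) measure" and \<alpha> :: real
    and \<nu> :: "(real^'n) measure" and \<beta> :: real
begin

text \<open>After Fubini the averaging \<open>conv i\<close> becomes \<open>smooth \<nu> i\<close>.
  As \<open>Xdiff\<close> is invariant along the planes, the fundamental domain replaces
  \<open>smooth \<nu> i\<close> by its plane integral. Cauchy-Schwarz enters as the
  arithmetic-geometric mean inequality with a free parameter a.\<close>

lemma nn_integral_conv_Xdiff_le: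
  assumes a: "a > 0"
  shows "2 * (\<integral>\<^sup>+ y. \<integral>\<^sup>+ u. ennreal (wt u) * conv i (Xdiff \<mu> j u) y \<partial>lborel \<partial>\<nu>)
    \<le> ennreal a * Ediff \<mu> j + ennreal (1 / a) * energy (smooth \<nu> i) (smooth \<nu> i)"
proof -
  interpret pair_sigma_finite "lborel :: (real^'n) measure" \<nu> by standard
  have m: "(\<lambda>(u, y). ennreal (wt u) * conv i (Xdiff \<mu> j u) y) \<in> borel_measurable (lborel \<Otimes>\<^sub>M \<nu>)"
    unfolding conv_def by measurable
  have "2 * (\<integral>\<^sup>+ y. \<integral>\<^sup>+ u. ennreal (wt u) * conv i (Xdiff \<mu> j u) y \<partial>lborel \<partial>\<nu>)
      = 2 * (\<integral>\<^sup>+ u. \<integral>\<^sup>+ y. ennreal (wt u) * conv i (Xdiff \<mu> j u) y \<partial>\<nu> \<partial>lborel)"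
    using Fubini'[OF m] by simp
  also have "\<dots> = 2 * (\<integral>\<^sup>+ u. ennreal (wt u) * (\<integral>\<^sup>+ z. slab u z * (Xdiff \<mu> j u z * Xray (smooth \<nu> i) u z) \<partial>lborel) \<partial>lborel)"
  proof (intro arg_cong[where f="\<lambda>x. 2 * x"] nn_integral_cong)
    fix u
    have [measurable]: "Xdiff \<mu> j u \<in> borel_measurable borel"
      by (rule measurable_Xdiff) measurable
    have "(\<integral>\<^sup>+ y. ennreal (wt u) * conv i (Xdiff \<mu> j u) y \<partial>\<nu>) = ennreal (wt u) * (\<integral>\<^sup>+ y. conv i (Xdiff \<mu> j u) y \<partial>\<nu>)"
      by (rule nn_integral_cmult) measurable
    also have "(\<integral>\<^sup>+ y. conv i (Xdiff \<mu> j u) y \<partial>\<nu>) = (\<integral>\<^sup>+ z. smooth \<nu> i z * Xdiff \<mu> j u z \<partial>lborel)"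
      by (rule nu.nn_integral_smooth_mult[symmetric]) measurable
    finally have *: "(\<integral>\<^sup>+ y. ennreal (wt u) * conv i (Xdiff \<mu> j u) y \<partial>\<nu>)
       = ennreal (wt u) * (\<integral>\<^sup>+ z. Xdiff \<mu> j u z * smooth \<nu> i z \<partial>lborel)"
      by (simp add: mult.commute)
    show "(\<integral>\<^sup>+ y. ennreal (wt u) * conv i (Xdiff \<mu> j u) y \<partial>\<nu>)
      = ennreal (wt u) * (\<integral>\<^sup>+ z. slab u z * (Xdiff \<mu> j u z * Xray (smooth \<nu> i) u z) \<partial>lborel)"
    proof (cases "wt u = 0")
      case False
      have "(\<integral>\<^sup>+ z. Xdiff \<mu> j u z * smooth \<nu> i z \<partial>lborel)
         = (\<integral>\<^sup>+ z. slab u z * (Xdiff \<mu> j u z * Xray (smooth \<nu> i) u z) \<partial>lborel)"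
        by (rule nn_integral_invariant_mult)
           (auto simp: wt_support_nonzero[OF False] Xdiff_invariant intro: nu.measurable_smooth)
      then show ?thesis unfolding * by simp
    qed (simp add: *)
  qed
  also have "\<dots> = (\<integral>\<^sup>+ u. 2 * (ennreal (wt u) * (\<integral>\<^sup>+ z. slab u z * (Xdiff \<mu> j u z * Xray (smooth \<nu> i) u z) \<partial>lborel)) \<partial>lborel)"
    by (rule nn_integral_cmult[symmetric]) measurable
  also have "\<dots> \<le> (\<integral>\<^sup>+ u. ennreal a * (ennreal (wt u) * (\<integral>\<^sup>+ z. slab u z * (Xdiff \<mu> j u z * Xdiff \<mu> j u z) \<partial>lborel))
      + ennreal (1 / a) * (ennreal (wt u) * (\<integral>\<^sup>+ z. slab u z * (Xray (smooth \<nu> i) u z * Xray (smooth \<nu> i) u z) \<partial>lborel)) \<partial>lborel)"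
  proof (rule nn_integral_mono)
    fix u
    show "2 * (ennreal (wt u) * (\<integral>\<^sup>+ z. slab u z * (Xdiff \<mu> j u z * Xray (smooth \<nu> i) u z) \<partial>lborel))
      \<le> ennreal a * (ennreal (wt u) * (\<integral>\<^sup>+ z. slab u z * (Xdiff \<mu> j u z * Xdiff \<mu> j u z) \<partial>lborel))
      + ennreal (1 / a) * (ennreal (wt u) * (\<integral>\<^sup>+ z. slab u z * (Xray (smooth \<nu> i) u z * Xray (smooth \<nu> i) u z) \<partial>lborel))"
    proof (cases "wt u = 0")
      case False
      have "2 * (\<integral>\<^sup>+ z. slab u z * (Xdiff \<mu> j u z * Xray (smooth \<nu> i) u z) \<partial>lborel)
         = (\<integral>\<^sup>+ z. 2 * (slab u z * (Xdiff \<mu> j u z * Xray (smooth \<nu> i) u z)) \<partial>lborel)"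
        by (rule nn_integral_cmult[symmetric]) measurable
      also have "\<dots> \<le> (\<integral>\<^sup>+ z. ennreal a * (slab u z * (Xdiff \<mu> j u z * Xdiff \<mu> j u z))
           + ennreal (1 / a) * (slab u z * (Xray (smooth \<nu> i) u z * Xray (smooth \<nu> i) u z)) \<partial>lborel)"
      proof (rule nn_integral_mono)
        fix z
        have "2 * (Xdiff \<mu> j u z * Xray (smooth \<nu> i) u z)
           \<le> ennreal a * (Xdiff \<mu> j u z * Xdiff \<mu> j u z) + ennreal (1 / a) * (Xray (smooth \<nu> i) u z * Xray (smooth \<nu> i) u z)"
          using a Xdiff_finite nu.Xray_smooth_finite[OF False] by (intro ennreal_am_gm)
        from ennreal_weight_le[OF this, of "slab u z"]
        show "2 * (slab u z * (Xdiff \<mu> j u z * Xray (smooth \<nu> i) u z))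
           \<le> ennreal a * (slab u z * (Xdiff \<mu> j u z * Xdiff \<mu> j u z))
           + ennreal (1 / a) * (slab u z * (Xray (smooth \<nu> i) u z * Xray (smooth \<nu> i) u z))"
          by (simp only: mult.left_commute[of "slab u z" 2])
      qed
      also have "\<dots> = ennreal a * (\<integral>\<^sup>+ z. slab u z * (Xdiff \<mu> j u z * Xdiff \<mu> j u z) \<partial>lborel)
           + ennreal (1 / a) * (\<integral>\<^sup>+ z. slab u z * (Xray (smooth \<nu> i) u z * Xray (smooth \<nu> i) u z) \<partial>lborel)"
        by (subst nn_integral_add) (auto simp: nn_integral_cmult intro: nu.measurable_smooth)
      finally show ?thesis
        using ennreal_weight_le by (subst mult.left_commute)
    qed simp
  qed
  also have "\<dots> = ennreal a * Ediff \<mu> j + ennreal (1 / a) * energy (smooth \<nu> i) (smooth \<nu> i)"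
    unfolding Ediff_def by (subst energy_eq_slab) (auto simp: nn_integral_add nn_integral_cmult)
  finally show ?thesis .
qed

lemma nn_integral_Delta_le:
  assumes s: "0 < s" "s < 1" and \<gamma>: "\<gamma> > 0" "\<gamma> \<ge> real CARD('n) - \<beta> - s"
  shows "(\<integral>\<^sup>+ y. \<integral>\<^sup>+ u. ennreal (wt u) * Delta j y u \<partial>lborel \<partial>\<nu>)
    \<le> ennreal ((diff_const s \<alpha> + growth_const s \<gamma> \<beta> * 2 powr \<gamma>) * 2 powr (- real j * ((\<alpha> + s - real CARD('n) - \<gamma>) / 2)))"
proof -
  let ?d = "real CARD('n)"
  \<comment> \<open>This t balances the two terms: a 2^(j (d - \<alpha> - s)) and 2^(j \<gamma>) / a
    with a = 2^(j t) both become 2^(-j \<eta>).\<close>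
  define t where "t = (\<gamma> + \<alpha> + s - ?d) / 2"
  define a where "a = 2 powr (real j * t)"
  define \<eta> where "\<eta> = (\<alpha> + s - ?d - \<gamma>) / 2"
  define K where "K = diff_const s \<alpha>"
  define G where "G = growth_const s \<gamma> \<beta>"
  have K: "0 \<le> K" by (simp add: K_def diff_const_nonneg)
  have "2 powr \<gamma> > 1" using \<gamma> by simp
  then have G: "0 \<le> G" by (simp add: G_def growth_const_def Let_def diff_const_nonneg rbound_def)
  have a: "a > 0" by (simp add: a_def)
  have [measurable]: "(\<lambda>(y, u). conv i (Xdiff \<mu> j u) y) \<in> borel_measurable (\<nu> \<Otimes>\<^sub>M lborel)" for i
    unfolding conv_def by measurable
  have [measurable]: "(\<lambda>u. conv i (Xdiff \<mu> j u) y) \<in> borel_measurable lborel" for i y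
    unfolding conv_def by measurable
  \<comment> \<open>One bound for both outer scales j and j + 1; the shift by one produces the
    factor 2^\<gamma> in the constant.\<close>
  have E: "energy (smooth \<nu> i) (smooth \<nu> i) \<le> ennreal (G * 2 powr ((real j + 1) * \<gamma>))" if "i \<le> Suc j" for i
  proof -
    have "2 powr (real i * \<gamma>) \<le> 2 powr ((real j + 1) * \<gamma>)" using that \<gamma> by (intro powr_mono mult_right_mono) auto
    then have "G * 2 powr (real i * \<gamma>) \<le> G * 2 powr ((real j + 1) * \<gamma>)" using G by (rule mult_left_mono)
    then show ?thesis using nu.energy_growth[OF s \<gamma>, of i] unfolding G_def by (auto intro: order_trans ennreal_leI)
  qed
  have *: "2 * (\<integral>\<^sup>+ y. \<integral>\<^sup>+ u. ennreal (wt u) * conv i (Xdiff \<mu> j u) y \<partial>lborel \<partial>\<nu>)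
     \<le> ennreal ((K + G * 2 powr \<gamma>) * 2 powr (- real j * \<eta>))" if "i \<le> Suc j" for i
  proof -
    have "2 * (\<integral>\<^sup>+ y. \<integral>\<^sup>+ u. ennreal (wt u) * conv i (Xdiff \<mu> j u) y \<partial>lborel \<partial>\<nu>)
       \<le> ennreal a * ennreal (K * 2 powr (real j * (?d - \<alpha> - s))) + ennreal (1 / a) * ennreal (G * 2 powr ((real j + 1) * \<gamma>))"
      by (rule order_trans[OF nn_integral_conv_Xdiff_le[OF a]])
         (intro add_mono mult_left_mono E that Ediff_le[OF s, folded K_def], auto)
    also have "\<dots> = ennreal (a * (K * 2 powr (real j * (?d - \<alpha> - s))) + (1 / a) * (G * 2 powr ((real j + 1) * \<gamma>)))"
    proof -
      have "ennreal a * ennreal (K * 2 powr (real j * (?d - \<alpha> - s))) = ennreal (a * (K * 2 powr (real j * (?d - \<alpha> - s))))"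
        using a K by (intro ennreal_mult[symmetric]) auto
      moreover have "ennreal (1 / a) * ennreal (G * 2 powr ((real j + 1) * \<gamma>)) = ennreal ((1 / a) * (G * 2 powr ((real j + 1) * \<gamma>)))"
        using a G by (intro ennreal_mult[symmetric]) auto
      ultimately show ?thesis using a K G by (simp only:) (intro ennreal_plus[symmetric], auto)
    qed
    also have "a * (K * 2 powr (real j * (?d - \<alpha> - s))) = K * 2 powr (- real j * \<eta>)"
    proof -
      have "a * 2 powr (real j * (?d - \<alpha> - s)) = 2 powr (real j * t + real j * (?d - \<alpha> - s))"
        by (simp add: a_def powr_add)
      also have "real j * t + real j * (?d - \<alpha> - s) = - real j * \<eta>"
        by (simp add: t_def \<eta>_def field_simps)
      finally show ?thesis by (simp add: mult_ac)
    qed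
    also have "(1 / a) * (G * 2 powr ((real j + 1) * \<gamma>)) = G * 2 powr \<gamma> * 2 powr (- real j * \<eta>)"
    proof -
      have "(1 / a) * 2 powr ((real j + 1) * \<gamma>) = 2 powr (- (real j * t) + (real j + 1) * \<gamma>)"
        by (simp only: a_def powr_add powr_minus_divide)
      also have "- (real j * t) + (real j + 1) * \<gamma> = \<gamma> + - real j * \<eta>"
        by (simp add: t_def \<eta>_def field_simps)
      finally have "(1 / a) * 2 powr ((real j + 1) * \<gamma>) = 2 powr \<gamma> * 2 powr (- real j * \<eta>)"
        by (simp only: powr_add)
      then show ?thesis by (simp only: mult.left_commute[of "1 / a"] mult_ac)
    qed
    finally show ?thesis by (simp add: distrib_right)
  qed
  let ?I = "\<lambda>i. \<integral>\<^sup>+ y. \<integral>\<^sup>+ u. ennreal (wt u) * conv i (Xdiff \<mu> j u) y \<partial>lborel \<partial>\<nu>"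
  have "2 * (\<integral>\<^sup>+ y. \<integral>\<^sup>+ u. ennreal (wt u) * Delta j y u \<partial>lborel \<partial>\<nu>) = 2 * ?I j + 2 * ?I (Suc j)"
    unfolding Delta_def distrib_left by (subst nn_integral_add; (subst nn_integral_add)?) (auto simp: distrib_left nn_integral_add)
  also have "\<dots> \<le> 2 * ennreal ((K + G * 2 powr \<gamma>) * 2 powr (- real j * \<eta>))"
    unfolding mult_2[of "ennreal _"] by (intro add_mono *) auto
  finally show ?thesis
    unfolding K_def G_def \<eta>_def by (simp add: ennreal_mult_le_mult_iff)
qed

end

lemma (in blocks) nn_integral_wt_le: "(\<integral>\<^sup>+ u. ennreal (wt u) \<partial>lborel) \<le> ennreal (8 ^ CARD('n))"
proof -
  have "(\<integral>\<^sup>+ u. ennreal (wt u) \<partial>lborel) \<le> (\<integral>\<^sup>+ u. indicator {w :: real^'n. \<forall>k. \<bar>w $ k\<bar> \<le> 4} u \<partial>lborel)"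
  proof (rule nn_integral_mono)
    fix u show "ennreal (wt u) \<le> indicator {w :: real^'n. \<forall>k. \<bar>w $ k\<bar> \<le> 4} u"
      using wt_le_1[of u] wt_support_nth[of u] by (cases "wt u = 0") (auto simp: ennreal_le_1)
  qed
  also have "\<dots> = ennreal (8 ^ CARD('n))" using emeasure_cube[of 4, where 'n='n] by simp
  finally show ?thesis .
qed

context blocks_frostman
begin

text \<open>Only the supremum is needed: it dominates the density of the projected measure, so the convergence
  of the regularized densities is never used.\<close>

definition Xsup :: "real^'n \<Rightarrow> real^'n \<Rightarrow> ennreal" where
  "Xsup y u = (SUP j. Xreg j y u)"

lemma measurable_Xsup [measurable (raw)]:
  assumes [measurable]: "g \<in> borel_measurable M" "h \<in> borel_measurable M"
  shows "(\<lambda>x. Xsup (g x) (h x)) \<in> borel_measurable M"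
  unfolding Xsup_def by measurable

lemma Xreg_scale:
  assumes "\<And>i. i < l \<Longrightarrow> s i > 0"
  shows "Xreg j y u = (\<Prod>i<l. ennreal (s i)) * Xreg j y (bscale b s u)"
  unfolding Xreg_def by (rule Xray_scale) (auto intro: assms measurable_conv measurable_smooth)

lemma Xsup_scale:
  assumes "\<And>i. i < l \<Longrightarrow> s i > 0"
  shows "Xsup y u = (\<Prod>i<l. ennreal (s i)) * Xsup y (bscale b s u)"
  unfolding Xsup_def by (subst Xreg_scale[OF assms]) (simp_all add: SUP_mult_left_ennreal)

end

context blocks_pair
begin

text \<open>The weights 2^(i (p - 1)) of the telescoped powers meet the decay 2^(-i \<eta>) of the
  differences, a geometric series of ratio 2^(p - 1 - \<eta>). This is why p - 1 < \<eta> is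
  required.\<close>

lemma Xsup_integral_le:
  assumes s: "0 < s" "s < 1" and \<gamma>: "\<gamma> > 0" "\<gamma> \<ge> real CARD('n) - \<beta> - s"
    and \<alpha>: "\<alpha> > real CARD('n) - 1" and \<eta>: "\<eta> = (\<alpha> + s - real CARD('n) - \<gamma>) / 2"
    and p: "p > 1" "p - 1 < \<eta>"
    and L: "L = diff_const s \<alpha> + growth_const s \<gamma> \<beta> * 2 powr \<gamma>"
    and S: "S = sup_const"
  shows "(\<integral>\<^sup>+ y. \<integral>\<^sup>+ u. ennreal (wt u) * ennreal_powr (Xsup y u) p \<partial>lborel \<partial>\<nu>)
    \<le> ennreal (S powr p * 8 ^ CARD('n) + p * (2 * S) powr (p - 1) * L / (1 - 2 powr (p - 1 - \<eta>)))"
proof -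
  define c where "c i = p * (S * 2 ^ Suc i) powr (p - 1)" for i
  have S0: "0 \<le> S" by (simp add: S sup_const_nonneg)
  have c: "c i \<ge> 0" for i using p by (simp add: c_def)
  have "2 powr \<gamma> > 1" using \<gamma> by simp
  then have L0: "0 \<le> L" by (simp add: L growth_const_def Let_def diff_const_nonneg rbound_def)
  define \<rho> where "\<rho> = (2::real) powr (p - 1 - \<eta>)"
  have \<rho>: "0 \<le> \<rho>" "\<rho> < 1" using p by (auto simp: \<rho>_def powr_less_one)
  have pw: "ennreal (wt u) * ennreal_powr (Xsup y u) p
      \<le> ennreal (S powr p) * ennreal (wt u) + (\<Sum>i. ennreal (c i) * (ennreal (wt u) * Delta i y u))" for y u
  proof (cases "wt u = 0")
    case False
    have "ennreal_powr (Xsup y u) p \<le> ennreal (S powr p) + (\<Sum>i. ennreal (c i) * Delta i y u)"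
      unfolding Xsup_def
    proof (rule ennreal_powr_SUP_le)
      fix j
      have "ennreal_powr (Xreg j y u) p \<le> ennreal (S powr p) + (\<Sum>i<j. ennreal (c i) * Delta i y u)"
        unfolding c_def S by (rule Xreg_powr_le[OF False \<alpha> p(1)])
      also have "\<dots> \<le> ennreal (S powr p) + (\<Sum>i. ennreal (c i) * Delta i y u)"
        by (intro add_left_mono sum_le_suminf) auto
      finally show "ennreal_powr (Xreg j y u) p \<le> ennreal (S powr p) + (\<Sum>i. ennreal (c i) * Delta i y u)" .
    qed (use p in auto)
    then have "ennreal (wt u) * ennreal_powr (Xsup y u) p
       \<le> ennreal (wt u) * (ennreal (S powr p) + (\<Sum>i. ennreal (c i) * Delta i y u))"
      by (rule mult_left_mono) simp
    then show ?thesis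
      unfolding distrib_left ennreal_suminf_cmult[symmetric] by (simp only: mult.commute[of "ennreal (wt u)" "ennreal (S powr p)"] mult.left_commute[of "ennreal (wt u)"])
  qed simp
  have "(\<integral>\<^sup>+ y. \<integral>\<^sup>+ u. ennreal (wt u) * ennreal_powr (Xsup y u) p \<partial>lborel \<partial>\<nu>)
     \<le> (\<integral>\<^sup>+ y. \<integral>\<^sup>+ u. ennreal (S powr p) * ennreal (wt u) + (\<Sum>i. ennreal (c i) * (ennreal (wt u) * Delta i y u)) \<partial>lborel \<partial>\<nu>)"
    by (intro nn_integral_mono pw)
  also have "\<dots> = (\<integral>\<^sup>+ y. ennreal (S powr p) * (\<integral>\<^sup>+ u. ennreal (wt u) \<partial>lborel)
      + (\<Sum>i. ennreal (c i) * (\<integral>\<^sup>+ u. ennreal (wt u) * Delta i y u \<partial>lborel)) \<partial>\<nu>)"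
    by (simp add: nn_integral_add nn_integral_cmult nn_integral_suminf)
  also have "\<dots> = ennreal (S powr p) * (\<integral>\<^sup>+ u. ennreal (wt u) \<partial>lborel) * emeasure \<nu> UNIV
      + (\<Sum>i. ennreal (c i) * (\<integral>\<^sup>+ y. \<integral>\<^sup>+ u. ennreal (wt u) * Delta i y u \<partial>lborel \<partial>\<nu>))"
    by (simp add: nn_integral_add nn_integral_cmult nn_integral_suminf)
  also have "\<dots> \<le> ennreal (S powr p) * ennreal (8 ^ CARD('n)) * 1
      + (\<Sum>i. ennreal (p * (2 * S) powr (p - 1) * L * \<rho> ^ i))"
  proof (intro add_mono mult_mono order_refl nn_integral_wt_le nu.emeasure_UNIV_le suminf_le summableI)
    fix i
    have "ennreal (c i) * (\<integral>\<^sup>+ y. \<integral>\<^sup>+ u. ennreal (wt u) * Delta i y u \<partial>lborel \<partial>\<nu>)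
       \<le> ennreal (c i) * ennreal (L * 2 powr (- real i * \<eta>))"
      unfolding L \<eta> by (intro mult_left_mono nn_integral_Delta_le s \<gamma>) auto
    also have "\<dots> = ennreal (c i * (L * 2 powr (- real i * \<eta>)))"
      using c L0 by (intro ennreal_mult[symmetric]) auto
    also have "c i * (L * 2 powr (- real i * \<eta>)) = p * (2 * S) powr (p - 1) * L * \<rho> ^ i"
    proof -
      have "(S * 2 ^ Suc i) powr (p - 1) = (2 * S) powr (p - 1) * (2 ^ i) powr (p - 1)"
        using S0 by (simp add: powr_mult[symmetric] mult_ac)
      also have "((2::real) ^ i) powr (p - 1) = 2 powr (real i * (p - 1))"
        by (simp add: powr_realpow[symmetric] powr_powr)
      finally have "c i = p * (2 * S) powr (p - 1) * 2 powr (real i * (p - 1))" by (simp add: c_def)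
      moreover have "\<rho> ^ i = 2 powr (real i * (p - 1)) * 2 powr (- real i * \<eta>)"
        unfolding \<rho>_def powr_add[symmetric] by (simp add: powr_realpow[symmetric] powr_powr algebra_simps)
      ultimately show ?thesis by (simp only: mult_ac)
    qed
    finally show "ennreal (c i) * (\<integral>\<^sup>+ y. \<integral>\<^sup>+ u. ennreal (wt u) * Delta i y u \<partial>lborel \<partial>\<nu>)
       \<le> ennreal (p * (2 * S) powr (p - 1) * L * \<rho> ^ i)" .
  qed auto
  also have "(\<Sum>i. ennreal (p * (2 * S) powr (p - 1) * L * \<rho> ^ i)) = ennreal (p * (2 * S) powr (p - 1) * L * (1 / (1 - \<rho>)))"
    using \<rho> p S0 L0 by (intro suminf_ennreal_eq sums_mult geometric_sums) auto
  also have "ennreal (S powr p) * ennreal (8 ^ CARD('n)) * 1 + \<dots>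
      = ennreal (S powr p * 8 ^ CARD('n) + p * (2 * S) powr (p - 1) * L / (1 - \<rho>))"
  proof -
    have "ennreal (S powr p) * ennreal (8 ^ CARD('n)) = ennreal (S powr p * 8 ^ CARD('n))"
      by (intro ennreal_mult[symmetric]) auto
    moreover have "0 \<le> p * (2 * S) powr (p - 1) * L / (1 - \<rho>)" using \<rho> p S0 L0 by simp
    ultimately show ?thesis by (simp add: ennreal_plus)
  qed
  finally show ?thesis by (simp add: \<rho>_def)
qed

end

lemma (in blocks) Xsup_integral_bound:
  assumes \<alpha>: "real CARD('n) - 1 < \<alpha>" "\<alpha> \<le> real CARD('n)" and \<beta>: "2 * (real CARD('n) - 1) - \<alpha> < \<beta>"
  shows "\<exists>p \<kappa>. p > 1 \<and> \<kappa> \<ge> 0 \<and> (\<forall>\<mu> \<nu>. blocks_pair l b \<mu> \<alpha> \<nu> \<beta> \<longrightarrow>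
    (\<integral>\<^sup>+ y. \<integral>\<^sup>+ u. ennreal (wt u) * ennreal_powr (blocks_frostman.Xsup l b \<mu> y u) p \<partial>lborel \<partial>\<nu>) \<le> ennreal \<kappa>)"
proof -
  let ?d = "real CARD('n)"
  \<comment> \<open>The smaller of the margins in the two hypotheses. Keeping s and \<gamma> at
    distance e/4 from their limits 1 and max(0, d - 1 - \<beta>) leaves \<eta> \<ge> e/4, and e
    \<le> 1, a consequence of \<alpha> \<le> d, keeps s positive.\<close>
  define e where "e = min (\<alpha> - ?d + 1) (\<alpha> + \<beta> - 2 * ?d + 2)"
  have e: "0 < e" "e \<le> 1" "e \<le> \<alpha> - ?d + 1" "e \<le> \<alpha> + \<beta> - 2 * ?d + 2"
    using \<alpha> \<beta> by (auto simp: e_def min_le_iff_disj)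
  define s where "s = 1 - e / 4"
  define \<gamma> where "\<gamma> = max (e / 4) (?d - 1 - \<beta> + e / 4)"
  define \<eta> where "\<eta> = (\<alpha> + s - ?d - \<gamma>) / 2"
  define p where "p = 1 + \<eta> / 2"
  define L where "L = diff_const s \<alpha> + growth_const s \<gamma> \<beta> * 2 powr \<gamma>"
  define S where "S = (2 * ?d) powr \<alpha> * (2 * rbound) ^ l"
  have s: "0 < s" "s < 1" using e by (auto simp: s_def)
  have \<gamma>: "\<gamma> > 0" "\<gamma> \<ge> ?d - \<beta> - s" using e by (auto simp: \<gamma>_def s_def)
  have \<eta>: "\<eta> > 0" using e by (auto simp: \<eta>_def s_def \<gamma>_def max_def)
  have p: "p > 1" "p - 1 < \<eta>" using \<eta> by (auto simp: p_def)
  let ?\<kappa> = "S powr p * 8 ^ CARD('n) + p * (2 * S) powr (p - 1) * L / (1 - 2 powr (p - 1 - \<eta>))"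
  have "(\<integral>\<^sup>+ y. \<integral>\<^sup>+ u. ennreal (wt u) * ennreal_powr (blocks_frostman.Xsup l b \<mu> y u) p \<partial>lborel \<partial>\<nu>) \<le> ennreal ?\<kappa>"
    if "blocks_pair l b \<mu> \<alpha> \<nu> \<beta>" for \<mu> \<nu>
  proof -
    interpret blocks_pair l b \<mu> \<alpha> \<nu> \<beta> by fact
    show ?thesis
      by (rule Xsup_integral_le[OF s \<gamma> \<alpha>(1) \<eta>_def p L_def]) (simp add: S_def sup_const_def)
  qed
  then have "\<forall>\<mu> \<nu>. blocks_pair l b \<mu> \<alpha> \<nu> \<beta> \<longrightarrow>
    (\<integral>\<^sup>+ y. \<integral>\<^sup>+ u. ennreal (wt u) * ennreal_powr (blocks_frostman.Xsup l b \<mu> y u) p \<partial>lborel \<partial>\<nu>) \<le> ennreal (max 0 ?\<kappa>)"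
    by (meson order_trans ennreal_leI max.cobounded2)
  then show ?thesis using p by (intro exI[of _ p] exI[of _ "max 0 ?\<kappa>"]) auto
qed

section \<open>Domination of the projected measure\<close>

lemma nn_integral_conv_mult:
  fixes f g :: "real^'n::finite \<Rightarrow> ennreal"
  assumes [measurable]: "f \<in> borel_measurable borel" "g \<in> borel_measurable borel"
  shows "(\<integral>\<^sup>+ z. conv j f z * g z \<partial>lborel) = (\<integral>\<^sup>+ z. f z * conv j g z \<partial>lborel)"
proof -
  have "(\<integral>\<^sup>+ z. conv j f z * g z \<partial>lborel) = (\<integral>\<^sup>+ z. \<integral>\<^sup>+ v. bump j v * f (z + v) * g z \<partial>lborel \<partial>lborel)"
    unfolding conv_def by (simp add: nn_integral_multc)
  also have "\<dots> = (\<integral>\<^sup>+ v. \<integral>\<^sup>+ z. bump j v * f (z + v) * g z \<partial>lborel \<partial>lborel)"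
    by (rule lborel_pair.Fubini') measurable
  also have "\<dots> = (\<integral>\<^sup>+ v. \<integral>\<^sup>+ z. bump j v * f z * g (z - v) \<partial>lborel \<partial>lborel)"
  proof (rule nn_integral_cong)
    fix v
    have "(\<integral>\<^sup>+ z. bump j v * f (z + v) * g z \<partial>lborel) = (\<integral>\<^sup>+ z. (\<lambda>z. bump j v * f z * g (z - v)) (z + v) \<partial>lborel)"
      by simp
    also have "\<dots> = (\<integral>\<^sup>+ z. bump j v * f z * g (z - v) \<partial>lborel)"
      by (rule nn_integral_lborel_shift) measurable
    finally show "(\<integral>\<^sup>+ z. bump j v * f (z + v) * g z \<partial>lborel) = (\<integral>\<^sup>+ z. bump j v * f z * g (z - v) \<partial>lborel)" .
  qed
  also have "\<dots> = (\<integral>\<^sup>+ z. \<integral>\<^sup>+ v. bump j v * f z * g (z - v) \<partial>lborel \<partial>lborel)"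
    by (rule lborel_pair.Fubini') measurable
  also have "\<dots> = (\<integral>\<^sup>+ z. f z * conv j g z \<partial>lborel)"
  proof (rule nn_integral_cong)
    fix z
    have "(\<integral>\<^sup>+ v. bump j v * f z * g (z - v) \<partial>lborel)
        = (\<integral>\<^sup>+ v. bump j v * f z * g (z - v) \<partial>distr (lborel :: (real^'n) measure) borel (\<lambda>v. - v))"
      using lborel_affine[of "-1" "0 :: real^'n"] by (simp add: density_1)
    also have "\<dots> = (\<integral>\<^sup>+ v. bump j v * f z * g (z + v) \<partial>lborel)"
      by (subst nn_integral_distr) (auto simp: bump_minus)
    also have "\<dots> = f z * conv j g z"
      unfolding conv_def by (simp add: nn_integral_cmult[symmetric] mult_ac)
    finally show "(\<integral>\<^sup>+ v. bump j v * f z * g (z - v) \<partial>lborel) = f z * conv j g z" .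
  qed
  finally show ?thesis .
qed

lemma conv_indicator_eq_1:
  fixes g :: "real^'n::finite \<Rightarrow> ennreal"
  assumes "\<And>v. (\<And>k. \<bar>v $ k\<bar> \<le> (1/2) ^ j) \<Longrightarrow> g (x + v) = 1"
  shows "conv j g x = 1"
proof -
  have "conv j g x = (\<integral>\<^sup>+ v. bump j (v :: real^'n) \<partial>lborel)"
    unfolding conv_def
  proof (rule nn_integral_cong)
    fix v show "bump j v * g (x + v) = bump j v"
      using assms[of v] bump_eq_0[of v _ j] by (cases "\<forall>k. \<bar>v $ k\<bar> \<le> (1/2) ^ j") auto
  qed
  then show ?thesis by (simp add: nn_integral_bump)
qed

text \<open>The Jacobian, the product of the r_i to the power d_i, is written as a product over
  single coordinates.\<close>

lemma nn_integral_lborel_bscale: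
  fixes H :: "real^'n::finite \<Rightarrow> ennreal"
  assumes [measurable]: "H \<in> borel_measurable borel" and r: "\<And>k. r (b k) > 0"
  shows "(\<integral>\<^sup>+ w. H w \<partial>lborel) = (\<Prod>k\<in>UNIV. ennreal (r (b k))) * (\<integral>\<^sup>+ u. H (bscale b r u) \<partial>lborel)"
proof -
  define c where "c j = bscale b r j \<bullet> j" for j :: "real^'n"
  have B: "(Basis :: (real^'n) set) = range (\<lambda>k. axis k 1)" by (auto simp: Basis_vec_def)
  have c: "c (axis k 1) = r (b k)" for k by (simp add: c_def inner_axis)
  have T: "0 + (\<Sum>j\<in>Basis. (c j * (x \<bullet> j)) *\<^sub>R j) = bscale b r x" for x
  proof (rule euclidean_eqI)
    fix i :: "real^'n" assume "i \<in> Basis"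
    then obtain k where k: "i = axis k 1" by (auto simp: B)
    have "(0 + (\<Sum>j\<in>Basis. (c j * (x \<bullet> j)) *\<^sub>R j)) \<bullet> i = c i * (x \<bullet> i)"
      using \<open>i \<in> Basis\<close> by (simp add: inner_sum_left_Basis)
    then show "(0 + (\<Sum>j\<in>Basis. (c j * (x \<bullet> j)) *\<^sub>R j)) \<bullet> i = bscale b r x \<bullet> i"
      by (simp add: k c inner_axis)
  qed
  have inj: "inj (\<lambda>k. axis k (1::real) :: real^'n)" by (auto simp: inj_on_def axis_eq_axis)
  have P: "(\<Prod>j\<in>Basis. \<bar>c j\<bar>) = (\<Prod>k\<in>UNIV. r (b k))"
    unfolding B by (subst prod.reindex[OF inj]) (auto simp: c abs_of_pos r intro!: prod.cong)
  have [measurable]: "bscale b r \<in> borel_measurable borel"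
    by (rule borel_measurable_vecI) (auto intro!: borel_measurable_continuous_onI continuous_intros)
  have "lborel = density (distr lborel borel (\<lambda>x. 0 + (\<Sum>j\<in>Basis. (c j * (x \<bullet> j)) *\<^sub>R j))) (\<lambda>_. (\<Prod>j\<in>Basis. \<bar>c j\<bar>))"
    by (rule lborel_affine_euclidean) (use r in \<open>auto simp: B c less_imp_neq[THEN not_sym]\<close>)
  then have "lborel = density (distr lborel borel (bscale b r)) (\<lambda>_. ennreal (\<Prod>k\<in>UNIV. r (b k)))"
    unfolding T P .
  then have "(\<integral>\<^sup>+ w. H w \<partial>lborel) = (\<integral>\<^sup>+ w. H w \<partial>density (distr lborel borel (bscale b r)) (\<lambda>_. ennreal (\<Prod>k\<in>UNIV. r (b k))))"
    by (rule arg_cong)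
  also have "\<dots> = ennreal (\<Prod>k\<in>UNIV. r (b k)) * (\<integral>\<^sup>+ u. H (bscale b r u) \<partial>lborel)"
    by (simp add: nn_integral_density nn_integral_distr nn_integral_cmult)
  also have "ennreal (\<Prod>k\<in>UNIV. r (b k)) = (\<Prod>k\<in>UNIV. ennreal (r (b k)))"
    by (rule prod_ennreal[symmetric]) (use r in \<open>auto intro: less_imp_le\<close>)
  finally show ?thesis .
qed

section \<open>Cones of directions and dilation orbits\<close>

context blocks
begin

definition nondeg :: "(real^'n) set" where
  "nondeg = {w. \<forall>i<l. block_proj b i w \<noteq> 0}"

text \<open>The tuple of unit directions kept as one vector of R^d, so that open sets and outer
  regularity there can be used. The passage to actual tuples comes later.\<close>

definition dir :: "real^'n \<Rightarrow> real^'n" where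
  "dir w = (\<chi> k. w $ k / norm (block_proj b (b k) w))"

lemma continuous_on_block_proj [continuous_intros]:
  "continuous_on A f \<Longrightarrow> continuous_on A (\<lambda>x. block_proj b i (f x))"
  unfolding block_proj_def
proof (intro continuous_on_vec_lambda)
  fix k assume "continuous_on A f"
  then show "continuous_on A (\<lambda>x. if b k = i then f x $ k else 0)"
    by (cases "b k = i") (auto intro!: continuous_intros)
qed

lemma open_nondeg: "open nondeg"
proof -
  have "nondeg = (\<Inter>i\<in>{..<l}. {w. block_proj b i w \<noteq> 0})" by (auto simp: nondeg_def)
  moreover have "open {w. block_proj b i w \<noteq> 0}" for i
    by (intro open_Collect_neq continuous_intros)
  ultimately show ?thesis by auto
qed

lemma continuous_on_dir: "continuous_on nondeg dir"
  unfolding dir_def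
  by (intro continuous_intros) (use b_less in \<open>auto simp: nondeg_def\<close>)

lemma borel_measurable_dir [measurable]: "dir \<in> borel_measurable borel"
proof (rule borel_measurable_vecI)
  fix k
  have [measurable]: "(\<lambda>x :: real^'n. x $ k) \<in> borel_measurable borel"
    by (auto intro!: borel_measurable_continuous_onI continuous_intros)
  show "(\<lambda>x. dir x $ k) \<in> borel_measurable borel" unfolding dir_def by simp
qed

lemma sets_nondeg [measurable]: "nondeg \<in> sets borel"
  using open_nondeg by simp

lemma sets_shell [measurable]: "shell \<in> sets borel"
proof -
  have "shell = (\<Inter>i\<in>{..<l}. {u. 2 \<le> norm (block_proj b i u)} \<inter> {u. norm (block_proj b i u) \<le> 3})"
    by (auto simp: shell_def)
  moreover have "closed {u. 2 \<le> norm (block_proj b i u)}" "closed {u. norm (block_proj b i u) \<le> 3}" for i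
    by (intro closed_Collect_le continuous_intros)+
  ultimately show ?thesis by (metis (no_types, lifting) borel_closed closed_INT closed_Int)
qed

lemma shell_subset_nondeg: "shell \<subseteq> nondeg"
  by (auto simp: shell_def nondeg_def)

lemma dir_bscale:
  assumes "\<And>i. i < l \<Longrightarrow> r i > 0"
  shows "dir (bscale b r u) = dir u"
proof -
  have "r (b k) \<noteq> 0 \<and> \<bar>r (b k)\<bar> = r (b k)" for k using assms[OF b_less[of k]] by simp
  then show ?thesis by (simp add: dir_def vec_eq_iff block_proj_bscale)
qed

lemma bscale_in_nondeg_iff:
  assumes "\<And>i. i < l \<Longrightarrow> r i > 0"
  shows "bscale b r u \<in> nondeg \<longleftrightarrow> u \<in> nondeg"
proof -
  have "r i \<noteq> 0" if "i < l" for i using assms[OF that] by simp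
  then show ?thesis by (auto simp: nondeg_def block_proj_bscale)
qed

definition dir_const :: real where
  "dir_const = 3 ^ l * (2 * real CARD('n)) ^ CARD('n)"

lemma dir_const_pos: "dir_const > 0"
  by (simp add: dir_const_def)

text \<open>The shell contains a fixed proportion of every dilation orbit, on which the Jacobian is bounded
  below; this replaces integration in polar coordinates.\<close>

lemma orbit_lower_bound:
  assumes w: "w \<in> nondeg" "\<And>k. \<bar>w $ k\<bar> \<le> 4"
  shows "1 \<le> ennreal dir_const * (\<integral>\<^sup>+ r. (\<Prod>i<l. indicator {0<..} (r i)) *
      ((\<Prod>k\<in>UNIV. ennreal (1 / r (b k))) * indicator shell (bscale b (\<lambda>i. 1 / r i) w)) \<partial>plane_measure l)"
proof -
  interpret product_sigma_finite "\<lambda>_::nat. lborel :: real measure" by standard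
  let ?d = "CARD('n)"
  define m where "m i = norm (block_proj b i w)" for i
  have m: "m i > 0" if "i < l" for i using w(1) that by (simp add: m_def nondeg_def)
  have m4: "m i \<le> 4 * real ?d" for i
  proof -
    have "m i \<le> norm w" unfolding m_def by (rule norm_block_proj_le)
    also have "\<dots> \<le> (\<Sum>k\<in>UNIV. \<bar>w $ k\<bar>)" by (rule norm_le_l1_cart)
    also have "\<dots> \<le> (\<Sum>k\<in>(UNIV::'n set). 4)" by (intro sum_mono w)
    finally show ?thesis by simp
  qed
  \<comment> \<open>For positive r_i, membership in this interval says exactly 2 \<le> m_i / r_i
    \<le> 3, that is, that the i-th block satisfies the shell condition.\<close>
  define J where "J i = {m i / 3..m i / 2}" for i
  define rep where "rep i = (SOME k. b k = i)" for i
  have rep: "b (rep i) = i" if "i < l" for i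
    unfolding rep_def using block_nonempty[OF that] by (rule someI_ex)
  have injr: "inj_on rep {..<l}" by (rule inj_on_inverseI[of _ b]) (simp add: rep)
  \<comment> \<open>A lower bound for the product of 2 / m_(b k) over all coordinates k. One
    coordinate per block keeps its exact factor, to cancel the length m_i / 6 of \<open>J i\<close>
    up to 1/3; the others are bounded below by 1 / (2 d) because m_i \<le> 4 d. This is the origin
    of \<open>dir_const\<close>.\<close>
  define c where "c = (\<Prod>i<l. 2 / m i) * (1 / (2 * real ?d)) ^ ?d"
  have pk: "c \<le> (\<Prod>k\<in>UNIV. 2 / m (b k))"
  proof -
    have d: "1 / (2 * real ?d) \<le> 2 / m (b k)" for k
      using m4[of "b k"] m[OF b_less[of k]] by (simp add: field_simps)
    have "real ?d \<ge> 1" using zero_less_card_finite[where 'a='n] by linarith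
    then have "1 / (2 * real ?d) \<le> 1" by (subst divide_le_eq_1_pos) linarith+
    then have "(1 / (2 * real ?d)) ^ ?d \<le> (1 / (2 * real ?d)) ^ card (UNIV - rep ` {..<l})"
      by (intro power_decreasing card_mono) auto
    also have "\<dots> = (\<Prod>k\<in>UNIV - rep ` {..<l}. 1 / (2 * real ?d))" by simp
    also have "\<dots> \<le> (\<Prod>k\<in>UNIV - rep ` {..<l}. 2 / m (b k))" by (intro prod_mono) (auto simp: d)
    finally have "c \<le> (\<Prod>i<l. 2 / m i) * (\<Prod>k\<in>UNIV - rep ` {..<l}. 2 / m (b k))"
      unfolding c_def using m by (intro mult_left_mono prod_nonneg) (auto intro: less_imp_le)
    also have "(\<Prod>i<l. 2 / m i) = (\<Prod>k\<in>rep ` {..<l}. 2 / m (b k))"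
      by (subst prod.reindex[OF injr]) (auto simp: rep intro!: prod.cong)
    also have "\<dots> * (\<Prod>k\<in>UNIV - rep ` {..<l}. 2 / m (b k)) = (\<Prod>k\<in>UNIV. 2 / m (b k))"
      using prod.subset_diff[of "rep ` {..<l}" UNIV "\<lambda>k. 2 / m (b k)"] by (simp add: mult.commute)
    finally show ?thesis .
  qed
  have "ennreal c * (\<Prod>i<l. indicator (J i) (r i)) \<le> (\<Prod>i<l. indicator {0<..} (r i)) *
      ((\<Prod>k\<in>UNIV. ennreal (1 / r (b k))) * indicator shell (bscale b (\<lambda>i. 1 / r i) w))" for r
  proof (cases "\<forall>i<l. r i \<in> J i")
    case True
    have r: "r i > 0" "m i / 3 \<le> r i" "r i \<le> m i / 2" if "i < l" for i
      using True m[OF that] that by (force simp: J_def)+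
    have "bscale b (\<lambda>i. 1 / r i) w \<in> shell"
      unfolding shell_def
    proof (intro CollectI allI impI)
      fix i assume i: "i < l"
      have "norm (block_proj b i (bscale b (\<lambda>i. 1 / r i) w)) = m i / r i"
        using r(1)[OF i] by (simp add: block_proj_bscale m_def)
      then show "2 \<le> norm (block_proj b i (bscale b (\<lambda>i. 1 / r i) w)) \<and> norm (block_proj b i (bscale b (\<lambda>i. 1 / r i) w)) \<le> 3"
        using r[OF i] by (simp only:) (simp add: field_simps)
    qed
    moreover have "(\<Prod>i<l. indicator {0<..} (r i)) = (1::ennreal)" using r by (intro prod.neutral) auto
    moreover have "(\<Prod>i<l. indicator (J i) (r i)) = (1::ennreal)" using True by (intro prod.neutral) auto
    moreover have "ennreal c \<le> (\<Prod>k\<in>UNIV. ennreal (1 / r (b k)))"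
    proof -
      have rk: "r (b k) > 0" "r (b k) \<le> m (b k) / 2" for k using r b_less by auto
      have "(\<Prod>k\<in>UNIV. 2 / m (b k)) \<le> (\<Prod>k\<in>UNIV. 1 / r (b k))"
        using rk m[OF b_less] by (intro prod_mono) (auto simp: field_simps intro: less_imp_le)
      then have "c \<le> (\<Prod>k\<in>UNIV. 1 / r (b k))" using pk by simp
      then show ?thesis using rk by (subst prod_ennreal) (auto intro: ennreal_leI less_imp_le)
    qed
    ultimately show ?thesis by simp
  next
    case False
    then obtain i where "i < l" "r i \<notin> J i" by blast
    then have "(\<Prod>i<l. indicator (J i) (r i)) = (0::ennreal)" by (intro prod_zero bexI[of _ i]) auto
    then show ?thesis by (simp only: mult_zero_right zero_le)
  qed
  then have "(\<integral>\<^sup>+ r. ennreal c * (\<Prod>i<l. indicator (J i) (r i)) \<partial>plane_measure l)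
     \<le> (\<integral>\<^sup>+ r. (\<Prod>i<l. indicator {0<..} (r i)) *
      ((\<Prod>k\<in>UNIV. ennreal (1 / r (b k))) * indicator shell (bscale b (\<lambda>i. 1 / r i) w)) \<partial>plane_measure l)"
    by (rule nn_integral_mono)
  moreover have "(\<integral>\<^sup>+ r. ennreal c * (\<Prod>i<l. indicator (J i) (r i)) \<partial>plane_measure l) = ennreal (1 / dir_const)"
  proof -
    have "(\<integral>\<^sup>+ r. ennreal c * (\<Prod>i<l. indicator (J i) (r i)) \<partial>plane_measure l)
       = ennreal c * (\<integral>\<^sup>+ r. (\<Prod>i<l. indicator (J i) (r i)) \<partial>plane_measure l)"
      by (intro nn_integral_cmult measurable_prod_indicator_plane) (auto simp: J_def)
    also have "(\<integral>\<^sup>+ r. (\<Prod>i<l. indicator (J i) (r i)) \<partial>plane_measure l) = (\<Prod>i<l. \<integral>\<^sup>+ x. indicator (J i) x \<partial>lborel)"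
      unfolding plane_measure_def by (rule product_nn_integral_prod) (auto simp: J_def)
    also have "\<dots> = (\<Prod>i<l. ennreal (m i / 6))"
      using m by (intro prod.cong refl) (auto simp: J_def field_simps)
    also have "\<dots> = ennreal (\<Prod>i<l. m i / 6)" using m by (intro prod_ennreal) (auto intro: less_imp_le)
    also have "ennreal c * ennreal (\<Prod>i<l. m i / 6) = ennreal (c * (\<Prod>i<l. m i / 6))"
      using m by (intro ennreal_mult[symmetric] prod_nonneg) (auto simp: c_def intro!: prod_nonneg mult_nonneg_nonneg intro: less_imp_le)
    also have "c * (\<Prod>i<l. m i / 6) = 1 / dir_const"
    proof -
      have "(\<Prod>i<l. 2 / m i) * (\<Prod>i<l. m i / 6) = (\<Prod>i<l. 1 / 3)"
        unfolding prod.distrib[symmetric] using m by (intro prod.cong) (auto simp: less_imp_neq[THEN not_sym])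
      then show ?thesis by (simp add: c_def dir_const_def mult_ac power_divide)
    qed
    finally show ?thesis .
  qed
  ultimately have "ennreal (1 / dir_const) \<le> (\<integral>\<^sup>+ r. (\<Prod>i<l. indicator {0<..} (r i)) *
      ((\<Prod>k\<in>UNIV. ennreal (1 / r (b k))) * indicator shell (bscale b (\<lambda>i. 1 / r i) w)) \<partial>plane_measure l)"
    by simp
  from mult_left_mono[OF this, of "ennreal dir_const"]
  show ?thesis using dir_const_pos by (simp add: ennreal_mult'[symmetric])
qed

text \<open>Each w is spread over its dilation orbit by a kernel of mass at least 1 /
  \<open>dir_const\<close>. The substitution w = r.u puts u into the shell, its Jacobian cancels the
  product of the 1 / r_(b k), and directions are unchanged as r is positive. Enlarging the range of
  r to all reals yields the plane integral.\<close>

lemma nn_integral_cone_le: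
  assumes [measurable]: "F \<in> borel_measurable borel" "U \<in> sets borel"
    and F: "supp3 F" and y: "\<And>k. \<bar>y $ k\<bar> \<le> 1"
  shows "(\<integral>\<^sup>+ w. indicator (nondeg \<inter> dir -` U) w * F (y + w) \<partial>lborel)
    \<le> ennreal dir_const * (\<integral>\<^sup>+ u. indicator shell u * indicator U (dir u) * Xray F u y \<partial>lborel)"
proof -
  interpret p: pair_sigma_finite "lborel :: (real^'n) measure" "plane_measure l" by standard
  let ?O = "nondeg \<inter> dir -` U"
  have [measurable]: "?O \<in> sets borel"
    using measurable_sets_borel[OF borel_measurable_dir, of U] by auto
  have [measurable]: "(\<lambda>r. r i) \<in> borel_measurable (plane_measure l)" if "i < l" for i
    unfolding plane_measure_def using measurable_component_singleton[of i "{..<l}" "\<lambda>_. lborel"] that by simp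
  have pos[measurable]: "(\<lambda>r. \<Prod>i<l. indicator {0<..} (r i) :: ennreal) \<in> borel_measurable (plane_measure l)"
    by (rule measurable_prod_indicator_plane) auto
  have sc[measurable]: "(\<lambda>(w, r). bscale b (\<lambda>i. 1 / r i) w) \<in> borel_measurable (lborel \<Otimes>\<^sub>M plane_measure l)"
    by (rule borel_measurable_vecI) (auto simp: case_prod_beta' intro!: borel_measurable_times borel_measurable_divide
        measurable_compose[OF measurable_snd measurable_component_plane]
        measurable_compose[OF measurable_fst, of "\<lambda>x. x $ _"] borel_measurable_continuous_onI continuous_intros)
  define k where "k w r = (\<Prod>i<l. indicator {0<..} (r i)) *
      ((\<Prod>k\<in>UNIV. ennreal (1 / r (b k))) * indicator shell (bscale b (\<lambda>i. 1 / r i) w))" for w and r :: "nat \<Rightarrow> real"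
  have [measurable]: "(\<lambda>(w, r). k w r) \<in> borel_measurable (lborel \<Otimes>\<^sub>M plane_measure l)"
    unfolding k_def using sc by measurable
  have "(\<integral>\<^sup>+ w. indicator ?O w * F (y + w) \<partial>lborel)
     \<le> (\<integral>\<^sup>+ w. ennreal dir_const * (\<integral>\<^sup>+ r. k w r * (indicator ?O w * F (y + w)) \<partial>plane_measure l) \<partial>lborel)"
  proof (rule nn_integral_mono)
    fix w
    show "indicator ?O w * F (y + w) \<le> ennreal dir_const * (\<integral>\<^sup>+ r. k w r * (indicator ?O w * F (y + w)) \<partial>plane_measure l)"
    proof (cases "indicator ?O w * F (y + w) = 0")
      case False
      then have w: "w \<in> nondeg" "F (y + w) \<noteq> 0" by (auto simp: indicator_def split: if_splits)
      have "\<bar>w $ k\<bar> \<le> 4" for k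
      proof -
        have "\<bar>(y + w) $ k\<bar> \<le> 3" using F w(2) unfolding supp3_def by blast
        then show ?thesis using y[of k] by simp
      qed
      from orbit_lower_bound[OF w(1) this]
      have "1 * (indicator ?O w * F (y + w)) \<le> (ennreal dir_const * (\<integral>\<^sup>+ r. k w r \<partial>plane_measure l)) * (indicator ?O w * F (y + w))"
        unfolding k_def by (rule mult_right_mono) simp
      also have "\<dots> = ennreal dir_const * (\<integral>\<^sup>+ r. k w r * (indicator ?O w * F (y + w)) \<partial>plane_measure l)"
      proof -
        have [measurable]: "(\<lambda>r. k w r) \<in> borel_measurable (plane_measure l)" by measurable
        show ?thesis by (simp add: nn_integral_multc mult.assoc)
      qed
      finally show ?thesis by simp
    next
      case True
      show ?thesis unfolding True by simp
    qed
  qed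
  also have "\<dots> = ennreal dir_const * (\<integral>\<^sup>+ w. \<integral>\<^sup>+ r. k w r * (indicator ?O w * F (y + w)) \<partial>plane_measure l \<partial>lborel)"
    by (rule nn_integral_cmult) measurable
  also have "(\<integral>\<^sup>+ w. \<integral>\<^sup>+ r. k w r * (indicator ?O w * F (y + w)) \<partial>plane_measure l \<partial>lborel)
     = (\<integral>\<^sup>+ r. \<integral>\<^sup>+ w. k w r * (indicator ?O w * F (y + w)) \<partial>lborel \<partial>plane_measure l)"
    by (rule p.Fubini'[symmetric]) measurable
  also have "\<dots> \<le> (\<integral>\<^sup>+ r. \<integral>\<^sup>+ u. indicator shell u * indicator U (dir u) * F (y + bscale b r u) \<partial>lborel \<partial>plane_measure l)"
  proof (rule nn_integral_mono)
    fix r assume r[measurable]: "r \<in> space (plane_measure l)"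
    show "(\<integral>\<^sup>+ w. k w r * (indicator ?O w * F (y + w)) \<partial>lborel)
      \<le> (\<integral>\<^sup>+ u. indicator shell u * indicator U (dir u) * F (y + bscale b r u) \<partial>lborel)"
    proof (cases "\<forall>i<l. r i > 0")
      case True
      then have rp: "\<And>i. i < l \<Longrightarrow> r i > 0" by blast
      have rk: "r (b k) > 0" for k using True b_less by blast
      have ib: "bscale b (\<lambda>i. 1 / r i) (bscale b r u) = u" for u
        using rk by (simp add: vec_eq_iff less_imp_neq[THEN not_sym])
      have e1: "(\<Prod>k\<in>UNIV. ennreal (r (b k))) * (\<Prod>k\<in>UNIV. ennreal (1 / r (b k))) = 1"
        unfolding prod.distrib[symmetric] using rk
        by (intro prod.neutral) (auto simp: ennreal_mult'[symmetric] less_imp_le less_imp_neq[THEN not_sym])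
      have [measurable]: "(\<lambda>w. k w r) \<in> borel_measurable borel"
        by measurable
      have "(\<integral>\<^sup>+ w. k w r * (indicator ?O w * F (y + w)) \<partial>lborel)
        = (\<Prod>k\<in>UNIV. ennreal (r (b k))) * (\<integral>\<^sup>+ u. k (bscale b r u) r * (indicator ?O (bscale b r u) * F (y + bscale b r u)) \<partial>lborel)"
        by (rule nn_integral_lborel_bscale[where H="\<lambda>w. k w r * (indicator ?O w * F (y + w))"]) (auto simp: rk)
      also have "(\<lambda>u. k (bscale b r u) r * (indicator ?O (bscale b r u) * F (y + bscale b r u)))
         = (\<lambda>u. (\<Prod>k\<in>UNIV. ennreal (1 / r (b k))) * (indicator shell u * indicator U (dir u) * F (y + bscale b r u)))"
      proof
        fix u
        have o: "(\<Prod>i<l. indicator {0<..} (r i)) = (1::ennreal)" using rp by (intro prod.neutral) auto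
        have q: "indicator shell u * indicator ?O (bscale b r u) = indicator shell u * (indicator U (dir u) :: ennreal)"
          using shell_subset_nondeg by (auto simp: indicator_def bscale_in_nondeg_iff[OF rp] dir_bscale[OF rp])
        have "k (bscale b r u) r * (indicator ?O (bscale b r u) * F (y + bscale b r u))
          = (\<Prod>k\<in>UNIV. ennreal (1 / r (b k))) * ((indicator shell u * indicator ?O (bscale b r u)) * F (y + bscale b r u))"
          unfolding k_def ib o by (simp only: mult_1 mult.assoc)
        then show "k (bscale b r u) r * (indicator ?O (bscale b r u) * F (y + bscale b r u))
          = (\<Prod>k\<in>UNIV. ennreal (1 / r (b k))) * (indicator shell u * indicator U (dir u) * F (y + bscale b r u))"
          unfolding q .
      qed
      also have "(\<integral>\<^sup>+ u. (\<Prod>k\<in>UNIV. ennreal (1 / r (b k))) * (indicator shell u * indicator U (dir u) * F (y + bscale b r u)) \<partial>lborel)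
        = (\<Prod>k\<in>UNIV. ennreal (1 / r (b k))) * (\<integral>\<^sup>+ u. indicator shell u * indicator U (dir u) * F (y + bscale b r u) \<partial>lborel)"
        by (rule nn_integral_cmult) measurable
      finally show ?thesis by (simp only: mult.assoc[symmetric] e1) simp
    next
      case False
      then obtain i where "i < l" "\<not> r i > 0" by blast
      then have "(\<Prod>i<l. indicator {0<..} (r i)) = (0::ennreal)" by (intro prod_zero bexI[of _ i]) auto
      then have "k w r = 0" for w unfolding k_def by (simp only: mult_zero_left)
      then show ?thesis by simp
    qed
  qed
  also have "\<dots> = (\<integral>\<^sup>+ u. \<integral>\<^sup>+ r. indicator shell u * indicator U (dir u) * F (y + bscale b r u) \<partial>plane_measure l \<partial>lborel)"
    by (rule p.Fubini') measurable
  also have "\<dots> = (\<integral>\<^sup>+ u. indicator shell u * indicator U (dir u) * Xray F u y \<partial>lborel)"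
    unfolding Xray_def by (intro nn_integral_cong nn_integral_cmult) measurable
  finally show ?thesis by (simp add: mult_left_mono)
qed

end

context blocks_frostman
begin

text \<open>Both smoothings are moved onto the indicator of \<open>Q\<close>. At each point of an
  open set the twice averaged indicator is eventually 1, so Fatou applies.\<close>

lemma emeasure_open_le_liminf:
  assumes "open Q"
  shows "emeasure \<mu> Q \<le> liminf (\<lambda>j. \<integral>\<^sup>+ z. conv j (smooth \<mu> j) z * indicator Q z \<partial>lborel)"
proof -
  have [measurable]: "Q \<in> sets borel" using assms by simp
  have [measurable]: "smooth \<mu> j \<in> borel_measurable borel" for j by (rule measurable_smooth) measurable
  have c[measurable]: "conv j g \<in> borel_measurable borel" if [measurable]: "g \<in> borel_measurable borel" for j and g :: "real^'n \<Rightarrow> ennreal"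
    by (rule measurable_conv) measurable
  let ?h = "\<lambda>j. conv j (conv j (indicator Q))"
  have e: "(\<integral>\<^sup>+ z. conv j (smooth \<mu> j) z * indicator Q z \<partial>lborel) = (\<integral>\<^sup>+ x. ?h j x \<partial>\<mu>)" for j
    by (subst nn_integral_conv_mult) (auto simp: nn_integral_smooth_mult)
  have "emeasure \<mu> Q = (\<integral>\<^sup>+ x. indicator Q x \<partial>\<mu>)" by simp
  also have "\<dots> \<le> (\<integral>\<^sup>+ x. liminf (\<lambda>j. ?h j x) \<partial>\<mu>)"
  proof (rule nn_integral_mono)
    fix x
    show "indicator Q x \<le> liminf (\<lambda>j. ?h j x)"
    proof (cases "x \<in> Q")
      case True
      then obtain e where e: "e > 0" "ball x e \<subseteq> Q" using assms open_contains_ball by blast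
      have "(\<lambda>j. 2 * real CARD('n) * (1/2) ^ j) \<longlonglongrightarrow> 2 * real CARD('n) * 0"
        by (intro tendsto_intros LIMSEQ_power_zero) auto
      then have "\<forall>\<^sub>F j in sequentially. 2 * real CARD('n) * (1/2) ^ j < e"
        by (rule order_tendstoD(2)) (use e(1) in simp)
      then have "\<forall>\<^sub>F j in sequentially. 1 \<le> ?h j x"
      proof eventually_elim
        case (elim j)
        have small: "norm v \<le> real CARD('n) * (1/2) ^ j" if "\<And>k. \<bar>v $ k\<bar> \<le> (1/2) ^ j" for v :: "real^'n"
        proof -
          have "norm v \<le> (\<Sum>k\<in>UNIV. \<bar>v $ k\<bar>)" by (rule norm_le_l1_cart)
          also have "\<dots> \<le> (\<Sum>k\<in>(UNIV::'n set). (1/2) ^ j)" by (intro sum_mono that)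
          finally show ?thesis by simp
        qed
        have "?h j x = 1"
        proof (rule conv_indicator_eq_1, rule conv_indicator_eq_1)
          fix v v' :: "real^'n"
          assume "\<And>k. \<bar>v $ k\<bar> \<le> (1/2) ^ j" "\<And>k. \<bar>v' $ k\<bar> \<le> (1/2) ^ j"
          then have "norm v + norm v' \<le> 2 * real CARD('n) * (1/2) ^ j"
            using small[of v] small[of v'] by simp
          then have "norm (v + v') < e" using norm_triangle_ineq[of v v'] elim by simp
          moreover have "dist x (x + v + v') = norm (v + v')" by (metis add.assoc dist_add_cancel add_0_right dist_0_norm)
          ultimately have "x + v + v' \<in> ball x e" by simp
          then show "indicator Q (x + v + v') = (1::ennreal)" using e(2) by auto
        qed
        then show ?case by simp
      qed
      then have "1 \<le> liminf (\<lambda>j. ?h j x)" by (rule Liminf_bounded)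
      then show ?thesis using True by simp
    qed simp
  qed
  also have "\<dots> \<le> liminf (\<lambda>j. \<integral>\<^sup>+ x. ?h j x \<partial>\<mu>)"
    by (rule nn_integral_liminf) measurable
  finally show ?thesis unfolding e .
qed

text \<open>The cone over an open set is open because \<open>dir\<close> is continuous on
  \<open>nondeg\<close>. Passing to \<open>Xsup\<close> makes the bound for the regularized masses
  independent of j, so that it survives the lower limit.\<close>

lemma emeasure_cone_open_le:
  assumes U: "open U" and y: "\<And>k. \<bar>y $ k\<bar> \<le> 1"
  shows "emeasure \<mu> {x. x - y \<in> nondeg \<and> dir (x - y) \<in> U}
    \<le> ennreal dir_const * (\<integral>\<^sup>+ u. indicator shell u * indicator U (dir u) * Xsup y u \<partial>lborel)"
proof -
  let ?O = "nondeg \<inter> dir -` U"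
  have [measurable]: "U \<in> sets borel" using U by simp
  have [measurable]: "smooth \<mu> j \<in> borel_measurable borel" for j by (rule measurable_smooth) measurable
  have c[measurable]: "conv j (smooth \<mu> j) \<in> borel_measurable borel" for j
    by (rule measurable_conv) measurable
  have oO: "open ?O"
    using continuous_open_preimage[OF continuous_on_dir open_nondeg U] by (simp add: Int_commute)
  then have [measurable]: "?O \<in> sets borel" by simp
  let ?Q = "{x. x - y \<in> nondeg \<and> dir (x - y) \<in> U}"
  have Q: "?Q = (\<lambda>x. x - y) -` ?O" by auto
  have "open ?Q"
    unfolding Q by (intro open_vimage oO continuous_intros)
  then have "emeasure \<mu> ?Q \<le> liminf (\<lambda>j. \<integral>\<^sup>+ z. conv j (smooth \<mu> j) z * indicator ?Q z \<partial>lborel)"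
    by (rule emeasure_open_le_liminf)
  also have "\<dots> \<le> liminf (\<lambda>j::nat. ennreal dir_const * (\<integral>\<^sup>+ u. indicator shell u * indicator U (dir u) * Xsup y u \<partial>lborel))"
  proof (intro Liminf_mono always_eventually allI)
    fix j
    have [measurable]: "?Q \<in> sets borel" using \<open>open ?Q\<close> by simp
    have "(\<integral>\<^sup>+ z. conv j (smooth \<mu> j) z * indicator ?Q z \<partial>lborel)
       = (\<integral>\<^sup>+ w. conv j (smooth \<mu> j) (w + y) * indicator ?Q (w + y) \<partial>lborel)"
      by (rule nn_integral_lborel_shift[symmetric, where f="\<lambda>z. conv j (smooth \<mu> j) z * indicator ?Q z"]) measurable
    also have "\<dots> = (\<integral>\<^sup>+ w. indicator ?O w * conv j (smooth \<mu> j) (y + w) \<partial>lborel)"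
      by (intro nn_integral_cong) (simp add: indicator_def add.commute)
    also have "\<dots> \<le> ennreal dir_const * (\<integral>\<^sup>+ u. indicator shell u * indicator U (dir u) * Xreg j y u \<partial>lborel)"
      unfolding Xreg_def by (rule nn_integral_cone_le) (auto simp: supp3_conv_smooth y)
    also have "\<dots> \<le> ennreal dir_const * (\<integral>\<^sup>+ u. indicator shell u * indicator U (dir u) * Xsup y u \<partial>lborel)"
      unfolding Xsup_def by (intro mult_left_mono nn_integral_mono SUP_upper) auto
    finally show "(\<integral>\<^sup>+ z. conv j (smooth \<mu> j) z * indicator ?Q z \<partial>lborel)
      \<le> ennreal dir_const * (\<integral>\<^sup>+ u. indicator shell u * indicator U (dir u) * Xsup y u \<partial>lborel)" .
  qed
  also have "\<dots> = ennreal dir_const * (\<integral>\<^sup>+ u. indicator shell u * indicator U (dir u) * Xsup y u \<partial>lborel)"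
    by (rule Liminf_const) simp
  finally show ?thesis .
qed

text \<open>The right-hand side is a Borel measure as a function of B, finite by hypothesis and
  hence outer regular. The inequality for open sets therefore extends by taking an infimum.\<close>

lemma emeasure_cone_le:
  assumes B: "B \<in> sets borel" and y: "\<And>k. \<bar>y $ k\<bar> \<le> 1"
    and fin: "(\<integral>\<^sup>+ u. indicator shell u * Xsup y u \<partial>lborel) < \<infinity>"
  shows "emeasure \<mu> {x. x - y \<in> nondeg \<and> dir (x - y) \<in> B}
    \<le> ennreal dir_const * (\<integral>\<^sup>+ u. indicator shell u * indicator B (dir u) * Xsup y u \<partial>lborel)"
proof -
  define N where "N = density (distr (density lborel (\<lambda>u. indicator shell u * Xsup y u)) borel dir) (\<lambda>_. ennreal dir_const)"
  have N: "emeasure N A = ennreal dir_const * (\<integral>\<^sup>+ u. indicator shell u * indicator A (dir u) * Xsup y u \<partial>lborel)"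
    if [measurable]: "A \<in> sets borel" for A
    unfolding N_def
    by (simp add: emeasure_density nn_integral_cmult nn_integral_distr nn_integral_density mult_ac)
  have sN: "sets N = sets borel" by (simp add: N_def)
  have "emeasure N (space N) \<noteq> \<infinity>"
  proof -
    have "space N = UNIV" using sets_eq_imp_space_eq[OF sN] by simp
    then show ?thesis using N[of UNIV] fin by (simp add: ennreal_mult_eq_top_iff less_top[symmetric])
  qed
  from outer_regular[OF sN this B]
  have "emeasure N B = (INF U\<in>{U. B \<subseteq> U \<and> open U}. emeasure N U)" .
  moreover have "emeasure \<mu> {x. x - y \<in> nondeg \<and> dir (x - y) \<in> B} \<le> emeasure N U" if U: "B \<subseteq> U" "open U" for U
  proof -
    have [measurable]: "U \<in> sets borel" using U by simp
    have "{x. x - y \<in> nondeg \<and> dir (x - y) \<in> U} \<in> sets \<mu>" by measurable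
    then have "emeasure \<mu> {x. x - y \<in> nondeg \<and> dir (x - y) \<in> B} \<le> emeasure \<mu> {x. x - y \<in> nondeg \<and> dir (x - y) \<in> U}"
      using U by (intro emeasure_mono) auto
    also have "\<dots> \<le> emeasure N U"
      using emeasure_cone_open_le[OF U(2) y] by (subst N) auto
    finally show ?thesis .
  qed
  ultimately have "emeasure \<mu> {x. x - y \<in> nondeg \<and> dir (x - y) \<in> B} \<le> emeasure N B"
    by (auto intro: INF_greatest)
  then show ?thesis using N[OF B] by simp
qed

end

section \<open>Hausdorff measure is a Borel measure\<close>

definition hausdorff_weight :: "real \<Rightarrow> 'a::metric_space set \<Rightarrow> ennreal" where
  "hausdorff_weight s D = ennreal (unit_ball_vol s / 2 powr s * diameter D powr s)"

lemma hausdorff_weight_empty [simp]: "hausdorff_weight s {} = 0"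
  by (simp add: hausdorff_weight_def)

definition hausdorff_cover :: "real \<Rightarrow> 'a::metric_space set \<Rightarrow> (nat \<Rightarrow> 'a set) \<Rightarrow> bool" where
  "hausdorff_cover \<delta> A E \<longleftrightarrow> A \<subseteq> (\<Union>j. E j) \<and> (\<forall>j. bounded (E j) \<and> diameter (E j) \<le> \<delta>)"

lemma hausdorff_content_eq:
  "hausdorff_content s \<delta> A = (INF E \<in> {E. hausdorff_cover \<delta> A E}. \<Sum>j. hausdorff_weight s (E j))"
  by (simp add: hausdorff_content_def hausdorff_cover_def hausdorff_weight_def)

lemma hausdorff_content_le: "hausdorff_cover \<delta> A E \<Longrightarrow> hausdorff_content s \<delta> A \<le> (\<Sum>j. hausdorff_weight s (E j))"
  unfolding hausdorff_content_eq by (rule INF_lower) simp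

lemma hausdorff_content_mono: "A \<subseteq> B \<Longrightarrow> hausdorff_content s \<delta> A \<le> hausdorff_content s \<delta> B"
  unfolding hausdorff_content_eq
  by (rule INF_superset_mono) (simp_all add: hausdorff_cover_def Collect_mono subset_trans[of A B])

lemma hausdorff_content_antimono: "\<delta> \<le> \<delta>' \<Longrightarrow> hausdorff_content s \<delta>' A \<le> hausdorff_content s \<delta> A"
  unfolding hausdorff_content_eq
  by (rule INF_superset_mono) (simp_all add: hausdorff_cover_def Collect_mono_iff, meson order_trans)

lemma hausdorff_content_empty: "0 \<le> \<delta> \<Longrightarrow> hausdorff_content s \<delta> {} = 0"
  using hausdorff_content_le[of \<delta> "{}" "\<lambda>_. {}" s] by (simp add: hausdorff_cover_def)

lemma hausdorff_content_subadditive: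
  "hausdorff_content s \<delta> (\<Union>i. A i) \<le> (\<Sum>i::nat. hausdorff_content s \<delta> (A i))"
proof (rule ennreal_le_epsilon)
  fix e :: real
  assume e: "0 < e" and fin: "(\<Sum>i. hausdorff_content s \<delta> (A i)) < top"
  have "\<exists>E. hausdorff_cover \<delta> (A n) E \<and> (\<Sum>j. hausdorff_weight s (E j)) \<le> hausdorff_content s \<delta> (A n) + e * (1/2) ^ Suc n" for n
  proof -
    have "hausdorff_content s \<delta> (A n) < hausdorff_content s \<delta> (A n) + e * (1/2) ^ Suc n"
      using fin e by (auto simp add: less_top dest!: ennreal_suminf_lessD)
    then have "\<exists>E\<in>{E. hausdorff_cover \<delta> (A n) E}. (\<Sum>j. hausdorff_weight s (E j)) < hausdorff_content s \<delta> (A n) + e * (1/2) ^ Suc n"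
      by (subst (asm) (1) hausdorff_content_eq) (simp only: INF_less_iff)
    then show ?thesis by (auto intro: less_imp_le)
  qed
  then obtain E where E: "\<And>n. hausdorff_cover \<delta> (A n) (E n)"
    and le: "\<And>n. (\<Sum>j. hausdorff_weight s (E n j)) \<le> hausdorff_content s \<delta> (A n) + e * (1/2) ^ Suc n"
    by metis
  define C where "C = case_prod E o prod_decode"
  have "hausdorff_cover \<delta> (\<Union>i. A i) C"
    unfolding hausdorff_cover_def
  proof
    show "(\<Union>i. A i) \<subseteq> (\<Union>j. C j)"
    proof
      fix x assume "x \<in> (\<Union>i. A i)"
      then obtain i where "x \<in> A i" by blast
      then obtain j where "x \<in> E i j" using E[of i] unfolding hausdorff_cover_def by blast
      then have "x \<in> C (prod_encode (i, j))" by (simp add: C_def)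
      then show "x \<in> (\<Union>j. C j)" by blast
    qed
    show "\<forall>j. bounded (C j) \<and> diameter (C j) \<le> \<delta>"
      using E by (auto simp: hausdorff_cover_def C_def split: prod.split)
  qed
  then have "hausdorff_content s \<delta> (\<Union>i. A i) \<le> (\<Sum>j. hausdorff_weight s (C j))"
    by (rule hausdorff_content_le)
  also have "\<dots> = (\<Sum>n. \<Sum>j. hausdorff_weight s (E n j))"
  proof -
    have "(\<Sum>i. (\<lambda>(n, j). hausdorff_weight s (E n j)) (prod_decode i)) = (\<Sum>n. \<Sum>j. hausdorff_weight s (E n j))"
      by (rule suminf_ennreal_2dimen) simp
    moreover have "(\<lambda>(n, j). hausdorff_weight s (E n j)) (prod_decode i) = hausdorff_weight s (C i)" for i
      by (simp add: C_def case_prod_beta)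
    ultimately show ?thesis by simp
  qed
  also have "\<dots> \<le> (\<Sum>n. hausdorff_content s \<delta> (A n) + e * (1/2) ^ Suc n)"
    by (intro suminf_le summableI le)
  also have "\<dots> = (\<Sum>n. hausdorff_content s \<delta> (A n)) + (\<Sum>n. ennreal e * ennreal ((1/2) ^ Suc n))"
    using e by (subst suminf_add[symmetric]) (auto simp del: ennreal_suminf_cmult simp add: ennreal_mult[symmetric])
  also have "\<dots> = (\<Sum>n. hausdorff_content s \<delta> (A n)) + e"
    unfolding ennreal_suminf_cmult by (subst suminf_ennreal_eq[OF zero_le_power power_half_series]) auto
  finally show "hausdorff_content s \<delta> (\<Union>i. A i) \<le> (\<Sum>n. hausdorff_content s \<delta> (A n)) + e" .
qed

lemma hausdorff_outer_ge: "0 < \<delta> \<Longrightarrow> hausdorff_content s \<delta> A \<le> hausdorff_outer s A"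
  unfolding hausdorff_outer_def by (rule SUP_upper) simp

lemma hausdorff_outer_empty [simp]: "hausdorff_outer s {} = 0"
  unfolding hausdorff_outer_def by (simp add: hausdorff_content_empty)

lemma hausdorff_outer_mono: "A \<subseteq> B \<Longrightarrow> hausdorff_outer s A \<le> hausdorff_outer s B"
  unfolding hausdorff_outer_def by (intro SUP_mono) (auto intro: hausdorff_content_mono)

lemma hausdorff_outer_subadditive:
  "hausdorff_outer s (\<Union>i. A i) \<le> (\<Sum>i::nat. hausdorff_outer s (A i))"
  unfolding hausdorff_outer_def[of s "\<Union>i. A i"]
proof (rule SUP_least)
  fix \<delta> :: real assume "\<delta> \<in> {0<..}"
  then have "(\<Sum>i. hausdorff_content s \<delta> (A i)) \<le> (\<Sum>i. hausdorff_outer s (A i))"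
    by (intro suminf_le summableI hausdorff_outer_ge) auto
  then show "hausdorff_content s \<delta> (\<Union>i. A i) \<le> (\<Sum>i. hausdorff_outer s (A i))"
    using hausdorff_content_subadditive order_trans by blast
qed

lemma hausdorff_outer_Un: "hausdorff_outer s (A \<union> B) \<le> hausdorff_outer s A + hausdorff_outer s B"
proof -
  let ?f = "\<lambda>i::nat. if i = 0 then A else if i = 1 then B else {}"
  have "A \<union> B = (\<Union>i. ?f i)" by (auto split: if_splits)
  then have "hausdorff_outer s (A \<union> B) \<le> (\<Sum>i. hausdorff_outer s (?f i))"
    using hausdorff_outer_subadditive[of s ?f] by simp
  also have "\<dots> = (\<Sum>i<2. hausdorff_outer s (?f i))"
    by (rule suminf_finite) auto
  finally show ?thesis by (simp add: numeral_2_eq_2)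
qed

text \<open>A set of diameter at most \<delta> < \<epsilon> cannot meet both A and B, so every cover
  of the union splits into a cover of A and a cover of B. The gaps are filled with empty sets of
  weight 0.\<close>

lemma hausdorff_content_separated:
  assumes sep: "\<And>x y. x \<in> A \<Longrightarrow> y \<in> B \<Longrightarrow> \<epsilon> \<le> dist x y" and \<delta>: "\<delta> < \<epsilon>"
  shows "hausdorff_content s \<delta> A + hausdorff_content s \<delta> B \<le> hausdorff_content s \<delta> (A \<union> B)"
  unfolding hausdorff_content_eq[of s \<delta> "A \<union> B"]
proof (rule INF_greatest)
  fix E assume "E \<in> {E. hausdorff_cover \<delta> (A \<union> B) E}"
  then have E: "A \<union> B \<subseteq> (\<Union>j. E j)" "\<And>j. bounded (E j)" "\<And>j. diameter (E j) \<le> \<delta>"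
    by (auto simp: hausdorff_cover_def)
  define EA where "EA j = (if E j \<inter> A = {} then {} else E j)" for j
  define EB where "EB j = (if E j \<inter> A = {} then E j else {})" for j
  have dis: "E j \<inter> A = {} \<or> E j \<inter> B = {}" for j
  proof (rule ccontr)
    assume "\<not> ?thesis"
    then obtain x y where xy: "x \<in> E j" "x \<in> A" "y \<in> E j" "y \<in> B" by blast
    then have "dist x y \<le> \<delta>" using diameter_bounded_bound[OF E(2), of x j y] E(3)[of j] by simp
    then show False using sep[OF xy(2,4)] \<delta> by simp
  qed
  have "0 \<le> \<delta>" using diameter_ge_0[OF E(2)[of 0]] E(3)[of 0] by simp
  then have "hausdorff_cover \<delta> A EA" "hausdorff_cover \<delta> B EB"
    using E dis unfolding hausdorff_cover_def EA_def EB_def by (auto split: if_splits) blast+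
  then have "hausdorff_content s \<delta> A + hausdorff_content s \<delta> B
      \<le> (\<Sum>j. hausdorff_weight s (EA j)) + (\<Sum>j. hausdorff_weight s (EB j))"
    by (intro add_mono hausdorff_content_le)
  also have "\<dots> = (\<Sum>j. hausdorff_weight s (EA j) + hausdorff_weight s (EB j))"
    by (rule suminf_add) auto
  also have "\<dots> = (\<Sum>j. hausdorff_weight s (E j))"
    by (intro suminf_cong) (auto simp: EA_def EB_def)
  finally show "hausdorff_content s \<delta> A + hausdorff_content s \<delta> B \<le> (\<Sum>j. hausdorff_weight s (E j))" .
qed

lemma hausdorff_outer_separated:
  assumes sep: "\<And>x y. x \<in> A \<Longrightarrow> y \<in> B \<Longrightarrow> \<epsilon> \<le> dist x y" and \<epsilon>: "0 < \<epsilon>"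
  shows "hausdorff_outer s A + hausdorff_outer s B \<le> hausdorff_outer s (A \<union> B)"
proof -
  \<comment> \<open>The two scales are independent because the suprema over them are taken one after
    the other; e is a common smaller scale below the separation.\<close>
  have *: "hausdorff_content s \<delta> A + hausdorff_content s \<delta>' B \<le> hausdorff_outer s (A \<union> B)" if "0 < \<delta>" "0 < \<delta>'" for \<delta> \<delta>'
  proof -
    define e where "e = min (min \<delta> \<delta>') (\<epsilon> / 2)"
    have e: "0 < e" "e \<le> \<delta>" "e \<le> \<delta>'" "e < \<epsilon>" using that \<epsilon> by (auto simp: e_def)
    have "hausdorff_content s \<delta> A + hausdorff_content s \<delta>' B \<le> hausdorff_content s e A + hausdorff_content s e B"
      by (intro add_mono hausdorff_content_antimono e)
    also have "\<dots> \<le> hausdorff_content s e (A \<union> B)" by (rule hausdorff_content_separated[OF sep e(4)])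
    also have "\<dots> \<le> hausdorff_outer s (A \<union> B)" by (rule hausdorff_outer_ge[OF e(1)])
    finally show ?thesis .
  qed
  have ne: "{0<..} \<noteq> ({} :: real set)" by (simp add: gt_ex)
  have "hausdorff_content s \<delta> A + hausdorff_outer s B \<le> hausdorff_outer s (A \<union> B)" if "0 < \<delta>" for \<delta>
  proof -
    have "(SUP i\<in>{0<..}. hausdorff_content s \<delta> A + hausdorff_content s i B) \<le> hausdorff_outer s (A \<union> B)"
      by (rule SUP_least) (use * that in simp)
    then show ?thesis
      unfolding hausdorff_outer_def[of s B] ennreal_SUP_add_right[OF ne] .
  qed
  then show ?thesis
    unfolding hausdorff_outer_def[of s A]
    by (subst ennreal_SUP_add_left[OF ne, symmetric]) (rule SUP_least, simp)
qed

text \<open>Caratheodory's argument: the part of \<open>T\<close> outside the closed set is exhausted by sets at positive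
  distance from it; slices two steps apart are separated, so the slices have summable measure.\<close>

lemma hausdorff_outer_closed_split:
  fixes F T :: "'a::metric_space set"
  assumes F: "closed F"
  shows "hausdorff_outer s (T \<inter> F) + hausdorff_outer s (T - F) \<le> hausdorff_outer s T"
proof (cases "F = {} \<or> hausdorff_outer s T = top")
  case True
  then show ?thesis by auto
next
  case False
  then have ne: "F \<noteq> {}" and fin: "hausdorff_outer s T < top" by (auto simp: less_top)
  let ?H = "hausdorff_outer s"
  define q where "q n = 1 / real (Suc n)" for n
  have q_less: "q n < q m" if "m < n" for m n using that by (simp add: q_def frac_less2)
  define Tn where "Tn n = {x \<in> T. q n < infdist x F}" for n
  define D where "D n = {x \<in> T. q (Suc n) < infdist x F \<and> infdist x F \<le> q n}" for n
  have DT: "D n \<subseteq> T" for n by (auto simp: D_def)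
  \<comment> \<open>Only slices whose indices have the same parity are at positive distance from
    each other; c selects the parity.\<close>
  have two: "(\<Sum>i<m. ?H (D (2 * i + c))) \<le> ?H (\<Union>i<m. D (2 * i + c))" for m c
  proof (induction m)
    case (Suc m)
    have "(\<Sum>i<Suc m. ?H (D (2 * i + c))) \<le> ?H (\<Union>i<m. D (2 * i + c)) + ?H (D (2 * m + c))"
      using Suc by (simp add: add_right_mono)
    also have "\<dots> \<le> ?H ((\<Union>i<m. D (2 * i + c)) \<union> D (2 * m + c))"
    proof (cases m)
      case 0
      then show ?thesis by simp
    next
      case (Suc m')
      show ?thesis
      proof (rule hausdorff_outer_separated)
        show "0 < q (2 * m' + 1 + c) - q (2 * m + c)" using q_less[of "2 * m' + 1 + c" "2 * m + c"] Suc by simp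
        fix x y assume "x \<in> (\<Union>i<m. D (2 * i + c))" and y: "y \<in> D (2 * m + c)"
        then obtain i where i: "i < m" "x \<in> D (2 * i + c)" by auto
        have "q (2 * m' + 1 + c) \<le> q (Suc (2 * i + c))" using i(1) Suc by (simp add: q_def frac_le)
        then have "q (2 * m' + 1 + c) \<le> infdist x F" using i by (auto simp: D_def)
        moreover have "infdist y F \<le> q (2 * m + c)" using y by (simp add: D_def)
        moreover have "infdist x F \<le> infdist y F + dist x y" by (rule infdist_triangle)
        ultimately show "q (2 * m' + 1 + c) - q (2 * m + c) \<le> dist x y" by simp
      qed
    qed
    also have "(\<Union>i<m. D (2 * i + c)) \<union> D (2 * m + c) = (\<Union>i<Suc m. D (2 * i + c))" by (auto simp: less_Suc_eq)
    finally show ?case .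
  qed simp
  have part: "(\<Sum>i<n. ?H (D i)) \<le> ?H T + ?H T" for n
  proof -
    have "(\<Sum>i<n. ?H (D i)) \<le> (\<Sum>i<2 * n. ?H (D i))" by (rule sum_mono2) auto
    also have "\<dots> = (\<Sum>i<n. ?H (D (2 * i + 0))) + (\<Sum>i<n. ?H (D (2 * i + 1)))"
      by (induction n) (simp_all add: add_ac)
    also have "\<dots> \<le> ?H (\<Union>i<n. D (2 * i + 0)) + ?H (\<Union>i<n. D (2 * i + 1))" by (intro add_mono two)
    also have "\<dots> \<le> ?H T + ?H T" using DT by (intro add_mono hausdorff_outer_mono) auto
    finally show ?thesis .
  qed
  have Dfin: "?H (D n) < top" for n
    using hausdorff_outer_mono[OF DT, of s n] fin by (rule le_less_trans)
  define f where "f n = enn2real (?H (D n))" for n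
  have f: "?H (D n) = ennreal (f n)" "0 \<le> f n" for n
    using Dfin[of n] by (auto simp: f_def)
  have summ: "summable f"
  proof (rule bounded_imp_summable)
    fix n
    have "ennreal (\<Sum>i\<le>n. f i) = (\<Sum>i<Suc n. ?H (D i))"
      by (simp add: f sum_ennreal lessThan_Suc_atMost)
    also have "\<dots> \<le> ?H T + ?H T" by (rule part)
    also have "\<dots> = ennreal (enn2real (?H T + ?H T))" using fin by simp
    finally show "(\<Sum>i\<le>n. f i) \<le> enn2real (?H T + ?H T)" by (simp add: ennreal_le_iff)
  qed (simp add: f)
  show ?thesis
  proof (rule ennreal_le_epsilon)
    fix e :: real assume e: "0 < e"
    obtain N where N: "\<And>n. n \<ge> N \<Longrightarrow> norm (\<Sum>i. f (i + n)) < e"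
      using suminf_exist_split[OF e summ] by blast
    have "T - F \<subseteq> Tn N \<union> (\<Union>i. D (i + N))"
    proof
      fix x assume x: "x \<in> T - F"
      then have pos: "infdist x F > 0" using in_closed_iff_infdist_zero[OF F ne] infdist_nonneg[of x F] by (auto simp: less_le)
      show "x \<in> Tn N \<union> (\<Union>i. D (i + N))"
      proof (cases "q N < infdist x F")
        case True
        then show ?thesis using x by (simp add: Tn_def)
      next
        case nq: False
        obtain n where "q n < infdist x F" using pos unfolding q_def by (metis nat_approx_posE)
        define m where "m = (LEAST n. q n < infdist x F)"
        have m: "q m < infdist x F" unfolding m_def by (rule LeastI) fact
        have "m > N"
        proof (rule ccontr)
          assume "\<not> m > N"
          then have "q N \<le> q m" using q_less[of m N] by (cases "m = N") auto
          then show False using m nq by simp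
        qed
        then obtain m' where m': "m = Suc m'" "m' \<ge> N" by (cases m) auto
        then have "\<not> q m' < infdist x F" unfolding m_def using not_less_Least[of m' "\<lambda>n. q n < infdist x F"] by simp
        then have "x \<in> D m'" using m x m' by (simp add: D_def)
        then have "x \<in> D ((m' - N) + N)" using m' by simp
        then show ?thesis by blast
      qed
    qed
    then have "?H (T - F) \<le> ?H (Tn N \<union> (\<Union>i. D (i + N)))" by (rule hausdorff_outer_mono)
    also have "\<dots> \<le> ?H (Tn N) + ?H (\<Union>i. D (i + N))" by (rule hausdorff_outer_Un)
    also have "?H (\<Union>i. D (i + N)) \<le> (\<Sum>i. ?H (D (i + N)))" by (rule hausdorff_outer_subadditive)
    also have "\<dots> = ennreal (\<Sum>i. f (i + N))"
      unfolding f using summ f(2) by (intro suminf_ennreal2) (auto simp: summable_iff_shift)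
    also have "\<dots> \<le> ennreal e" using N[of N] by (intro ennreal_leI) auto
    finally have 1: "?H (T - F) \<le> ?H (Tn N) + ennreal e" by (simp add: add_left_mono)
    have 2: "?H (T \<inter> F) + ?H (Tn N) \<le> ?H ((T \<inter> F) \<union> Tn N)"
    proof (rule hausdorff_outer_separated)
      show "0 < q N" by (simp add: q_def)
      fix x y assume "x \<in> T \<inter> F" "y \<in> Tn N"
      then have "q N < infdist y F" "infdist y F \<le> dist y x" by (auto simp: Tn_def intro: infdist_le)
      then show "q N \<le> dist x y" by (simp add: dist_commute)
    qed
    have "?H (T \<inter> F) + ?H (T - F) \<le> (?H (T \<inter> F) + ?H (Tn N)) + ennreal e"
      using add_left_mono[OF 1] by (simp only: add.assoc)
    also have "\<dots> \<le> ?H ((T \<inter> F) \<union> Tn N) + ennreal e" by (rule add_right_mono[OF 2])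
    also have "\<dots> \<le> ?H T + ennreal e"
      by (intro add_right_mono hausdorff_outer_mono) (auto simp: Tn_def)
    finally show "?H (T \<inter> F) + ?H (T - F) \<le> ?H T + ennreal e" .
  qed
qed

text \<open>Closed sets split every test set additively, so they lie in the Caratheodory
  sigma-algebra of the outer measure, which then contains all Borel sets.\<close>

lemma measure_space_hausdorff: "measure_space UNIV (sets borel) (hausdorff_outer s :: 'a::metric_space set \<Rightarrow> ennreal)"
proof -
  let ?L = "lambda_system UNIV (Pow UNIV) (hausdorff_outer s :: 'a set \<Rightarrow> ennreal)"
  interpret P: sigma_algebra UNIV "Pow UNIV :: 'a set set" by (rule sigma_algebra_Pow)
  have "outer_measure_space (Pow UNIV) (hausdorff_outer s :: 'a set \<Rightarrow> ennreal)"
    by (auto simp: outer_measure_space_def positive_def increasing_def countably_subadditive_def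
        intro: hausdorff_outer_mono hausdorff_outer_subadditive)
  then have ms: "measure_space UNIV ?L (hausdorff_outer s)"
    by (rule P.caratheodory_lemma)
  then interpret L: sigma_algebra UNIV ?L by (simp add: measure_space_def)
  have "closed F \<Longrightarrow> F \<in> ?L" for F
  proof -
    assume F: "closed F"
    have "hausdorff_outer s (F \<inter> T) + hausdorff_outer s ((UNIV - F) \<inter> T) = hausdorff_outer s T" for T
    proof (rule antisym)
      have "(UNIV - F) \<inter> T = T - F" by auto
      then show "hausdorff_outer s (F \<inter> T) + hausdorff_outer s ((UNIV - F) \<inter> T) \<le> hausdorff_outer s T"
        using hausdorff_outer_closed_split[OF F, of s T] by (simp add: Int_commute)
      have "T = (F \<inter> T) \<union> ((UNIV - F) \<inter> T)" by auto
      then show "hausdorff_outer s T \<le> hausdorff_outer s (F \<inter> T) + hausdorff_outer s ((UNIV - F) \<inter> T)"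
        using hausdorff_outer_Un by metis
    qed
    then show "F \<in> ?L" by (simp add: lambda_system_def)
  qed
  then have "Collect open \<subseteq> ?L"
    using L.compl_sets by (metis (no_types, lifting) Compl_eq_Diff_UNIV Collect_subset closed_Compl double_complement mem_Collect_eq subsetI)
  then have "sets borel \<subseteq> ?L"
    using L.sigma_sets_subset[of "Collect open"] unfolding borel_def by simp
  then show ?thesis
    by (rule measure_down[OF ms sets.sigma_algebra_axioms[of borel, simplified]])
qed

lemma sets_hausdorff_measure [simp, measurable_cong]: "sets (hausdorff_measure s) = sets borel"
  unfolding hausdorff_measure_def using sets.sigma_sets_eq[of borel] by (simp add: sets_measure_of_conv)

lemma space_hausdorff_measure [simp]: "space (hausdorff_measure s) = UNIV"
  unfolding hausdorff_measure_def by (simp add: space_measure_of_conv)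

lemma emeasure_hausdorff_measure:
  assumes "A \<in> sets borel"
  shows "emeasure (hausdorff_measure s) A = hausdorff_outer s A"
  unfolding hausdorff_measure_def
  by (rule emeasure_measure_of_sigma) (use measure_space_hausdorff[of s] assms in \<open>auto simp: measure_space_def\<close>)

lemma hausdorff_content_finite_cover:
  assumes J: "finite J" and cov: "A \<subseteq> (\<Union>x\<in>J. C x)" and C: "\<And>x. x \<in> J \<Longrightarrow> bounded (C x) \<and> diameter (C x) \<le> \<delta>"
    and \<delta>: "0 \<le> \<delta>" and s: "0 \<le> s"
  shows "hausdorff_content s \<delta> A \<le> of_nat (card J) * ennreal (unit_ball_vol s / 2 powr s * \<delta> powr s)"
proof -
  obtain h where h: "bij_betw h {0..<card J} J" using ex_bij_betw_nat_finite[OF J] by blast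
  define E where "E j = (if j < card J then C (h j) else {})" for j
  have hJ: "h j \<in> J" if "j < card J" for j using h that by (auto simp: bij_betw_def)
  have "hausdorff_cover \<delta> A E"
    unfolding hausdorff_cover_def
  proof
    show "A \<subseteq> (\<Union>j. E j)"
    proof
      fix x assume "x \<in> A"
      then obtain c where c: "c \<in> J" "x \<in> C c" using cov by blast
      then have "c \<in> h ` {0..<card J}" using h by (simp add: bij_betw_def)
      then obtain j where "j < card J" "h j = c" by auto
      then have "x \<in> E j" using c by (simp add: E_def)
      then show "x \<in> (\<Union>j. E j)" by blast
    qed
    show "\<forall>j. bounded (E j) \<and> diameter (E j) \<le> \<delta>" using C hJ \<delta> by (auto simp: E_def)
  qed
  then have "hausdorff_content s \<delta> A \<le> (\<Sum>j. hausdorff_weight s (E j))" by (rule hausdorff_content_le)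
  also have "\<dots> = (\<Sum>j<card J. hausdorff_weight s (E j))" by (rule suminf_finite) (auto simp: E_def)
  also have "\<dots> \<le> (\<Sum>j<card J. ennreal (unit_ball_vol s / 2 powr s * \<delta> powr s))"
  proof (rule sum_mono)
    fix j assume "j \<in> {..<card J}"
    then have "bounded (E j) \<and> diameter (E j) \<le> \<delta>" using C hJ by (auto simp: E_def)
    then have "diameter (E j) powr s \<le> \<delta> powr s" using s by (intro powr_mono2 diameter_ge_0) auto
    then show "hausdorff_weight s (E j) \<le> ennreal (unit_ball_vol s / 2 powr s * \<delta> powr s)"
      unfolding hausdorff_weight_def using s by (intro ennreal_leI mult_left_mono) auto
  qed
  finally show ?thesis by simp
qed

section \<open>Surface measure on the block spheres\<close>

text \<open>From |x| (sgn x - sgn y) = (x - y) + (|y| - |x|) sgn y, whose two terms are each at most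
  |x - y| in norm.\<close>

lemma norm_sgn_diff_le:
  fixes x y :: "'a::real_normed_vector"
  assumes "1 \<le> norm x" "1 \<le> norm y"
  shows "norm (sgn x - sgn y) \<le> 2 * norm (x - y)"
proof -
  have nx: "norm x > 0" and ny: "norm y > 0" using assms by linarith+
  have "norm x *\<^sub>R (sgn x - sgn y) = (x - y) + (norm y - norm x) *\<^sub>R sgn y"
    using nx ny by (simp add: sgn_div_norm algebra_simps)
  then have "norm x * norm (sgn x - sgn y) = norm ((x - y) + (norm y - norm x) *\<^sub>R sgn y)"
    using nx by (metis abs_of_pos norm_scaleR)
  also have "\<dots> \<le> norm (x - y) + \<bar>norm y - norm x\<bar> * norm (sgn y)"
    by (rule order_trans[OF norm_triangle_ineq]) simp
  also have "\<dots> \<le> norm (x - y) + norm (x - y)"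
    using ny norm_triangle_ineq3[of y x] by (simp add: norm_sgn norm_minus_commute)
  finally have *: "norm x * norm (sgn x - sgn y) \<le> 2 * norm (x - y)" by simp
  have "1 * norm (sgn x - sgn y) \<le> norm x * norm (sgn x - sgn y)"
    by (rule mult_right_mono[OF assms(1)]) simp
  then show ?thesis using * by simp
qed

locale sphere_blocks = blocks l b for l :: nat and b :: "'n::finite \<Rightarrow> nat" +
  assumes two_le: "i < l \<Longrightarrow> 2 \<le> block_dim b i"
begin

abbreviation idx :: "nat \<Rightarrow> 'n set" where "idx i \<equiv> {k. b k = i}"

definition emb :: "nat \<Rightarrow> ('n \<Rightarrow> real) \<Rightarrow> real^'n" where
  "emb i f = (\<chi> k. if b k = i then f k else 0)"

lemma emb_nth [simp]: "emb i f $ k = (if b k = i then f k else 0)"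
  by (simp add: emb_def)

lemma block_sphere_eq: "block_sphere b i = {\<theta>. block_proj b i \<theta> = \<theta> \<and> norm \<theta> = 1}"
proof -
  have "\<theta> \<in> range (block_proj b i) \<longleftrightarrow> block_proj b i \<theta> = \<theta>" for \<theta>
    by (auto simp: vec_eq_iff intro!: image_eqI[of _ _ \<theta>])
  then show ?thesis by (auto simp: block_sphere_def)
qed

lemma closed_block_sphere: "closed (block_sphere b i)"
  unfolding block_sphere_eq
  by (intro closed_Collect_conj closed_Collect_eq continuous_intros)

lemma sets_block_sphere [measurable, simp]: "block_sphere b i \<in> sets borel"
  using closed_block_sphere by (rule borel_closed)

lemma space_sphere_measure [simp]: "space (sphere_measure b i) = block_sphere b i"
  by (simp add: sphere_measure_def space_restrict_space)

lemma sets_sphere_measure: "sets (sphere_measure b i) = sets (restrict_space borel (block_sphere b i))"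
  by (simp add: sphere_measure_def sets_restrict_space)

lemma sets_sphere_measure_iff: "E \<in> sets (sphere_measure b i) \<longleftrightarrow> E \<in> sets borel \<and> E \<subseteq> block_sphere b i"
  unfolding sets_sphere_measure by (subst sets_restrict_space_iff) auto

lemma emeasure_sphere_measure:
  assumes "E \<in> sets (sphere_measure b i)"
  shows "emeasure (sphere_measure b i) E = hausdorff_outer (real (block_dim b i) - 1) E"
proof -
  have "E \<in> sets borel" "E \<subseteq> block_sphere b i" using assms by (auto simp: sets_sphere_measure_iff)
  then show ?thesis
    unfolding sphere_measure_def by (subst emeasure_restrict_space) (auto simp: emeasure_hausdorff_measure)
qed

lemma sgn_in_block_sphere: "v \<noteq> 0 \<Longrightarrow> block_proj b i v = v \<Longrightarrow> sgn v \<in> block_sphere b i"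
proof -
  assume v: "v \<noteq> 0" "block_proj b i v = v"
  have "block_proj b i (a *\<^sub>R v) = a *\<^sub>R block_proj b i v" for a by (simp add: vec_eq_iff)
  then have "block_proj b i (sgn v) = sgn v" using v(2) by (simp add: sgn_div_norm)
  then show "sgn v \<in> block_sphere b i" using v by (simp add: block_sphere_eq norm_sgn)
qed

text \<open>In the triple, \<open>k0\<close> is the coordinate equal to 1 or -1 on the face of the
  cube, \<sigma> is its sign, and g is the lower corner, in units of 1/N, of a grid cube on that
  face.\<close>

definition cell :: "nat \<Rightarrow> nat \<Rightarrow> 'n \<times> bool \<times> ('n \<Rightarrow> int) \<Rightarrow> (real^'n) set" where
  "cell i N = (\<lambda>(k0, \<sigma>, g). sgn ` {v. block_proj b i v = v \<and> v $ k0 = (if \<sigma> then 1 else - 1) \<and>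
     (\<forall>k\<in>idx i - {k0}. of_int (g k) \<le> real N * v $ k \<and> real N * v $ k \<le> of_int (g k) + 1)})"

definition cells :: "nat \<Rightarrow> nat \<Rightarrow> ('n \<times> bool \<times> ('n \<Rightarrow> int)) set" where
  "cells i N = (SIGMA k0:idx i. UNIV \<times> (Pi\<^sub>E (idx i - {k0}) (\<lambda>_. {- int N..int N})))"

lemma card_cells:
  assumes "i < l"
  shows "finite (cells i N)" "card (cells i N) = block_dim b i * (2 * (2 * N + 1) ^ (block_dim b i - 1))"
proof -
  show "finite (cells i N)"
    unfolding cells_def by (intro finite_SigmaI finite_cartesian_product finite_PiE) auto
  have "card (cells i N) = (\<Sum>k0\<in>idx i. card (UNIV \<times> Pi\<^sub>E (idx i - {k0}) (\<lambda>_. {- int N..int N}) :: (bool \<times> ('n \<Rightarrow> int)) set))"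
    unfolding cells_def by (intro card_SigmaI ballI finite_cartesian_product finite_PiE) auto
  also have "\<dots> = (\<Sum>k0\<in>idx i. 2 * (2 * N + 1) ^ (block_dim b i - 1))"
  proof (rule sum.cong[OF refl])
    fix k0 assume "k0 \<in> idx i"
    then have "card (idx i - {k0}) = block_dim b i - 1" by (simp add: block_dim_def)
    moreover have "nat (int N - - int N + 1) = 2 * N + 1" by simp
    ultimately show "card (UNIV \<times> Pi\<^sub>E (idx i - {k0}) (\<lambda>_. {- int N..int N}) :: (bool \<times> ('n \<Rightarrow> int)) set)
        = 2 * (2 * N + 1) ^ (block_dim b i - 1)"
      by (simp add: card_cartesian_product card_PiE)
  qed
  finally show "card (cells i N) = block_dim b i * (2 * (2 * N + 1) ^ (block_dim b i - 1))"
    by (simp add: block_dim_def)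
qed

text \<open>Two points of a grid cube differ by at most 1/N in each coordinate, so by d/N in norm.
  Points on the boundary of the cube have norm at least 1, where radial projection at most doubles
  distances.\<close>

lemma cell_diameter:
  assumes N: "N > 0" and c: "c \<in> cells i N"
  shows "bounded (cell i N c) \<and> diameter (cell i N c) \<le> 2 * real CARD('n) / real N"
proof -
  obtain k0 \<sigma> g where cc: "c = (k0, \<sigma>, g)" by (cases c) auto
  define V where "V = {v. block_proj b i v = v \<and> v $ k0 = (if \<sigma> then 1 else - 1 :: real) \<and>
     (\<forall>k\<in>idx i - {k0}. of_int (g k) \<le> real N * v $ k \<and> real N * v $ k \<le> of_int (g k) + 1)}"
  have cell: "cell i N c = sgn ` V" by (simp add: cell_def cc V_def)
  have n1: "1 \<le> norm v" if "v \<in> V" for v :: "real^'n"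
    using that component_le_norm_cart[of v k0] by (auto simp: V_def split: if_splits)
  have d: "norm (v - w) \<le> real CARD('n) / real N" if v: "v \<in> V" and w: "w \<in> V" for v w :: "real^'n"
  proof -
    have "norm (v - w) \<le> (\<Sum>k\<in>UNIV. \<bar>(v - w) $ k\<bar>)" by (rule norm_le_l1_cart)
    also have "\<dots> \<le> (\<Sum>k\<in>(UNIV::'n set). 1 / real N)"
    proof (rule sum_mono)
      fix k
      show "\<bar>(v - w) $ k\<bar> \<le> 1 / real N"
      proof (cases "k \<in> idx i - {k0}")
        case True
        then have "of_int (g k) \<le> real N * v $ k \<and> real N * v $ k \<le> of_int (g k) + 1"
           "of_int (g k) \<le> real N * w $ k \<and> real N * w $ k \<le> of_int (g k) + 1"
          using v w unfolding V_def by blast+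
        then have "\<bar>real N * v $ k - real N * w $ k\<bar> \<le> 1" by linarith
        then have "real N * \<bar>v $ k - w $ k\<bar> \<le> 1"
          by (metis abs_mult abs_of_nat right_diff_distrib)
        then show ?thesis using N by (simp add: field_simps)
      next
        case False
        have "v $ k = w $ k"
        proof (cases "k = k0")
          case True then show ?thesis using v w by (simp add: V_def)
        next
          case nk: False
          then have "b k \<noteq> i" using False by auto
          moreover have "block_proj b i v = v" "block_proj b i w = w" using v w unfolding V_def by blast+
          ultimately show ?thesis by (metis block_proj_nth)
        qed
        then show ?thesis by simp
      qed
    qed
    finally show ?thesis by simp
  qed
  have dd: "norm (x - y) \<le> 2 * real CARD('n) / real N" if xy: "x \<in> cell i N c" "y \<in> cell i N c" for x y
  proof -
    obtain v w where vw: "x = sgn v" "y = sgn w" "v \<in> V" "w \<in> V" using xy unfolding cell by blast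
    have "norm (x - y) \<le> 2 * norm (v - w)" unfolding vw(1,2) by (rule norm_sgn_diff_le) (intro n1 vw)+
    also have "\<dots> \<le> 2 * (real CARD('n) / real N)" by (intro mult_left_mono d vw) simp
    finally show ?thesis by simp
  qed
  have "bounded (cell i N c)"
  proof (rule boundedI)
    fix x assume "x \<in> cell i N c"
    then show "norm x \<le> 1" unfolding cell by (auto simp: norm_sgn)
  qed
  moreover have "diameter (cell i N c) \<le> 2 * real CARD('n) / real N"
    by (rule diameter_le) (auto intro: dd)
  ultimately show ?thesis by blast
qed

text \<open>Radial projection of a grid on the boundary of the cube \<open>[-1, 1]\<^sup>k\<close>.\<close>

lemma block_sphere_subset_cells:
  assumes i: "i < l" and N: "N > 0"
  shows "block_sphere b i \<subseteq> (\<Union>c\<in>cells i N. cell i N c)"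
proof
  fix \<theta> assume "\<theta> \<in> block_sphere b i"
  then have t: "block_proj b i \<theta> = \<theta>" "norm \<theta> = 1" by (auto simp: block_sphere_eq)
  have ne: "idx i \<noteq> {}" using block_nonempty[OF i] by auto
  define m where "m = Max ((\<lambda>k. \<bar>\<theta> $ k\<bar>) ` idx i)"
  have "m \<in> (\<lambda>k. \<bar>\<theta> $ k\<bar>) ` idx i" unfolding m_def by (rule Max_in) (use ne in auto)
  then obtain k0 where k0: "b k0 = i" "\<bar>\<theta> $ k0\<bar> = m" by auto
  have le: "\<bar>\<theta> $ k\<bar> \<le> m" if "b k = i" for k unfolding m_def using that by (intro Max_ge) auto
  have "m \<noteq> 0"
  proof
    assume "m = 0"
    then have "\<theta> $ k = 0" for k
      using le[of k] t(1) by (cases "b k = i") (auto simp: vec_eq_iff dest: spec[of _ k])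
    then have "\<theta> = 0" by (simp add: vec_eq_iff)
    then show False using t by simp
  qed
  then have m: "m > 0" using k0 by auto
  define v where "v = (1 / m) *\<^sub>R \<theta>"
  define \<sigma> where "\<sigma> = (\<theta> $ k0 > 0)"
  define g where "g = (\<lambda>k\<in>idx i - {k0}. \<lfloor>real N * v $ k\<rfloor>)"
  have "block_proj b i (a *\<^sub>R \<theta>) = a *\<^sub>R block_proj b i \<theta>" for a by (simp add: vec_eq_iff)
  then have pv: "block_proj b i v = v" using t(1) by (simp add: v_def)
  have "v $ k0 = (if \<sigma> then 1 else - 1)" using k0(2) m by (auto simp: v_def \<sigma>_def abs_if field_simps split: if_splits)
  moreover have "of_int (g k) \<le> real N * v $ k \<and> real N * v $ k \<le> of_int (g k) + 1" if "k \<in> idx i - {k0}" for k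
    using that by (simp add: g_def)
  ultimately have "sgn v \<in> cell i N (k0, \<sigma>, g)" using pv by (auto simp: cell_def)
  moreover have "sgn v = \<theta>" using m t(2) by (simp add: v_def sgn_div_norm)
  moreover have "(k0, \<sigma>, g) \<in> cells i N"
  proof -
    have "- int N \<le> \<lfloor>real N * v $ k\<rfloor> \<and> \<lfloor>real N * v $ k\<rfloor> \<le> int N" if "b k = i" for k
    proof -
      have "\<bar>v $ k\<bar> \<le> 1" using le[OF that] m by (simp add: v_def abs_mult field_simps)
      then have "\<bar>real N * v $ k\<bar> \<le> real N * 1" unfolding abs_mult by (intro mult_mono) auto
      then show ?thesis by (auto simp: le_floor_iff floor_le_iff)
    qed
    then show ?thesis using k0 by (auto simp: cells_def g_def)
  qed
  ultimately show "\<theta> \<in> (\<Union>c\<in>cells i N. cell i N c)" by blast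
qed

text \<open>In block dimension k, about N^(k-1) cells of diameter about 1/N cover the sphere, so the
  Hausdorff sums are bounded uniformly in N. Finiteness makes the products and Radon-Nikodym
  derivatives below available.\<close>

lemma hausdorff_outer_block_sphere_finite:
  assumes i: "i < l"
  shows "hausdorff_outer (real (block_dim b i) - 1) (block_sphere b i) < \<infinity>"
proof -
  let ?s = "real (block_dim b i) - 1"
  define m where "m = block_dim b i - 1"
  have s: "?s = real m" "m \<ge> 1" using two_le[OF i] by (auto simp: m_def)
  define c where "c = unit_ball_vol ?s / 2 powr ?s"
  have c: "0 \<le> c" using s by (simp add: c_def)
  \<comment> \<open>The number 6 d arises from 2 N + 1 \<le> 3 N cells per direction times the
    diameter bound 2 d / N.\<close>
  define C where "C = c * real (block_dim b i) * 2 * (6 * real CARD('n)) ^ m"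
  have le_C: "hausdorff_content ?s (2 * real CARD('n) / real N) (block_sphere b i) \<le> ennreal C" if N: "N > 0" for N
  proof -
    have "hausdorff_content ?s (2 * real CARD('n) / real N) (block_sphere b i)
       \<le> of_nat (card (cells i N)) * ennreal (c * (2 * real CARD('n) / real N) powr ?s)"
      unfolding c_def
      by (rule hausdorff_content_finite_cover[where C="cell i N"])
         (use N cell_diameter block_sphere_subset_cells[OF i] card_cells[OF i] s in auto)
    also have "\<dots> = ennreal (real (card (cells i N)) * (c * (2 * real CARD('n) / real N) powr ?s))"
      using c by (simp add: ennreal_mult ennreal_of_nat_eq_real_of_nat)
    also have "\<dots> \<le> ennreal C"
    proof (rule ennreal_leI)
      have "(2 * real CARD('n) / real N) powr ?s = (2 * real CARD('n) / real N) ^ m"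
        unfolding s(1) using N by (intro powr_realpow) auto
      moreover have "real (card (cells i N)) = real (block_dim b i) * 2 * (2 * real N + 1) ^ m"
        by (simp add: card_cells[OF i] m_def add.commute)
      moreover have "(2 * real N + 1) ^ m * (2 * real CARD('n) / real N) ^ m \<le> (6 * real CARD('n)) ^ m"
        unfolding power_mult_distrib[symmetric]
      proof (rule power_mono)
        have "(2 * real N + 1) * (2 * real CARD('n) / real N) \<le> (3 * real N) * (2 * real CARD('n) / real N)"
          using N by (intro mult_right_mono) auto
        also have "\<dots> = 6 * real CARD('n)" using N by simp
        finally show "(2 * real N + 1) * (2 * real CARD('n) / real N) \<le> 6 * real CARD('n)" .
      qed auto
      then have "(c * real (block_dim b i) * 2) * ((2 * real N + 1) ^ m * (2 * real CARD('n) / real N) ^ m)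
         \<le> (c * real (block_dim b i) * 2) * (6 * real CARD('n)) ^ m"
        using c by (intro mult_left_mono) auto
      ultimately show "real (card (cells i N)) * (c * (2 * real CARD('n) / real N) powr ?s) \<le> C"
        unfolding C_def by (simp only: mult_ac)
    qed
    finally show ?thesis .
  qed
  have "hausdorff_outer ?s (block_sphere b i) \<le> ennreal C"
    unfolding hausdorff_outer_def
  proof (rule SUP_least)
    fix \<delta> :: real assume "\<delta> \<in> {0<..}"
    then have \<delta>: "\<delta> > 0" by simp
    obtain N :: nat where N: "N > 0" "2 * real CARD('n) / \<delta> < real N"
      by (metis \<delta> divide_nonneg_pos gr0I less_le_trans of_nat_0 not_le of_nat_0_le_iff mult_nonneg_nonneg reals_Archimedean2 zero_le_numeral)
    then have "2 * real CARD('n) / real N \<le> \<delta>" using \<delta> by (simp add: field_simps)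
    then show "hausdorff_content ?s \<delta> (block_sphere b i) \<le> ennreal C"
      by (rule order_trans[OF hausdorff_content_antimono le_C[OF N(1)]])
  qed
  then show ?thesis by (rule le_less_trans) simp
qed

lemma finite_sphere_measure: "finite_measure (sphere_measure b i)"
proof
  show "emeasure (sphere_measure b i) (space (sphere_measure b i)) \<noteq> \<infinity>"
  proof (cases "i < l")
    case True
    have "block_sphere b i \<in> sets (sphere_measure b i)" by (simp add: sets_sphere_measure_iff)
    then show ?thesis using hausdorff_outer_block_sphere_finite[OF True]
      by (simp add: emeasure_sphere_measure)
  next
    \<comment> \<open>Indices beyond the blocks occur because finiteness is wanted for the whole
      family; their sphere is empty.\<close>
    case False
    then have "b k \<noteq> i" for k using b_less[of k] by auto
    then have "block_proj b i \<theta> = 0" for \<theta> by (simp add: vec_eq_iff)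
    then have "block_sphere b i = {}" by (auto simp: block_sphere_eq)
    then show ?thesis by simp
  qed
qed

section \<open>Volumes of cones over subsets of one sphere\<close>

abbreviation PB :: "nat \<Rightarrow> ('n \<Rightarrow> real) measure" where
  "PB i \<equiv> Pi\<^sub>M (idx i) (\<lambda>_. lborel)"

definition bcone :: "nat \<Rightarrow> (real^'n) set \<Rightarrow> ('n \<Rightarrow> real) set" where
  "bcone i E = {f \<in> space (PB i). 2 \<le> norm (emb i f) \<and> norm (emb i f) \<le> 3 \<and> sgn (emb i f) \<in> E}"

lemma measurable_emb [measurable]: "emb i \<in> borel_measurable (PB i)"
proof (rule borel_measurable_vecI)
  fix k
  show "(\<lambda>f. emb i f $ k) \<in> borel_measurable (PB i)"
    using measurable_component_singleton[of k "idx i" "\<lambda>_. lborel"] by (cases "b k = i") auto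
qed

lemma borel_measurable_sgn_vec: "(sgn :: real^'n \<Rightarrow> real^'n) \<in> borel_measurable borel"
  unfolding sgn_div_norm[abs_def]
  by (intro borel_measurable_scaleR borel_measurable_inverse borel_measurable_norm measurable_ident_sets refl)

lemma sets_bcone [measurable]:
  assumes "E \<in> sets borel"
  shows "bcone i E \<in> sets (PB i)"
proof -
  have "sgn -` E \<in> sets borel" by (rule measurable_sets_borel[OF borel_measurable_sgn_vec assms])
  moreover have "{v :: real^'n. 2 \<le> norm v \<and> norm v \<le> 3} \<in> sets borel"
    by (intro borel_closed closed_Collect_conj closed_Collect_le continuous_on_const continuous_on_norm_id)
  ultimately have "{v. 2 \<le> norm v \<and> norm v \<le> 3} \<inter> sgn -` E \<in> sets borel" by (rule sets.Int[rotated])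
  then have "emb i -` ({v. 2 \<le> norm v \<and> norm v \<le> 3} \<inter> sgn -` E) \<inter> space (PB i) \<in> sets (PB i)"
    by (rule measurable_sets[OF measurable_emb])
  moreover have "bcone i E = emb i -` ({v. 2 \<le> norm v \<and> norm v \<le> 3} \<inter> sgn -` E) \<inter> space (PB i)"
    by (auto simp: bcone_def)
  ultimately show ?thesis by simp
qed

text \<open>With k the block dimension, the radii from 2 to 3 are cut into at most 2/t steps of
  length t. A piece lies in a cube of side 8 t about a multiple of one fixed direction: 3 t comes
  from the spread of directions at radius at most 3, and t from the radii. Altogether (2/t) (8
  t)^k.\<close>

lemma emeasure_bcone_cap:
  assumes i: "i < l" and t: "0 < t" "t \<le> 1" and E: "E \<in> sets borel" "E \<subseteq> block_sphere b i"
    and d: "\<And>x y. x \<in> E \<Longrightarrow> y \<in> E \<Longrightarrow> dist x y \<le> t"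
  shows "emeasure (PB i) (bcone i E) \<le> ennreal (2 * 8 ^ block_dim b i * t ^ (block_dim b i - 1))"
proof (cases "E = {}")
  case True
  then show ?thesis by (simp add: bcone_def)
next
  case False
  then obtain x0 where x0: "x0 \<in> E" by blast
  interpret product_sigma_finite "\<lambda>_::'n. lborel :: real measure" by standard
  let ?k = "block_dim b i"
  define \<rho> where "\<rho> m = 2 + real m * t" for m
  define M where "M = nat \<lfloor>1 / t\<rfloor> + 1"
  define Bx where "Bx m = Pi\<^sub>E (idx i) (\<lambda>k. {\<rho> m * x0 $ k - 4 * t..\<rho> m * x0 $ k + 4 * t})" for m
  have sub: "bcone i E \<subseteq> (\<Union>m<M. Bx m)"
  proof
    fix f assume "f \<in> bcone i E"
    then have f: "f \<in> space (PB i)" "2 \<le> norm (emb i f)" "norm (emb i f) \<le> 3" "sgn (emb i f) \<in> E"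
      by (auto simp: bcone_def)
    let ?r = "norm (emb i f)" and ?\<theta> = "sgn (emb i f)"
    define m where "m = nat \<lfloor>(?r - 2) / t\<rfloor>"
    have fl: "0 \<le> \<lfloor>(?r - 2) / t\<rfloor>" using f t by simp
    have "(?r - 2) / t \<le> 1 / t" using f t by (intro divide_right_mono) auto
    then have "\<lfloor>(?r - 2) / t\<rfloor> \<le> \<lfloor>1 / t\<rfloor>" by (rule floor_mono)
    then have mM: "m < M" using fl by (simp add: m_def M_def)
    have rm: "real m = of_int \<lfloor>(?r - 2) / t\<rfloor>" using fl by (simp add: m_def)
    have "real m \<le> (?r - 2) / t" "(?r - 2) / t \<le> real m + 1" unfolding rm by linarith+
    then have r: "\<rho> m \<le> ?r" "?r \<le> \<rho> m + t" using t by (auto simp: \<rho>_def field_simps)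
    have x01: "norm x0 = 1" using x0 E by (auto simp: block_sphere_eq)
    have "?r \<noteq> 0" using f(2) by linarith
    then have "emb i f = ?r *\<^sub>R ?\<theta>" by (simp add: sgn_div_norm)
    then have "norm (emb i f - \<rho> m *\<^sub>R x0) = norm (?r *\<^sub>R (?\<theta> - x0) + (?r - \<rho> m) *\<^sub>R x0)"
      by (metis (no_types, lifting) add_diff_eq diff_add_cancel scaleR_left_diff_distrib scaleR_right_diff_distrib)
    also have "\<dots> \<le> ?r * norm (?\<theta> - x0) + \<bar>?r - \<rho> m\<bar> * norm x0"
      by (rule order_trans[OF norm_triangle_ineq]) simp
    also have "\<dots> \<le> 3 * t + t * 1"
      using f(3) r d[OF f(4) x0] x01 by (intro add_mono mult_mono) (auto simp: dist_norm)
    finally have n4: "norm (emb i f - \<rho> m *\<^sub>R x0) \<le> 4 * t" by simp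
    have "f k \<in> {\<rho> m * x0 $ k - 4 * t..\<rho> m * x0 $ k + 4 * t}" if "b k = i" for k
      using order_trans[OF component_le_norm_cart[of "emb i f - \<rho> m *\<^sub>R x0" k] n4] that by (auto simp: abs_le_iff)
    then have "f \<in> Bx m" using f(1) by (auto simp: Bx_def space_PiM PiE_iff)
    then show "f \<in> (\<Union>m<M. Bx m)" using mM by blast
  qed
  have Bm: "emeasure (PB i) (Bx m) = ennreal ((8 * t) ^ ?k)" for m
  proof -
    have "emeasure (PB i) (Bx m) = (\<Prod>k\<in>idx i. emeasure lborel {\<rho> m * x0 $ k - 4 * t..\<rho> m * x0 $ k + 4 * t})"
      unfolding Bx_def by (rule emeasure_PiM) auto
    also have "\<dots> = (\<Prod>k\<in>idx i. ennreal (8 * t))" using t by (intro prod.cong) auto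
    finally show ?thesis using t by (simp add: block_dim_def ennreal_power)
  qed
  have sB: "Bx m \<in> sets (PB i)" for m unfolding Bx_def by (intro sets_PiM_I_finite) auto
  have "emeasure (PB i) (bcone i E) \<le> emeasure (PB i) (\<Union>m<M. Bx m)"
    using sB by (intro emeasure_mono sub) auto
  also have "\<dots> \<le> (\<Sum>m<M. emeasure (PB i) (Bx m))" using sB by (intro emeasure_subadditive_finite) auto
  also have "\<dots> = ennreal (real M * (8 * t) ^ ?k)" using t by (simp add: Bm ennreal_mult ennreal_of_nat_eq_real_of_nat)
  also have "\<dots> \<le> ennreal (2 * 8 ^ ?k * t ^ (?k - 1))"
  proof (rule ennreal_leI)
    have "real_of_int \<lfloor>1 / t\<rfloor> \<le> 1 / t" by linarith
    moreover have "0 \<le> \<lfloor>1 / t\<rfloor>" "1 \<le> 1 / t" using t by auto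
    moreover have "2 / t = 1 / t + 1 / t" by simp
    moreover have "real M = of_int \<lfloor>1 / t\<rfloor> + 1" using t by (simp add: M_def)
    ultimately have M: "real M \<le> 2 / t" by linarith
    have k: "?k = Suc (?k - 1)" using two_le[OF i] by simp
    have e: "(8 * t) ^ ?k = 8 ^ ?k * (t * t ^ (?k - 1))"
      unfolding power_mult_distrib by (subst (2) k) (simp only: power_Suc)
    have "real M * (8 * t) ^ ?k \<le> (2 / t) * (8 * t) ^ ?k" using t by (intro mult_right_mono M) auto
    also have "\<dots> = 2 * 8 ^ ?k * t ^ (?k - 1)" unfolding e using t by simp
    finally show "real M * (8 * t) ^ ?k \<le> 2 * 8 ^ ?k * t ^ (?k - 1)" .
  qed
  finally show ?thesis .
qed

text \<open>Taking the closure makes a covering set Borel without changing its diameter.\<close>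

lemma emeasure_bcone_le_weight:
  assumes i: "i < l" and E: "E \<in> sets borel" "E \<subseteq> block_sphere b i" and D: "bounded D" "diameter D \<le> 1"
  shows "emeasure (PB i) (bcone i (E \<inter> closure D))
    \<le> ennreal (2 * 8 ^ block_dim b i * diameter D powr (real (block_dim b i) - 1))"
proof -
  let ?m = "block_dim b i - 1"
  have s: "real (block_dim b i) - 1 = real ?m" "?m \<ge> 1" using two_le[OF i] by auto
  have d: "dist x y \<le> diameter D" if "x \<in> closure D" "y \<in> closure D" for x y
    using diameter_bounded_bound[OF bounded_closure[OF D(1)] that] diameter_closure[OF D(1)] by simp
  have *: "emeasure (PB i) (bcone i (E \<inter> closure D)) \<le> ennreal (2 * 8 ^ block_dim b i * t ^ ?m)"
    if "0 < t" "t \<le> 1" "diameter D \<le> t" for t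
    using that E by (intro emeasure_bcone_cap i) (auto intro: order_trans[OF d])
  show ?thesis
  proof (cases "diameter D = 0")
    case False
    then have "0 < diameter D" using diameter_ge_0[OF D(1)] by simp
    then show ?thesis using *[of "diameter D"] D(2) unfolding s(1) by (simp add: powr_realpow)
  next
    \<comment> \<open>A single direction: the cap bound holds for every small t > 0, and its
      exponent is at least 1 since blocks have dimension at least 2, so the volume is 0.\<close>
    case True
    have "emeasure (PB i) (bcone i (E \<inter> closure D)) \<le> 0"
    proof (rule ennreal_le_epsilon)
      fix e :: real assume e: "0 < e"
      define t where "t = min 1 (e / (2 * 8 ^ block_dim b i))"
      have t: "0 < t" "t \<le> 1" "t \<le> e / (2 * 8 ^ block_dim b i)" using e by (auto simp: t_def)
      have "t ^ ?m \<le> t ^ 1" using t s by (intro power_decreasing) auto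
      then have "2 * 8 ^ block_dim b i * t ^ ?m \<le> 2 * 8 ^ block_dim b i * (e / (2 * 8 ^ block_dim b i))"
        using t by (intro mult_left_mono) auto
      then have "2 * 8 ^ block_dim b i * t ^ ?m \<le> e" by simp
      then show "emeasure (PB i) (bcone i (E \<inter> closure D)) \<le> 0 + ennreal e"
        using *[of t] t True by (auto intro: order_trans ennreal_leI)
    qed
    then show ?thesis by simp
  qed
qed

text \<open>A sum over the blocks in place of a maximum, giving one constant for all of
  them.\<close>

definition cone_const :: real where
  "cone_const = (\<Sum>i<l. 2 * 8 ^ block_dim b i / (unit_ball_vol (real (block_dim b i) - 1) / 2 powr (real (block_dim b i) - 1)))"

text \<open>Every cover by sets of diameter at most 1 bounds the volume of the cone by its Hausdorff
  sum, so already the content at scale 1 dominates the volume.\<close>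

lemma emeasure_bcone_le_hausdorff:
  assumes i: "i < l" and E: "E \<in> sets borel" "E \<subseteq> block_sphere b i"
  shows "emeasure (PB i) (bcone i E) \<le> ennreal cone_const * hausdorff_outer (real (block_dim b i) - 1) E"
proof -
  let ?s = "real (block_dim b i) - 1"
  define c where "c = unit_ball_vol ?s / 2 powr ?s"
  define C where "C = 2 * (8::real) ^ block_dim b i"
  have c: "c > 0" and C: "C > 0" using two_le[OF i] by (auto simp: c_def C_def)
  have "ennreal (c / C) * emeasure (PB i) (bcone i E) \<le> hausdorff_content ?s 1 E"
    unfolding hausdorff_content_eq
  proof (rule INF_greatest)
    fix D assume "D \<in> {D. hausdorff_cover 1 E D}"
    then have D: "E \<subseteq> (\<Union>j. D j)" "\<And>j. bounded (D j)" "\<And>j. diameter (D j) \<le> 1"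
      by (auto simp: hausdorff_cover_def)
    have "E \<subseteq> (\<Union>j. E \<inter> closure (D j))" using D(1) closure_subset by blast
    then have "bcone i E \<subseteq> (\<Union>j. bcone i (E \<inter> closure (D j)))" unfolding bcone_def by auto
    then have "emeasure (PB i) (bcone i E) \<le> emeasure (PB i) (\<Union>j. bcone i (E \<inter> closure (D j)))"
      using E by (intro emeasure_mono) auto
    also have "\<dots> \<le> (\<Sum>j. emeasure (PB i) (bcone i (E \<inter> closure (D j))))"
      using E by (intro emeasure_subadditive_countably) auto
    also have "\<dots> \<le> (\<Sum>j. ennreal (C * diameter (D j) powr ?s))"
      unfolding C_def by (intro suminf_le summableI emeasure_bcone_le_weight i E D)
    finally have "ennreal (c / C) * emeasure (PB i) (bcone i E) \<le> ennreal (c / C) * (\<Sum>j. ennreal (C * diameter (D j) powr ?s))"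
      by (rule mult_left_mono) simp
    also have "\<dots> = (\<Sum>j. ennreal (c / C) * ennreal (C * diameter (D j) powr ?s))" by simp
    also have "\<dots> = (\<Sum>j. hausdorff_weight ?s (D j))"
    proof (rule suminf_cong)
      fix j
      have "ennreal (c / C) * ennreal (C * diameter (D j) powr ?s) = ennreal ((c / C) * (C * diameter (D j) powr ?s))"
        using c C by (intro ennreal_mult[symmetric]) auto
      also have "(c / C) * (C * diameter (D j) powr ?s) = c * diameter (D j) powr ?s" using C by simp
      finally show "ennreal (c / C) * ennreal (C * diameter (D j) powr ?s) = hausdorff_weight ?s (D j)"
        by (simp add: hausdorff_weight_def c_def)
    qed
    finally show "ennreal (c / C) * emeasure (PB i) (bcone i E) \<le> (\<Sum>j. hausdorff_weight ?s (D j))" .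
  qed
  also have "\<dots> \<le> hausdorff_outer ?s E" by (rule hausdorff_outer_ge) simp
  finally have "ennreal (C / c) * (ennreal (c / C) * emeasure (PB i) (bcone i E)) \<le> ennreal (C / c) * hausdorff_outer ?s E"
    by (rule mult_left_mono) simp
  moreover have "ennreal (C / c) * ennreal (c / C) = 1"
    using c C by (simp add: ennreal_mult'[symmetric])
  ultimately have "emeasure (PB i) (bcone i E) \<le> ennreal (C / c) * hausdorff_outer ?s E"
    by (simp add: mult.assoc[symmetric])
  also have "\<dots> \<le> ennreal cone_const * hausdorff_outer ?s E"
  proof (intro mult_right_mono ennreal_leI)
    have "0 \<le> 2 * 8 ^ block_dim b j / (unit_ball_vol (real (block_dim b j) - 1) / 2 powr (real (block_dim b j) - 1))"
      if "j < l" for j using two_le[OF that] by simp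
    then show "C / c \<le> cone_const"
      unfolding cone_const_def C_def c_def using i
      by (intro member_le_sum[of i "{..<l}"]) auto
  qed simp
  finally show ?thesis .
qed

end

section \<open>Polar coordinates on the product of the block spheres\<close>

text \<open>The hypothesis is tested on the set where g < f; finiteness of the integral of f allows
  subtracting there.\<close>

lemma AE_le_of_set_nn_integral_le:
  assumes [measurable]: "f \<in> borel_measurable M" "g \<in> borel_measurable M"
    and fin: "(\<integral>\<^sup>+ x. f x \<partial>M) < \<infinity>"
    and le: "\<And>A. A \<in> sets M \<Longrightarrow> (\<integral>\<^sup>+ x. f x * indicator A x \<partial>M) \<le> (\<integral>\<^sup>+ x. g x * indicator A x \<partial>M)"
  shows "AE x in M. f x \<le> (g x :: ennreal)"
proof -
  let ?A = "{x \<in> space M. g x < f x}"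
  have A[measurable]: "?A \<in> sets M" by measurable
  let ?f = "\<lambda>x. f x * indicator ?A x" and ?g = "\<lambda>x. g x * indicator ?A x"
  have gf: "?g x \<le> ?f x" for x by (auto simp: indicator_def)
  have "(\<integral>\<^sup>+ x. ?f x \<partial>M) \<le> (\<integral>\<^sup>+ x. f x \<partial>M)" by (intro nn_integral_mono) (auto simp: indicator_def)
  then have ffin: "(\<integral>\<^sup>+ x. ?f x \<partial>M) < \<infinity>" using fin by (rule le_less_trans)
  have "(\<integral>\<^sup>+ x. ?g x \<partial>M) \<le> (\<integral>\<^sup>+ x. ?f x \<partial>M)" by (intro nn_integral_mono gf)
  then have gfin: "(\<integral>\<^sup>+ x. ?g x \<partial>M) \<noteq> \<infinity>" using ffin by (auto simp: top_unique)
  have "(\<integral>\<^sup>+ x. ?f x - ?g x \<partial>M) = (\<integral>\<^sup>+ x. ?f x \<partial>M) - (\<integral>\<^sup>+ x. ?g x \<partial>M)"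
    using gfin gf by (intro nn_integral_diff) auto
  also have "\<dots> = 0" using le[OF A] ffin by (simp add: diff_eq_0_ennreal)
  finally have "AE x in M. ?f x - ?g x = 0" by (subst (asm) nn_integral_0_iff_AE) auto
  with AE_space show ?thesis
  proof eventually_elim
    case (elim x)
    show ?case
    proof (rule ccontr)
      assume "\<not> f x \<le> g x"
      then have "g x < f x" by simp
      then show False using elim by (auto simp: diff_eq_0_iff_ennreal dest: leD)
    qed
  qed
qed

context sphere_blocks
begin

lemma measurable_into_sphere:
  assumes "f \<in> borel_measurable M" "\<And>x. x \<in> space M \<Longrightarrow> f x \<in> block_sphere b i"
  shows "f \<in> measurable M (sphere_measure b i)"
proof -
  have "f \<in> measurable M (restrict_space borel (block_sphere b i))"
    using assms by (intro measurable_restrict_space2) auto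
  then show ?thesis
    using measurable_cong_sets[OF refl sets_sphere_measure[of i]] by blast
qed

lemma measurable_from_sphere:
  "(\<lambda>x. x) \<in> borel_measurable (sphere_measure b i)"
proof -
  have "(\<lambda>x. x) \<in> borel_measurable (restrict_space borel (block_sphere b i))"
    by (intro measurable_restrict_space1) simp
  then show ?thesis
    using measurable_cong_sets[OF sets_sphere_measure[of i] refl] by blast
qed

text \<open>The image of Lebesgue measure on the shell of one block under radial projection. It
  stands for surface measure in polar coordinates.\<close>

definition cone_measure :: "nat \<Rightarrow> (real^'n) measure" where
  "cone_measure i = distr (restrict_space (PB i) (bcone i UNIV)) (sphere_measure b i) (\<lambda>f. sgn (emb i f))"

lemma sets_cone_measure [simp, measurable_cong]: "sets (cone_measure i) = sets (sphere_measure b i)"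
  by (simp add: cone_measure_def)

lemma emb_restrict [simp]: "emb i (restrict f (idx i)) = emb i f"
  by (simp add: emb_def vec_eq_iff)

lemma block_proj_emb: "block_proj b i (emb i f) = emb i f"
  by (simp add: vec_eq_iff)

lemma emeasure_cone_measure:
  assumes E: "E \<in> sets (sphere_measure b i)"
  shows "emeasure (cone_measure i) E = emeasure (PB i) (bcone i E)"
proof -
  have C: "bcone i UNIV \<in> sets (PB i)" by (rule sets_bcone) simp
  have sg: "(\<lambda>f. sgn (emb i f)) \<in> borel_measurable (PB i)"
    by (rule measurable_compose[OF measurable_emb borel_measurable_sgn_vec])
  have sp: "space (restrict_space (PB i) (bcone i UNIV)) = bcone i UNIV"
    by (auto simp: space_restrict_space bcone_def)
  have "sgn (emb i f) \<in> block_sphere b i" if "f \<in> bcone i UNIV" for f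
    using that by (intro sgn_in_block_sphere block_proj_emb) (auto simp: bcone_def)
  then have m: "(\<lambda>f. sgn (emb i f)) \<in> measurable (restrict_space (PB i) (bcone i UNIV)) (sphere_measure b i)"
    using sp by (intro measurable_into_sphere measurable_restrict_space1 sg) auto
  have "emeasure (cone_measure i) E = emeasure (restrict_space (PB i) (bcone i UNIV)) ((\<lambda>f. sgn (emb i f)) -` E \<inter> bcone i UNIV)"
    unfolding cone_measure_def by (subst emeasure_distr[OF m E]) (simp add: sp)
  also have "(\<lambda>f. sgn (emb i f)) -` E \<inter> bcone i UNIV = bcone i E" by (auto simp: bcone_def)
  also have "emeasure (restrict_space (PB i) (bcone i UNIV)) (bcone i E) = emeasure (PB i) (bcone i E)"
    using C by (intro emeasure_restrict_space) (auto simp: bcone_def sets.Int_space_eq2)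
  finally show ?thesis .
qed

lemma emeasure_cone_measure_space: "emeasure (cone_measure i) (space (cone_measure i)) < \<infinity>"
proof -
  interpret product_sigma_finite "\<lambda>_::'n. lborel :: real measure" by standard
  have sp: "space (cone_measure i) = block_sphere b i" using sets_eq_imp_space_eq[OF sets_cone_measure[of i]] by simp
  have "emeasure (cone_measure i) (space (cone_measure i)) = emeasure (PB i) (bcone i (block_sphere b i))"
    unfolding sp by (intro emeasure_cone_measure) (simp add: sets_sphere_measure_iff)
  also have "\<dots> \<le> emeasure (PB i) (Pi\<^sub>E (idx i) (\<lambda>_. {-3..3}))"
  proof (rule emeasure_mono)
    show "bcone i (block_sphere b i) \<subseteq> Pi\<^sub>E (idx i) (\<lambda>_. {-3..3})"
    proof
      fix f assume f: "f \<in> bcone i (block_sphere b i)"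
      have "f k \<in> {-3..3}" if "b k = i" for k
        using f that component_le_norm_cart[of "emb i f" k] by (auto simp: bcone_def abs_le_iff)
      then show "f \<in> Pi\<^sub>E (idx i) (\<lambda>_. {-3..3})" using f by (auto simp: bcone_def space_PiM PiE_iff)
    qed
  qed (auto intro: sets_PiM_I_finite)
  also have "\<dots> = (\<Prod>k\<in>idx i. emeasure lborel {-3..3::real})" by (rule emeasure_PiM) auto
  also have "\<dots> = ennreal (6 ^ card (idx i))" by (simp add: ennreal_power[symmetric])
  also have "\<dots> < \<infinity>" by simp
  finally show ?thesis .
qed

lemma finite_cone_measure: "finite_measure (cone_measure i)"
  by standard (use emeasure_cone_measure_space[of i] in \<open>simp add: less_top[symmetric]\<close>)

lemma cone_const_nonneg: "0 \<le> cone_const"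
proof -
  have "0 \<le> 2 * 8 ^ block_dim b j / (unit_ball_vol (real (block_dim b j) - 1) / 2 powr (real (block_dim b j) - 1))"
    if "j < l" for j using two_le[OF that] by simp
  then show ?thesis unfolding cone_const_def by (intro sum_nonneg) auto
qed

text \<open>Domination by a multiple of the sphere measure gives a Radon-Nikodym derivative that is
  bounded almost everywhere; taking the minimum with the constant makes the bound hold at every
  point.\<close>

lemma cone_measure_density:
  assumes i: "i < l"
  shows "\<exists>w \<in> borel_measurable (sphere_measure b i). (\<forall>x. w x \<le> ennreal cone_const) \<and> cone_measure i = density (sphere_measure b i) w"
proof -
  interpret S: finite_measure "sphere_measure b i" by (rule finite_sphere_measure)
  let ?S = "sphere_measure b i"
  have le: "emeasure (cone_measure i) E \<le> ennreal cone_const * emeasure ?S E" if "E \<in> sets ?S" for E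
    using that emeasure_bcone_le_hausdorff[OF i, of E]
    by (simp add: emeasure_cone_measure emeasure_sphere_measure sets_sphere_measure_iff)
  have "absolutely_continuous ?S (cone_measure i)"
    unfolding absolutely_continuous_def
  proof
    fix E assume "E \<in> null_sets ?S"
    then have "E \<in> sets ?S" "emeasure ?S E = 0" by auto
    then show "E \<in> null_sets (cone_measure i)" using le[of E] by (auto simp: null_sets_def)
  qed
  then obtain f where f[measurable]: "f \<in> borel_measurable ?S" and d: "density ?S f = cone_measure i"
    using S.Radon_Nikodym[of "cone_measure i"] by auto
  have "AE x in ?S. f x \<le> ennreal cone_const"
  proof (rule AE_le_of_set_nn_integral_le)
    have "(\<integral>\<^sup>+ x. f x \<partial>?S) = emeasure (density ?S f) (space ?S)"
      by (subst emeasure_density) (auto simp: sets_sphere_measure_iff intro!: nn_integral_cong)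
    also have "\<dots> < \<infinity>" unfolding d using emeasure_cone_measure_space[of i] sets_eq_imp_space_eq[OF sets_cone_measure[of i]] by simp
    finally show "(\<integral>\<^sup>+ x. f x \<partial>?S) < \<infinity>" .
    fix A assume A: "A \<in> sets ?S"
    have "(\<integral>\<^sup>+ x. f x * indicator A x \<partial>?S) = emeasure (cone_measure i) A"
      unfolding d[symmetric] using A by (simp add: emeasure_density)
    also have "\<dots> \<le> ennreal cone_const * emeasure ?S A" by (rule le[OF A])
    also have "\<dots> = (\<integral>\<^sup>+ x. ennreal cone_const * indicator A x \<partial>?S)"
      using A by (simp add: nn_integral_cmult_indicator)
    finally show "(\<integral>\<^sup>+ x. f x * indicator A x \<partial>?S) \<le> (\<integral>\<^sup>+ x. ennreal cone_const * indicator A x \<partial>?S)" .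
  qed auto
  then have "AE x in ?S. f x = min (f x) (ennreal cone_const)"
    by eventually_elim (simp add: min_absorb1)
  then have "cone_measure i = density ?S (\<lambda>x. min (f x) (ennreal cone_const))"
    unfolding d[symmetric] by (intro density_cong) auto
  then show ?thesis by (intro bexI[of _ "\<lambda>x. min (f x) (ennreal cone_const)"]) auto
qed

text \<open>Fubini with the coordinates grouped by block, one block being split off at each step of
  the induction.\<close>

lemma nn_integral_PiM_blocks:
  assumes "finite L" "\<And>i. i \<in> L \<Longrightarrow> g i \<in> borel_measurable (PB i)"
  shows "(\<integral>\<^sup>+ f. (\<Prod>i\<in>L. g i (restrict f (idx i))) \<partial>Pi\<^sub>M {k. b k \<in> L} (\<lambda>_. lborel)) = (\<Prod>i\<in>L. \<integral>\<^sup>+ f. g i f \<partial>PB i)"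
  using assms
proof (induction L rule: finite_induct)
  case empty
  interpret product_sigma_finite "\<lambda>_::'n. lborel :: real measure" by standard
  show ?case by (simp add: space_PiM_empty)
next
  case (insert i L)
  interpret product_sigma_finite "\<lambda>_::'n. lborel :: real measure" by standard
  note insert.prems[measurable]
  let ?J = "{k. b k \<in> L}"
  have I: "{k. b k \<in> insert i L} = idx i \<union> ?J" by auto
  have dis: "idx i \<inter> ?J = {}" using insert.hyps by auto
  have m: "(\<lambda>f. g j (restrict f (idx j))) \<in> borel_measurable (Pi\<^sub>M A (\<lambda>_. lborel))" if "j \<in> insert i L" "idx j \<subseteq> A" for j A
    using that by (intro measurable_compose[OF measurable_restrict_subset[of "idx j" A] insert.prems]) auto
  have "(\<integral>\<^sup>+ f. (\<Prod>i\<in>insert i L. g i (restrict f (idx i))) \<partial>Pi\<^sub>M {k. b k \<in> insert i L} (\<lambda>_. lborel))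
    = (\<integral>\<^sup>+ x. \<integral>\<^sup>+ y. (\<Prod>j\<in>insert i L. g j (restrict (merge (idx i) ?J (x, y)) (idx j))) \<partial>Pi\<^sub>M ?J (\<lambda>_. lborel) \<partial>PB i)"
    unfolding I by (rule product_nn_integral_fold[OF dis]) (auto intro!: borel_measurable_prod_ennreal m)
  also have "\<dots> = (\<integral>\<^sup>+ x. \<integral>\<^sup>+ y. g i x * (\<Prod>j\<in>L. g j (restrict y (idx j))) \<partial>Pi\<^sub>M ?J (\<lambda>_. lborel) \<partial>PB i)"
  proof (intro nn_integral_cong)
    fix x y assume x: "x \<in> space (PB i)"
    have "restrict (merge (idx i) ?J (x, y)) (idx i) = x"
      using dis x by (simp add: space_PiM PiE_restrict)
    moreover have "restrict (merge (idx i) ?J (x, y)) (idx j) = restrict y (idx j)" if "j \<in> L" for j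
      using that insert.hyps by (auto simp: merge_def restrict_def fun_eq_iff)
    ultimately show "(\<Prod>j\<in>insert i L. g j (restrict (merge (idx i) ?J (x, y)) (idx j)))
      = g i x * (\<Prod>j\<in>L. g j (restrict y (idx j)))"
      using insert.hyps by (simp cong: prod.cong)
  qed
  also have "\<dots> = (\<integral>\<^sup>+ x. g i x * (\<integral>\<^sup>+ y. (\<Prod>j\<in>L. g j (restrict y (idx j))) \<partial>Pi\<^sub>M ?J (\<lambda>_. lborel)) \<partial>PB i)"
    by (intro nn_integral_cong nn_integral_cmult borel_measurable_prod_ennreal m) auto
  also have "\<dots> = (\<integral>\<^sup>+ x. g i x \<partial>PB i) * (\<Prod>j\<in>L. \<integral>\<^sup>+ f. g j f \<partial>PB j)"
  proof -
    have "(\<integral>\<^sup>+ y. (\<Prod>j\<in>L. g j (restrict y (idx j))) \<partial>Pi\<^sub>M ?J (\<lambda>_. lborel)) = (\<Prod>j\<in>L. \<integral>\<^sup>+ f. g j f \<partial>PB j)"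
      by (rule insert.IH) (rule insert.prems, simp)
    then show ?thesis by (simp only:) (rule nn_integral_multc, simp add: insert.prems)
  qed
  finally show ?case by (simp only: prod.insert[OF insert.hyps])
qed

lemma measurable_vec_lambda: "(\<lambda>f. (\<chi> k. f k) :: real^'n) \<in> borel_measurable (Pi\<^sub>M UNIV (\<lambda>_. lborel))"
proof (rule borel_measurable_vecI)
  fix k
  show "(\<lambda>f. (\<chi> k. f k) $ k) \<in> borel_measurable (Pi\<^sub>M UNIV (\<lambda>_. lborel))"
    using measurable_component_singleton[of k UNIV "\<lambda>_. lborel :: real measure"] by simp
qed

lemma lborel_eq_distr_PiM: "(lborel :: (real^'n) measure) = distr (Pi\<^sub>M UNIV (\<lambda>_. lborel)) borel (\<lambda>f. \<chi> k. f k)"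
proof (rule lborel_eqI)
  interpret product_sigma_finite "\<lambda>_::'n. lborel :: real measure" by standard
  have m: "(\<lambda>f. (\<chi> k. f k) :: real^'n) \<in> borel_measurable (Pi\<^sub>M UNIV (\<lambda>_. lborel))"
    by (rule measurable_vec_lambda)
  fix x y :: "real^'n" assume le: "\<And>j. j \<in> Basis \<Longrightarrow> x \<bullet> j \<le> y \<bullet> j"
  have B: "(Basis :: (real^'n) set) = range (\<lambda>k. axis k 1)" by (auto simp: Basis_vec_def)
  have inj: "inj (\<lambda>k. axis k (1::real) :: real^'n)" by (auto simp: inj_on_def axis_eq_axis)
  have le': "x $ k \<le> y $ k" for k using le[of "axis k 1"] by (auto simp: B inner_axis)
  have "emeasure (distr (Pi\<^sub>M UNIV (\<lambda>_. lborel)) borel (\<lambda>f. (\<chi> k. f k) :: real^'n)) (box x y)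
     = emeasure (Pi\<^sub>M UNIV (\<lambda>_. lborel)) (Pi\<^sub>E UNIV (\<lambda>k. {x $ k<..<y $ k}))"
    using m by (subst emeasure_distr) (auto simp: mem_box_cart space_PiM PiE_iff intro!: arg_cong[where f="emeasure _"])
  also have "\<dots> = (\<Prod>k\<in>UNIV. emeasure lborel {x $ k<..<y $ k})" by (rule emeasure_PiM) auto
  also have "\<dots> = (\<Prod>k\<in>UNIV. ennreal (y $ k - x $ k))" using le' by simp
  also have "\<dots> = ennreal (\<Prod>k\<in>UNIV. y $ k - x $ k)" using le' by (intro prod_ennreal) auto
  also have "(\<Prod>k\<in>UNIV. y $ k - x $ k) = (\<Prod>j\<in>Basis. (y - x) \<bullet> j)"
    unfolding B by (subst prod.reindex[OF inj]) (auto simp: inner_axis)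
  finally show "emeasure (distr (Pi\<^sub>M UNIV (\<lambda>_. lborel)) borel (\<lambda>f. (\<chi> k. f k) :: real^'n)) (box x y)
     = ennreal (\<Prod>j\<in>Basis. (y - x) \<bullet> j)" .
qed simp

abbreviation SPH :: "(nat \<Rightarrow> real^'n) measure" where "SPH \<equiv> product_sphere_measure l b"

definition tup :: "real^'n \<Rightarrow> nat \<Rightarrow> real^'n" where
  "tup v = (\<lambda>i\<in>{..<l}. block_proj b i v)"

lemma block_proj_dir: "block_proj b i (dir u) = sgn (block_proj b i u)"
  by (simp add: vec_eq_iff dir_def sgn_div_norm divide_inverse)

lemma tup_dir: "tup (dir u) = (\<lambda>i\<in>{..<l}. sgn (block_proj b i u))"
  by (simp add: tup_def block_proj_dir cong: restrict_cong)

lemma sgn_block_proj_in_sphere: "u \<in> nondeg \<Longrightarrow> i < l \<Longrightarrow> sgn (block_proj b i u) \<in> block_sphere b i"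
  by (intro sgn_in_block_sphere) (auto simp: nondeg_def vec_eq_iff)

lemma measurable_tup_dir:
  assumes f: "f \<in> borel_measurable M" "\<And>x. x \<in> space M \<Longrightarrow> f x \<in> nondeg"
  shows "(\<lambda>x. tup (dir (f x))) \<in> measurable M SPH"
  unfolding tup_dir product_sphere_measure_def
proof (rule measurable_restrict)
  fix i assume i: "i \<in> {..<l}"
  have "(\<lambda>x. block_proj b i (dir (f x))) \<in> borel_measurable M"
    using f(1) by measurable
  then show "(\<lambda>x. sgn (block_proj b i (f x))) \<in> measurable M (sphere_measure b i)"
    unfolding block_proj_dir using f(2) i by (intro measurable_into_sphere sgn_block_proj_in_sphere) auto
qed

text \<open>The shell is a product of shells, one per block, and the i-th direction depends on the
  i-th block alone. Hence preimages of rectangles are products of the sets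
  \<open>bcone\<close>.\<close>

lemma distr_shell: "distr (restrict_space lborel shell) SPH (\<lambda>u. tup (dir u)) = Pi\<^sub>M {..<l} cone_measure"
proof -
  interpret sg: product_sigma_finite cone_measure
    unfolding product_sigma_finite_def using finite_cone_measure by (blast intro: finite_measure.axioms)
  let ?D = "distr (restrict_space lborel shell) SPH (\<lambda>u. tup (dir u))"
  have spsh: "space (restrict_space lborel shell) = shell" by (simp add: space_restrict_space)
  have m: "(\<lambda>u. tup (dir u)) \<in> measurable (restrict_space lborel shell) SPH"
    using shell_subset_nondeg spsh
    by (intro measurable_tup_dir measurable_restrict_space1) auto
  show ?thesis
  proof (rule sg.PiM_eqI)
    show "sets ?D = sets (Pi\<^sub>M {..<l} cone_measure)"
      by (simp add: product_sphere_measure_def cong: sets_PiM_cong)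
    fix A assume A: "\<And>i. i \<in> {..<l} \<Longrightarrow> A i \<in> sets (cone_measure i)"
    then have As: "A i \<in> sets (sphere_measure b i)" if "i < l" for i using that by simp
    have Ab: "A i \<in> sets borel" if "i < l" for i using As[OF that] by (simp add: sets_sphere_measure_iff)
    have AP: "Pi\<^sub>E {..<l} A \<in> sets SPH"
      unfolding product_sphere_measure_def using As by (intro sets_PiM_I_finite) auto
    let ?Q = "(\<lambda>u. tup (dir u)) -` Pi\<^sub>E {..<l} A \<inter> shell"
    have Q: "?Q \<in> sets borel"
    proof -
      have "?Q \<in> sets (restrict_space lborel shell)" using measurable_sets[OF m AP] spsh by simp
      then show ?thesis by (subst (asm) sets_restrict_space_iff) auto
    qed
    have "emeasure ?D (Pi\<^sub>E {..<l} A) = emeasure (restrict_space lborel shell) ?Q"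
      using emeasure_distr[OF m AP] spsh by simp
    also have "\<dots> = emeasure lborel ?Q" by (rule emeasure_restrict_space) auto
    also have "\<dots> = (\<integral>\<^sup>+ u. indicator ?Q u \<partial>lborel)" using Q by simp
    also have "\<dots> = (\<integral>\<^sup>+ f. indicator ?Q (\<chi> k. f k) \<partial>Pi\<^sub>M UNIV (\<lambda>_. lborel))"
      by (subst lborel_eq_distr_PiM, subst nn_integral_distr[OF measurable_vec_lambda]) (use Q in simp_all)
    also have "\<dots> = (\<integral>\<^sup>+ f. (\<Prod>i<l. indicator (bcone i (A i)) (restrict f (idx i))) \<partial>Pi\<^sub>M {k. b k \<in> {..<l}} (\<lambda>_. lborel))"
    proof -
      have U: "{k. b k \<in> {..<l}} = UNIV" using b_less by auto
      have "indicator ?Q (\<chi> k. f k) = (\<Prod>i<l. indicator (bcone i (A i)) (restrict f (idx i)) :: ennreal)" for f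
      proof -
        have e: "block_proj b i (\<chi> k. f k) = emb i f" for i by (simp add: vec_eq_iff)
        have "(\<chi> k. f k) \<in> ?Q \<longleftrightarrow> (\<forall>i<l. restrict f (idx i) \<in> bcone i (A i))"
          by (auto simp: tup_dir e shell_def bcone_def space_PiM PiE_iff)
        then show ?thesis
          by (cases "\<forall>i<l. restrict f (idx i) \<in> bcone i (A i)") (auto simp: indicator_def intro!: prod.neutral prod_zero)
      qed
      then show ?thesis unfolding U by simp
    qed
    also have "\<dots> = (\<Prod>i<l. \<integral>\<^sup>+ f. indicator (bcone i (A i)) f \<partial>PB i)"
      by (rule nn_integral_PiM_blocks) (auto intro!: borel_measurable_indicator sets_bcone Ab)
    also have "\<dots> = (\<Prod>i<l. emeasure (cone_measure i) (A i))"
      using Ab As by (intro prod.cong refl) (auto simp: emeasure_cone_measure sets_bcone)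
    finally show "emeasure ?D (Pi\<^sub>E {..<l} A) = (\<Prod>i\<in>{..<l}. emeasure (cone_measure i) (A i))" .
  qed simp
qed

text \<open>The maximum with 1 keeps it positive, as the base of a real power later on.\<close>

definition weight_const :: real where "weight_const = max 1 (cone_const ^ l)"

text \<open>Polar coordinates with an unspecified weight, the product of the block densities. Being
  an identity, it can be read from the shell to the spheres to bound the density, and back to
  evaluate its p-th power.\<close>

lemma shell_integral:
  "\<exists>W \<in> borel_measurable SPH. (\<forall>\<theta>. W \<theta> \<le> ennreal weight_const) \<and>
    (\<forall>h \<in> borel_measurable SPH. (\<integral>\<^sup>+ u. indicator shell u * h (tup (dir u)) \<partial>lborel) = (\<integral>\<^sup>+ \<theta>. W \<theta> * h \<theta> \<partial>SPH))"
proof -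
  interpret sg: product_sigma_finite cone_measure
    unfolding product_sigma_finite_def using finite_cone_measure by (blast intro: finite_measure.axioms)
  interpret sp: product_sigma_finite "sphere_measure b"
    unfolding product_sigma_finite_def using finite_sphere_measure by (blast intro: finite_measure.axioms)
  obtain w where w: "\<And>i. i < l \<Longrightarrow> w i \<in> borel_measurable (sphere_measure b i)"
    "\<And>i x. i < l \<Longrightarrow> w i x \<le> ennreal cone_const" "\<And>i. i < l \<Longrightarrow> cone_measure i = density (sphere_measure b i) (w i)"
    using cone_measure_density by metis
  define W where "W \<theta> = (\<Prod>i<l. w i (\<theta> i))" for \<theta>
  have Wm[measurable]: "W \<in> borel_measurable SPH"
    unfolding W_def product_sphere_measure_def
  proof (rule borel_measurable_prod_ennreal)
    fix i assume i: "i \<in> {..<l}"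
    then have "w i \<in> borel_measurable (sphere_measure b i)" using w(1) by simp
    then show "(\<lambda>\<theta>. w i (\<theta> i)) \<in> borel_measurable (Pi\<^sub>M {..<l} (sphere_measure b))"
      by (rule measurable_compose[OF measurable_component_singleton[OF i]])
  qed
  have "density SPH W = Pi\<^sub>M {..<l} cone_measure"
  proof (rule sg.PiM_eqI)
    show "sets (density SPH W) = sets (Pi\<^sub>M {..<l} cone_measure)"
      by (simp add: product_sphere_measure_def cong: sets_PiM_cong)
    fix A assume "\<And>i. i \<in> {..<l} \<Longrightarrow> A i \<in> sets (cone_measure i)"
    then have As: "A i \<in> sets (sphere_measure b i)" if "i < l" for i using that by simp
    have AP: "Pi\<^sub>E {..<l} A \<in> sets SPH"
      unfolding product_sphere_measure_def using As by (intro sets_PiM_I_finite) auto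
    have "emeasure (density SPH W) (Pi\<^sub>E {..<l} A) = (\<integral>\<^sup>+ \<theta>. W \<theta> * indicator (Pi\<^sub>E {..<l} A) \<theta> \<partial>SPH)"
      using AP by (simp add: emeasure_density)
    also have "\<dots> = (\<integral>\<^sup>+ \<theta>. (\<Prod>i<l. w i (\<theta> i) * indicator (A i) (\<theta> i)) \<partial>SPH)"
    proof (rule nn_integral_cong)
      fix \<theta> assume "\<theta> \<in> space SPH"
      then have ext: "\<theta> \<in> extensional {..<l}" by (auto simp: product_sphere_measure_def space_PiM PiE_iff)
      have "indicator (Pi\<^sub>E {..<l} A) \<theta> = (\<Prod>i<l. indicator (A i) (\<theta> i) :: ennreal)"
      proof (cases "\<theta> \<in> Pi\<^sub>E {..<l} A")
        case True
        then show ?thesis by (auto simp: PiE_iff intro!: prod.neutral[symmetric])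
      next
        case False
        then obtain i where "i < l" "\<theta> i \<notin> A i" using ext by (auto simp: PiE_iff)
        then have "(\<Prod>i<l. indicator (A i) (\<theta> i)) = (0::ennreal)" by (intro prod_zero bexI[of _ i]) auto
        then show ?thesis using False by (simp only:) simp
      qed
      then show "W \<theta> * indicator (Pi\<^sub>E {..<l} A) \<theta> = (\<Prod>i<l. w i (\<theta> i) * indicator (A i) (\<theta> i))"
        by (simp only: W_def prod.distrib)
    qed
    also have "\<dots> = (\<Prod>i<l. \<integral>\<^sup>+ x. w i x * indicator (A i) x \<partial>sphere_measure b i)"
      unfolding product_sphere_measure_def
      by (rule sp.product_nn_integral_prod) (auto intro!: borel_measurable_times_ennreal w borel_measurable_indicator As)
    also have "\<dots> = (\<Prod>i<l. emeasure (cone_measure i) (A i))"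
      by (intro prod.cong refl) (simp add: w(1,3) As emeasure_density)
    finally show "emeasure (density SPH W) (Pi\<^sub>E {..<l} A) = (\<Prod>i\<in>{..<l}. emeasure (cone_measure i) (A i))" .
  qed simp
  then have D: "distr (restrict_space lborel shell) SPH (\<lambda>u. tup (dir u)) = density SPH W"
    using distr_shell by simp
  have spsh: "space (restrict_space lborel shell) = shell" by (simp add: space_restrict_space)
  have m: "(\<lambda>u. tup (dir u)) \<in> measurable (restrict_space lborel shell) SPH"
    using shell_subset_nondeg spsh
    by (intro measurable_tup_dir measurable_restrict_space1) auto
  have "(\<integral>\<^sup>+ u. indicator shell u * h (tup (dir u)) \<partial>lborel) = (\<integral>\<^sup>+ \<theta>. W \<theta> * h \<theta> \<partial>SPH)"
    if h: "h \<in> borel_measurable SPH" for h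
  proof -
    have "(\<integral>\<^sup>+ \<theta>. W \<theta> * h \<theta> \<partial>SPH) = (\<integral>\<^sup>+ \<theta>. h \<theta> \<partial>density SPH W)"
      using h by (simp add: nn_integral_density)
    also have "\<dots> = (\<integral>\<^sup>+ u. h (tup (dir u)) \<partial>restrict_space lborel shell)"
      unfolding D[symmetric] using h m by (simp add: nn_integral_distr)
    also have "\<dots> = (\<integral>\<^sup>+ u. h (tup (dir u)) * indicator shell u \<partial>lborel)"
      by (rule nn_integral_restrict_space) simp
    finally show ?thesis by (simp add: mult.commute)
  qed
  moreover have "W \<theta> \<le> ennreal weight_const" for \<theta>
  proof -
    have "W \<theta> \<le> (\<Prod>i<l. ennreal cone_const)" unfolding W_def by (intro prod_mono_ennreal w) simp
    also have "\<dots> = ennreal (cone_const ^ l)" using cone_const_nonneg by (simp add: ennreal_power)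
    also have "\<dots> \<le> ennreal weight_const" by (rule ennreal_leI) (simp add: weight_const_def)
    finally show ?thesis .
  qed
  ultimately show ?thesis using Wm by blast
qed

end

section \<open>Density of the pushforward\<close>

lemma ennreal_powr_mono: "0 \<le> p \<Longrightarrow> x \<le> y \<Longrightarrow> ennreal_powr x p \<le> ennreal_powr y p"
  by (cases x; cases y) (auto simp: ennreal_powr_def top_unique intro!: ennreal_leI powr_mono2)

lemma ennreal_powr_mult: "0 < a \<Longrightarrow> ennreal_powr (ennreal a * x) p = ennreal (a powr p) * ennreal_powr x p"
  by (cases x) (auto simp: ennreal_powr_def ennreal_mult'[symmetric] powr_mult ennreal_mult_eq_top_iff ennreal_mult_top)

lemma ennreal_powr_powr_inverse: "0 < p \<Longrightarrow> ennreal_powr (ennreal_powr x (1 / p)) p = x"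
  by (cases x) (auto simp: ennreal_powr_def powr_powr)

text \<open>Of the p factors w only p - 1 are estimated. One is kept to convert the integral over
  the spheres back into one over the shell.\<close>

lemma ennreal_powr_mult_le:
  assumes p: "1 < p" and w: "w \<le> ennreal K" "0 < K"
  shows "ennreal_powr (w * y) p \<le> ennreal (K powr (p - 1)) * (w * ennreal_powr y p)"
proof -
  obtain v where v: "w = ennreal v" "0 \<le> v" "v \<le> K" using w by (cases w) (auto simp: top_unique)
  show ?thesis
  proof (cases y)
    case (real x)
    have "(v * x) powr p = v powr (p - 1) * (v * x powr p)"
    proof (cases "v = 0")
      case False
      then have "v powr p = v powr (p - 1) * v" using v(2) by (simp add: powr_diff)
      then show ?thesis using v real by (simp add: powr_mult)
    qed (use p in simp)
    also have "\<dots> \<le> K powr (p - 1) * (v * x powr p)"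
      using v p by (intro mult_right_mono powr_mono2) auto
    finally have "ennreal ((v * x) powr p) \<le> ennreal (K powr (p - 1) * (v * x powr p))" by (rule ennreal_leI)
    then show ?thesis using v real by (simp add: ennreal_powr_def ennreal_mult[symmetric])
  next
    case top
    then show ?thesis using v w by (cases "v = 0") (auto simp: ennreal_powr_def ennreal_mult_top)
  qed
qed

text \<open>Where f \<le> L the excess power f^(q-1) is at most L^(q-1); where f > L the power
  f^(q-p) is at most L^(q-p). The threshold L remains free.\<close>

lemma powr_interpolate:
  fixes f L p q :: real
  assumes "0 \<le> f" "0 < L" "1 \<le> q" "q \<le> p"
  shows "f powr q \<le> L powr (q - 1) * f + L powr (q - p) * f powr p"
proof (cases "f \<le> L")
  case True
  have "f powr q = f powr (q - 1) * f" using assms by (cases "f = 0") (auto simp: powr_diff)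
  also have "\<dots> \<le> L powr (q - 1) * f" using True assms by (intro mult_right_mono powr_mono2) auto
  finally show ?thesis by (simp add: add_increasing2)
next
  case False
  then have "f powr q = f powr (q - p) * f powr p" using assms by (simp add: powr_add[symmetric])
  also have "\<dots> \<le> L powr (q - p) * f powr p" using False assms by (intro mult_right_mono powr_mono2') auto
  finally show ?thesis using assms by (simp add: add_increasing)
qed

lemma Lp_norm_measure_powr_le:
  assumes p: "0 < p" and f: "f \<in> borel_measurable S" "\<And>x. 0 \<le> f x" "M = density S (\<lambda>x. ennreal (f x))"
  shows "ennreal_powr (Lp_norm_measure p S M) p \<le> (\<integral>\<^sup>+ x. ennreal (f x powr p) \<partial>S)"
proof -
  have "Lp_norm_measure p S M \<le> ennreal_powr (\<integral>\<^sup>+ x. ennreal (f x powr p) \<partial>S) (1 / p)"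
    unfolding Lp_norm_measure_def by (rule INF_lower) (use f in auto)
  then have "ennreal_powr (Lp_norm_measure p S M) p \<le> ennreal_powr (ennreal_powr (\<integral>\<^sup>+ x. ennreal (f x powr p) \<partial>S) (1 / p)) p"
    using p by (intro ennreal_powr_mono) auto
  then show ?thesis using p by (simp add: ennreal_powr_powr_inverse)
qed

text \<open>Smoothing preserves the total mass, which is then at most the height times the volume
  4^d of the cube [-2, 2]^d, and for \<alpha> > d the height tends to 0.\<close>

lemma (in frostman) null_of_large_exponent:
  assumes "real CARD('n) < \<alpha>"
  shows "emeasure \<mu> UNIV = 0"
proof -
  define r where "r = (2::real) powr (real CARD('n) - \<alpha>)"
  define A where "A = 4 ^ CARD('n) * (2 * real CARD('n)) powr \<alpha>"
  have r: "0 \<le> r" "r < 1" using assms by (auto simp: r_def powr_less_one)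
  have le: "emeasure \<mu> UNIV \<le> ennreal (A * r ^ j)" for j
  proof -
    have one: "conv j (\<lambda>_. 1) x = 1" for x :: "real^'n" by (simp add: conv_def nn_integral_bump)
    have "emeasure \<mu> UNIV = (\<integral>\<^sup>+ x. conv j (\<lambda>_. 1) x \<partial>\<mu>)" by (simp add: one)
    also have "\<dots> = (\<integral>\<^sup>+ z. smooth \<mu> j z * 1 \<partial>lborel)" by (rule nn_integral_smooth_mult[symmetric]) simp
    also have "\<dots> \<le> (\<integral>\<^sup>+ z. ennreal (height j) * indicator {z :: real^'n. \<forall>k. \<bar>z $ k\<bar> \<le> 2} z \<partial>lborel)"
    proof (rule nn_integral_mono)
      fix z show "smooth \<mu> j z * 1 \<le> ennreal (height j) * indicator {z :: real^'n. \<forall>k. \<bar>z $ k\<bar> \<le> 2} z"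
        using smooth_le[of j z] smooth_support[of j z] by (cases "smooth \<mu> j z = 0") auto
    qed
    also have "\<dots> = ennreal (height j) * ennreal (4 ^ CARD('n))"
      by (subst nn_integral_cmult_indicator) (simp_all add: emeasure_cube)
    also have "\<dots> = ennreal (height j * 4 ^ CARD('n))" using height_nonneg by (intro ennreal_mult[symmetric]) auto
    also have "height j * 4 ^ CARD('n) = A * r ^ j"
      by (simp add: A_def r_def height_def powr_realpow[symmetric] powr_powr mult_ac)
    finally show ?thesis .
  qed
  have "(\<lambda>j. ennreal (A * r ^ j)) \<longlonglongrightarrow> ennreal (A * 0)"
    using r by (intro tendsto_ennrealI tendsto_intros LIMSEQ_power_zero) auto
  then have "emeasure \<mu> UNIV \<le> ennreal (A * 0)"
    by (rule LIMSEQ_le_const) (use le in auto)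
  then show ?thesis by simp
qed

context sphere_blocks
begin

text \<open>The blocks occupy disjoint coordinates, so summing the entries inverts
  \<open>tup\<close>.\<close>

definition untup :: "(nat \<Rightarrow> real^'n) \<Rightarrow> real^'n" where
  "untup \<theta> = (\<Sum>i<l. \<theta> i)"

lemma untup_tup: "untup (tup v) = v"
proof -
  have "(\<Sum>i<l. if b k = i then v $ k else 0) = v $ k" for k
    using b_less[of k] by simp
  then show ?thesis by (simp add: untup_def tup_def vec_eq_iff)
qed

lemma measurable_untup [measurable]: "untup \<in> borel_measurable SPH"
  unfolding untup_def product_sphere_measure_def
proof (rule borel_measurable_sum)
  fix i assume i: "i \<in> {..<l}"
  have "(\<lambda>\<theta>. \<theta> i) \<in> measurable (Pi\<^sub>M {..<l} (sphere_measure b)) (sphere_measure b i)"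
    by (rule measurable_component_singleton[OF i])
  from measurable_comp[OF this measurable_from_sphere]
  show "(\<lambda>\<theta>. \<theta> i) \<in> borel_measurable (Pi\<^sub>M {..<l} (sphere_measure b))"
    by (simp add: comp_def)
qed

lemma radial_domain_eq: "radial_domain l b y = {x. x - y \<in> nondeg}"
  by (simp add: radial_domain_def nondeg_def norm_block_proj_diff[symmetric])

lemma radial_proj_eq: "radial_proj l b y x = tup (dir (x - y))"
  by (simp add: radial_proj_def tup_dir norm_block_proj_diff sgn_div_norm cong: restrict_cong)

lemma sigma_finite_SPH: "sigma_finite_measure SPH"
proof -
  interpret product_sigma_finite "sphere_measure b"
    unfolding product_sigma_finite_def using finite_sphere_measure by (blast intro: finite_measure.axioms)
  show ?thesis unfolding product_sphere_measure_def by (rule sigma_finite) simp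
qed

lemma sets_radial_pushforward: "sets (radial_pushforward l b y \<mu>) = sets SPH"
  by (simp add: radial_pushforward_def)

definition product_sphere :: "(real^'n) set" where
  "product_sphere = {v. \<forall>i<l. block_proj b i v \<in> block_sphere b i}"

lemma sets_product_sphere: "product_sphere \<in> sets borel"
proof -
  have "product_sphere = (\<Inter>i\<in>{..<l}. block_proj b i -` block_sphere b i)" by (auto simp: product_sphere_def)
  moreover have "closed (block_proj b i -` block_sphere b i)" for i
    by (intro closed_vimage closed_block_sphere continuous_on_block_proj continuous_on_id)
  ultimately have "closed product_sphere" by (simp add: closed_INT)
  then show ?thesis by (rule borel_closed)
qed

text \<open>Turns a measurable set of tuples into a Borel set of R^d, where the bound for cones was
  proved.\<close>

lemma sets_tup_preimage:
  assumes E: "E \<in> sets SPH"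
  shows "{v \<in> product_sphere. tup v \<in> E} \<in> sets borel"
proof -
  have sp: "space (restrict_space borel product_sphere) = product_sphere" by (simp add: space_restrict_space)
  have "tup \<in> measurable (restrict_space borel product_sphere) SPH"
    unfolding tup_def product_sphere_measure_def
  proof (rule measurable_restrict)
    fix i assume "i \<in> {..<l}"
    then show "block_proj b i \<in> measurable (restrict_space borel product_sphere) (sphere_measure b i)"
      by (intro measurable_into_sphere measurable_restrict_space1 borel_measurable_block_proj)
         (auto simp: sp product_sphere_def)
  qed
  then have "tup -` E \<inter> product_sphere \<in> sets (restrict_space borel product_sphere)"
    using measurable_sets[OF _ E] sp by metis
  moreover have "tup -` E \<inter> product_sphere = {v \<in> product_sphere. tup v \<in> E}" by auto
  ultimately show ?thesis
    using sets_product_sphere by (subst (asm) sets_restrict_space_iff) auto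
qed

lemma dir_in_product_sphere: "w \<in> nondeg \<Longrightarrow> dir w \<in> product_sphere"
  by (simp add: product_sphere_def block_proj_dir sgn_block_proj_in_sphere)

lemma emeasure_radial_pushforward:
  assumes \<mu>: "sets \<mu> = sets borel" and E: "E \<in> sets SPH"
  shows "emeasure (radial_pushforward l b y \<mu>) E = emeasure \<mu> {x. x - y \<in> nondeg \<and> tup (dir (x - y)) \<in> E}"
proof -
  note [measurable_cong] = \<mu>
  have spm: "space \<mu> = UNIV" using sets_eq_imp_space_eq[OF \<mu>] by simp
  let ?D = "{x. x - y \<in> nondeg}"
  have D: "?D \<in> sets \<mu>"
  proof -
    have "?D = (\<lambda>x. x - y) -` nondeg" by auto
    then have "open ?D" using open_vimage[OF open_nondeg, of "\<lambda>x. x - y"] by (simp add: continuous_intros)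
    then show ?thesis unfolding \<mu> by simp
  qed
  have sp: "space (restrict_space \<mu> ?D) = ?D" using spm by (simp add: space_restrict_space)
  have "(\<lambda>x. x - y) \<in> borel_measurable \<mu>" by measurable
  then have m: "(\<lambda>x. tup (dir (x - y))) \<in> measurable (restrict_space \<mu> ?D) SPH"
    by (intro measurable_tup_dir measurable_restrict_space1) (auto simp: sp)
  have "radial_pushforward l b y \<mu> = distr (restrict_space \<mu> ?D) SPH (\<lambda>x. tup (dir (x - y)))"
    by (simp add: radial_pushforward_def radial_domain_eq radial_proj_eq[abs_def])
  then have "emeasure (radial_pushforward l b y \<mu>) E
     = emeasure (restrict_space \<mu> ?D) ((\<lambda>x. tup (dir (x - y))) -` E \<inter> ?D)"
    using m E sp by (simp add: emeasure_distr)
  also have "\<dots> = emeasure \<mu> ((\<lambda>x. tup (dir (x - y))) -` E \<inter> ?D)"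
    using D by (intro emeasure_restrict_space) auto
  also have "(\<lambda>x. tup (dir (x - y))) -` E \<inter> ?D = {x. x - y \<in> nondeg \<and> tup (dir (x - y)) \<in> E}" by auto
  finally show ?thesis .
qed

text \<open>The three factors come from the domination on cones, from the p - 1 estimated powers of
  the polar weight, and from comparing u with its normalized direction.\<close>

definition push_const :: "real \<Rightarrow> real" where
  "push_const p = dir_const powr p * weight_const powr (p - 1) * (3 ^ l) powr p"

end

locale sphere_frostman = sphere_blocks l b + blocks_frostman l b \<mu> \<alpha>
  for l :: nat and b :: "'n::finite \<Rightarrow> nat" and \<mu> :: "(real^'n) measure" and \<alpha> :: real
begin

text \<open>Here u = s.(dir u) with s_i the norms of the blocks, all between 2 and 3, and
  \<open>Xsup\<close> is homogeneous of degree -1 in each block.\<close>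

lemma Xsup_dir:
  assumes u: "u \<in> shell"
  shows "Xsup y u \<le> Xsup y (dir u)" "Xsup y (dir u) \<le> ennreal (3 ^ l) * Xsup y u"
proof -
  define s where "s i = norm (block_proj b i u)" for i
  have s: "2 \<le> s i" "s i \<le> 3" if "i < l" for i using u that by (auto simp: shell_def s_def)
  have s0: "s (b k) \<noteq> 0" for k using s(1)[OF b_less[of k]] by simp
  have pos: "s i > 0" if "i < l" for i using s(1)[OF that] by simp
  have "bscale b s (dir u) = u" using s0 by (simp add: vec_eq_iff dir_def s_def)
  then have X: "Xsup y (dir u) = ennreal (\<Prod>i<l. s i) * Xsup y u"
    using Xsup_scale[where s=s and y=y and u="dir u"] pos prod_ennreal[of "{..<l}" s] by (simp add: less_imp_le)
  have "1 \<le> (\<Prod>i<l. s i)" using s by (intro prod_ge_1) force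
  then have "1 * Xsup y u \<le> ennreal (\<Prod>i<l. s i) * Xsup y u" by (intro mult_right_mono) auto
  then show "Xsup y u \<le> Xsup y (dir u)" by (simp add: X)
  have "(\<Prod>i<l. s i) \<le> (\<Prod>i<l. 3)" using s pos by (intro prod_mono) (auto intro: less_imp_le)
  then show "Xsup y (dir u) \<le> ennreal (3 ^ l) * Xsup y u"
    unfolding X by (intro mult_right_mono ennreal_leI) auto
qed

definition sup_moment :: "real \<Rightarrow> real^'n \<Rightarrow> ennreal" where
  "sup_moment p y = (\<integral>\<^sup>+ u. ennreal (wt u) * ennreal_powr (Xsup y u) p \<partial>lborel)"

lemma Xsup_shell_finite:
  assumes p: "1 < p" and G: "sup_moment p y < \<infinity>"
  shows "(\<integral>\<^sup>+ u. indicator shell u * Xsup y u \<partial>lborel) < \<infinity>"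
proof -
  have x: "x \<le> 1 + ennreal_powr x p" for x
  proof (cases x)
    case (real r)
    have "r \<le> 1 + r powr p"
    proof (cases "r \<le> 1")
      case False
      then have "r powr 1 \<le> r powr p" using p by (intro powr_mono) auto
      then show ?thesis using False by simp
    qed (simp add: add_increasing2)
    then have "ennreal r \<le> ennreal (1 + r powr p)" by (rule ennreal_leI)
    then show ?thesis using real by (simp add: ennreal_powr_def)
  qed (simp add: ennreal_powr_def)
  have "(\<integral>\<^sup>+ u. indicator shell u * Xsup y u \<partial>lborel)
     \<le> (\<integral>\<^sup>+ u. ennreal (wt u) + ennreal (wt u) * ennreal_powr (Xsup y u) p \<partial>lborel)"
  proof (rule nn_integral_mono)
    fix u show "indicator shell u * Xsup y u \<le> ennreal (wt u) + ennreal (wt u) * ennreal_powr (Xsup y u) p"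
      using x[of "Xsup y u"] by (cases "u \<in> shell") (auto simp: wt_shell)
  qed
  also have "\<dots> = (\<integral>\<^sup>+ u. ennreal (wt u) \<partial>lborel) + sup_moment p y"
    unfolding sup_moment_def by (rule nn_integral_add) auto
  also have "\<dots> < \<infinity>"
    using G le_less_trans[OF nn_integral_wt_le, of top] by (simp add: less_top[symmetric])
  finally show ?thesis .
qed

text \<open>Domination by g times the product sphere measure gives absolute continuity and a density
  below g almost everywhere. The integral of the density is bounded by the mass of \<mu> alone; this
  bound, free of \<alpha> and \<beta>, is one end of the later interpolation.\<close>

lemma pushforward_density:
  assumes p: "1 < p" and y: "\<And>k. \<bar>y $ k\<bar> \<le> 1" and G: "sup_moment p y < \<infinity>"
  shows "\<exists>f :: (nat \<Rightarrow> real^'n) \<Rightarrow> real. f \<in> borel_measurable SPH \<and> (\<forall>\<theta>. 0 \<le> f \<theta>) \<and>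
    radial_pushforward l b y \<mu> = density SPH (\<lambda>\<theta>. ennreal (f \<theta>)) \<and>
    (\<integral>\<^sup>+ \<theta>. ennreal (f \<theta>) \<partial>SPH) \<le> 1 \<and>
    (\<integral>\<^sup>+ \<theta>. ennreal (f \<theta> powr p) \<partial>SPH) \<le> ennreal (push_const p) * sup_moment p y"
proof -
  interpret S: sigma_finite_measure SPH by (rule sigma_finite_SPH)
  let ?N = "radial_pushforward l b y \<mu>"
  obtain W where W[measurable]: "W \<in> borel_measurable SPH" and W_le: "\<And>\<theta>. W \<theta> \<le> ennreal weight_const"
    and W_int: "\<And>h. h \<in> borel_measurable SPH \<Longrightarrow>
      (\<integral>\<^sup>+ u. indicator shell u * h (tup (dir u)) \<partial>lborel) = (\<integral>\<^sup>+ \<theta>. W \<theta> * h \<theta> \<partial>SPH)"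
    using shell_integral by blast
  have Wpos: "weight_const > 0" by (simp add: weight_const_def)
  define Y where "Y \<theta> = Xsup y (untup \<theta>)" for \<theta>
  have Y[measurable]: "Y \<in> borel_measurable SPH" unfolding Y_def by measurable
  define g where "g \<theta> = ennreal dir_const * (W \<theta> * Y \<theta>)" for \<theta>
  have g[measurable]: "g \<in> borel_measurable SPH" unfolding g_def by measurable
  have fin: "(\<integral>\<^sup>+ u. indicator shell u * Xsup y u \<partial>lborel) < \<infinity>" by (rule Xsup_shell_finite[OF p G])
  have Nle: "emeasure ?N E \<le> (\<integral>\<^sup>+ \<theta>. g \<theta> * indicator E \<theta> \<partial>SPH)" if E[measurable]: "E \<in> sets SPH" for E
  proof -
    let ?B = "{v \<in> product_sphere. tup v \<in> E}"
    have "emeasure ?N E = emeasure \<mu> {x. x - y \<in> nondeg \<and> dir (x - y) \<in> ?B}"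
      by (subst emeasure_radial_pushforward[OF sets_eq E]) (auto intro!: arg_cong[where f="emeasure \<mu>"] dir_in_product_sphere)
    also have "\<dots> \<le> ennreal dir_const * (\<integral>\<^sup>+ u. indicator shell u * indicator ?B (dir u) * Xsup y u \<partial>lborel)"
      by (rule emeasure_cone_le[OF sets_tup_preimage[OF E] y fin])
    also have "\<dots> \<le> ennreal dir_const * (\<integral>\<^sup>+ u. indicator shell u * (indicator E (tup (dir u)) * Y (tup (dir u))) \<partial>lborel)"
    \<comment> \<open>\<open>Xsup y u\<close> is replaced by its larger value at
      \<open>dir u\<close>, so that the integrand becomes a function of the tuple of
      directions.\<close>
    proof (intro mult_left_mono nn_integral_mono)
      fix u
      show "indicator shell u * indicator ?B (dir u) * Xsup y u
        \<le> indicator shell u * (indicator E (tup (dir u)) * Y (tup (dir u)))"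
        using Xsup_dir(1)[of u y] by (auto simp: Y_def untup_tup indicator_def)
    qed simp
    also have "(\<integral>\<^sup>+ u. indicator shell u * (indicator E (tup (dir u)) * Y (tup (dir u))) \<partial>lborel)
       = (\<integral>\<^sup>+ \<theta>. W \<theta> * (indicator E \<theta> * Y \<theta>) \<partial>SPH)"
      by (rule W_int) measurable
    also have "ennreal dir_const * \<dots> = (\<integral>\<^sup>+ \<theta>. g \<theta> * indicator E \<theta> \<partial>SPH)"
      unfolding g_def by (simp add: nn_integral_cmult[symmetric] mult_ac)
    finally show ?thesis .
  qed
  have Nfin: "emeasure ?N (space SPH) \<le> 1"
  proof -
    have "emeasure ?N (space SPH) = emeasure \<mu> {x. x - y \<in> nondeg \<and> tup (dir (x - y)) \<in> space SPH}"
      by (rule emeasure_radial_pushforward[OF sets_eq]) simp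
    also have "\<dots> \<le> emeasure \<mu> UNIV" by (intro emeasure_mono) auto
    finally show ?thesis using emeasure_UNIV_le by (rule order_trans)
  qed
  have "absolutely_continuous SPH ?N"
    unfolding absolutely_continuous_def
  proof
    fix E assume E: "E \<in> null_sets SPH"
    then have [measurable]: "E \<in> sets SPH" by auto
    have "(\<integral>\<^sup>+ \<theta>. g \<theta> * indicator E \<theta> \<partial>SPH) = 0"
      using nn_integral_null_set[OF E, of g] .
    then show "E \<in> null_sets ?N" using Nle[of E] by (auto simp: null_sets_def sets_radial_pushforward)
  qed
  then obtain f0 where f0[measurable]: "f0 \<in> borel_measurable SPH" and N: "density SPH f0 = ?N"
    using S.Radon_Nikodym[of ?N] sets_radial_pushforward by auto
  have I0: "(\<integral>\<^sup>+ \<theta>. f0 \<theta> \<partial>SPH) \<le> 1"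
  proof -
    have "(\<integral>\<^sup>+ \<theta>. f0 \<theta> \<partial>SPH) = emeasure (density SPH f0) (space SPH)"
      by (subst emeasure_density) (auto intro!: nn_integral_cong)
    then show ?thesis using Nfin by (simp add: N)
  qed
  then have I0': "(\<integral>\<^sup>+ \<theta>. f0 \<theta> \<partial>SPH) < \<infinity>" by (rule le_less_trans) simp
  have f0g: "AE \<theta> in SPH. f0 \<theta> \<le> g \<theta>"
  proof (rule AE_le_of_set_nn_integral_le[OF f0 g I0'])
    fix A assume A: "A \<in> sets SPH"
    have "(\<integral>\<^sup>+ \<theta>. f0 \<theta> * indicator A \<theta> \<partial>SPH) = emeasure ?N A"
      unfolding N[symmetric] using A by (simp add: emeasure_density)
    then show "(\<integral>\<^sup>+ \<theta>. f0 \<theta> * indicator A \<theta> \<partial>SPH) \<le> (\<integral>\<^sup>+ \<theta>. g \<theta> * indicator A \<theta> \<partial>SPH)" using Nle[OF A] by simp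
  qed
  have ftop: "AE \<theta> in SPH. f0 \<theta> \<noteq> \<infinity>"
    using I0' by (intro nn_integral_PInf_AE f0) auto
  define f where "f \<theta> = enn2real (f0 \<theta>)" for \<theta>
  have fm: "f \<in> borel_measurable SPH" unfolding f_def by measurable
  have ff0: "AE \<theta> in SPH. ennreal (f \<theta>) = f0 \<theta>"
    using ftop by eventually_elim (simp add: f_def less_top)
  have "?N = density SPH (\<lambda>\<theta>. ennreal (f \<theta>))"
    unfolding N[symmetric] using ff0 fm by (intro density_cong) auto
  moreover have "(\<integral>\<^sup>+ \<theta>. ennreal (f \<theta>) \<partial>SPH) \<le> 1"
    using I0 nn_integral_cong_AE[OF ff0] by simp
  moreover have "(\<integral>\<^sup>+ \<theta>. ennreal (f \<theta> powr p) \<partial>SPH) \<le> ennreal (push_const p) * sup_moment p y"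
  proof -
    let ?c = "ennreal (dir_const powr p) * ennreal (weight_const powr (p - 1))"
    have "(\<integral>\<^sup>+ \<theta>. ennreal (f \<theta> powr p) \<partial>SPH) \<le> (\<integral>\<^sup>+ \<theta>. ?c * (W \<theta> * ennreal_powr (Y \<theta>) p) \<partial>SPH)"
    proof (rule nn_integral_mono_AE)
      show "AE \<theta> in SPH. ennreal (f \<theta> powr p) \<le> ?c * (W \<theta> * ennreal_powr (Y \<theta>) p)"
        using f0g ftop
      proof eventually_elim
        case (elim \<theta>)
        have "ennreal (f \<theta> powr p) = ennreal_powr (f0 \<theta>) p" using elim(2) by (simp add: f_def ennreal_powr_def)
        also have "\<dots> \<le> ennreal_powr (g \<theta>) p" using p by (intro ennreal_powr_mono elim) auto
        also have "\<dots> = ennreal (dir_const powr p) * ennreal_powr (W \<theta> * Y \<theta>) p"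
          unfolding g_def by (rule ennreal_powr_mult[OF dir_const_pos])
        also have "\<dots> \<le> ennreal (dir_const powr p) * (ennreal (weight_const powr (p - 1)) * (W \<theta> * ennreal_powr (Y \<theta>) p))"
          by (intro mult_left_mono ennreal_powr_mult_le p W_le Wpos) simp
        finally show ?case by (simp add: mult.assoc)
      qed
    qed
    also have "\<dots> = ?c * (\<integral>\<^sup>+ \<theta>. W \<theta> * ennreal_powr (Y \<theta>) p \<partial>SPH)"
      by (rule nn_integral_cmult) measurable
    also have "(\<integral>\<^sup>+ \<theta>. W \<theta> * ennreal_powr (Y \<theta>) p \<partial>SPH)
       = (\<integral>\<^sup>+ u. indicator shell u * ennreal_powr (Y (tup (dir u))) p \<partial>lborel)"
      by (rule W_int[symmetric]) measurable
    also have "\<dots> \<le> (\<integral>\<^sup>+ u. ennreal ((3 ^ l) powr p) * (ennreal (wt u) * ennreal_powr (Xsup y u) p) \<partial>lborel)"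
    proof (rule nn_integral_mono)
      fix u
      show "indicator shell u * ennreal_powr (Y (tup (dir u))) p
        \<le> ennreal ((3 ^ l) powr p) * (ennreal (wt u) * ennreal_powr (Xsup y u) p)"
      proof (cases "u \<in> shell")
        case True
        have "ennreal_powr (Xsup y (dir u)) p \<le> ennreal_powr (ennreal (3 ^ l) * Xsup y u) p"
          using p by (intro ennreal_powr_mono Xsup_dir True) auto
        also have "\<dots> = ennreal ((3 ^ l) powr p) * ennreal_powr (Xsup y u) p" by (rule ennreal_powr_mult) simp
        finally show ?thesis using True by (simp add: Y_def untup_tup wt_shell)
      qed simp
    qed
    also have "\<dots> = ennreal ((3 ^ l) powr p) * sup_moment p y"
      unfolding sup_moment_def by (rule nn_integral_cmult) measurable
    also have "?c * (ennreal ((3 ^ l) powr p) * sup_moment p y) = ennreal (push_const p) * sup_moment p y"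
    proof -
      have "ennreal (push_const p) = ?c * ennreal ((3 ^ l) powr p)"
        unfolding push_const_def by (simp add: ennreal_mult)
      then show ?thesis by (simp add: mult.assoc)
    qed
    finally show ?thesis by (simp add: mult_left_mono)
  qed
  ultimately show ?thesis using fm by (intro exI[of _ f]) (auto simp: f_def)
qed

end

section \<open>Rescaling and conclusion\<close>

text \<open>The complement of the support is a union of open null sets, hence by Lindelof a
  countable one and itself null. The compact support then carries all the mass.\<close>

lemma radon_compact_supportD:
  fixes M :: "(real^'n::finite) measure"
  assumes "radon_compact_support M"
  shows "finite_borel M" "AE x in M. x \<in> msupport M"
proof -
  have s: "sets M = sets borel" and fin: "\<And>K. compact K \<Longrightarrow> emeasure M K < \<infinity>" and c: "compact (msupport M)"
    using assms by (auto simp: radon_compact_support_def)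
  note [measurable_cong] = s
  have sp: "space M = UNIV" using sets_eq_imp_space_eq[OF s] by simp
  define F where "F = {U :: (real^'n) set. open U \<and> emeasure M U = 0}"
  have F: "- msupport M = \<Union>F"
    by (auto simp: F_def msupport_def zero_less_iff_neq_zero)
  obtain F' where F': "F' \<subseteq> F" "countable F'" "\<Union>F' = \<Union>F"
    using Lindelof[of F] by (auto simp: F_def)
  have "(\<Union>U\<in>F'. U) \<in> null_sets M"
    using F'(1,2) s by (intro null_sets_UN') (auto simp: F_def null_sets_def)
  then have "- msupport M \<in> null_sets M" using F F'(3) by simp
  then show AE: "AE x in M. x \<in> msupport M" by (rule AE_I') auto
  have ms: "msupport M \<in> sets M" using c s by (simp add: compact_imp_closed)
  have "emeasure M (space M) = emeasure M (msupport M)"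
  proof (rule emeasure_eq_AE)
    show "AE x in M. x \<in> space M \<longleftrightarrow> x \<in> msupport M" using AE by eventually_elim (simp add: sp)
  qed (use ms in simp_all)
  then have "emeasure M (space M) \<noteq> \<infinity>" using fin[OF c] by simp
  then show "finite_borel M" using s by (intro finite_borel.intro finite_measureI finite_borel_axioms.intro)
qed

lemma finite_borel_null:
  assumes "finite_borel M" "AE x in M. x \<in> ball x0 R" "measure M (ball x0 R) \<le> 0"
  shows "emeasure M UNIV = 0"
proof -
  interpret finite_borel M by fact
  have sp: "space M = UNIV" using sets_eq_imp_space_eq[OF sets_eq] by simp
  have "emeasure M UNIV = emeasure M (ball x0 R)"
    using assms(2) sp by (intro emeasure_eq_AE) auto
  then show ?thesis using assms(3) by (simp add: emeasure_eq_measure measure_le_0_iff)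
qed

definition normalized :: "'a::euclidean_space \<Rightarrow> real \<Rightarrow> real \<Rightarrow> 'a measure \<Rightarrow> 'a measure" where
  "normalized x0 R a M = density (distr M borel (\<lambda>x. (1 / R) *\<^sub>R (x - x0))) (\<lambda>_. ennreal a)"

lemma sets_normalized [simp]: "sets (normalized x0 R a M) = sets borel"
  by (simp add: normalized_def)

lemma nn_integral_normalized:
  assumes "sets M = sets borel" "H \<in> borel_measurable borel"
  shows "(\<integral>\<^sup>+ x. H x \<partial>normalized x0 R a M) = ennreal a * (\<integral>\<^sup>+ x. H ((1 / R) *\<^sub>R (x - x0)) \<partial>M)"
proof -
  note [measurable_cong] = assms(1)
  note [measurable] = assms(2)
  show ?thesis
    unfolding normalized_def by (simp add: nn_integral_density nn_integral_cmult nn_integral_distr)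
qed

lemma emeasure_normalized:
  assumes M: "sets M = sets borel" and A: "A \<in> sets borel"
  shows "emeasure (normalized x0 R a M) A = ennreal a * emeasure M {x. (1 / R) *\<^sub>R (x - x0) \<in> A}"
proof -
  note [measurable_cong] = M
  have sp: "space M = UNIV" using sets_eq_imp_space_eq[OF M] by simp
  have m: "(\<lambda>x. (1 / R) *\<^sub>R (x - x0)) \<in> borel_measurable M" by measurable
  have "{x. (1 / R) *\<^sub>R (x - x0) \<in> A} \<in> sets M"
    using measurable_sets[OF m A] sp by (simp add: vimage_def)
  moreover have "(indicator A ((1 / R) *\<^sub>R (x - x0)) :: ennreal) = indicator {x. (1 / R) *\<^sub>R (x - x0) \<in> A} x" for x
    by (simp add: indicator_def)
  ultimately show ?thesis
    using nn_integral_normalized[OF M, of "indicator A" x0 R a] A by simp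
qed

text \<open>A ball of radius r comes from one of radius R r, whose mass is at most c (R r)^s; the
  factor 1 / (c R^s) leaves r^s.\<close>

lemma frostman_normalized:
  fixes M :: "(real^'n::finite) measure"
  assumes M: "finite_borel M" and ball: "AE x in M. x \<in> ball x0 R" and R: "0 < R" and c: "0 < c" and s: "0 \<le> s"
    and le: "\<And>x r. 0 < r \<Longrightarrow> measure M (ball x r) \<le> c * r powr s"
  shows "frostman (normalized x0 R (1 / (c * R powr s)) M) s"
proof -
  interpret finite_borel M by fact
  let ?a = "1 / (c * R powr s)" and ?T = "\<lambda>x. (1 / R) *\<^sub>R (x - x0)"
  let ?M = "normalized x0 R ?a M"
  have sp: "space M = UNIV" using sets_eq_imp_space_eq[OF sets_eq] by simp
  have spM: "space ?M = UNIV" using sets_eq_imp_space_eq[OF sets_normalized] by simp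
  have a: "0 \<le> ?a" using c by simp
  have Tb: "?T x \<in> ball y r \<longleftrightarrow> x \<in> ball (x0 + R *\<^sub>R y) (R * r)" for x y r
  proof -
    have "R *\<^sub>R (y - ?T x) = (x0 + R *\<^sub>R y) - x" using R by (simp add: algebra_simps)
    then have "R * dist y (?T x) = dist (x0 + R *\<^sub>R y) x"
      using R unfolding dist_norm by (metis abs_of_pos norm_scaleR)
    then show ?thesis using R by (simp only: mem_ball) (metis mult_less_cancel_left_pos)
  qed
  have ms: "{x. ?T x \<in> ball y r} = ball (x0 + R *\<^sub>R y) (R * r)" for y r using Tb by blast
  show ?thesis
  proof (intro frostman.intro finite_borel.intro finite_borel_axioms.intro frostman_axioms.intro finite_measureI)
    show "emeasure ?M (space ?M) \<noteq> \<infinity>"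
      unfolding spM using emeasure_normalized[OF sets_eq, of UNIV] sp
      by (simp add: ennreal_mult_eq_top_iff emeasure_eq_measure)
    show "sets ?M = sets borel" by simp
    show "AE x in ?M. x \<in> ball 0 1"
    proof (rule AE_I')
      have "emeasure M {x \<in> space M. x \<notin> ball x0 R} = 0"
        by (rule emeasure_eq_0_AE) (use ball in simp)
      then have "emeasure M (- ball x0 R) = 0" by (simp only: sp UNIV_I simp_thms Compl_eq)
      moreover have "{x. ?T x \<in> - ball 0 1} = - ball (x0 + R *\<^sub>R 0) (R * 1)"
        by (simp only: Compl_iff Collect_neg_eq ms)
      moreover have "- ball (0 :: real^'n) 1 \<in> sets borel" by simp
      ultimately have "emeasure ?M (- ball 0 1) = 0"
        by (simp only: emeasure_normalized[OF sets_eq] scaleR_zero_right add_0_right mult_1_right mult_zero_right)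
      then show "- ball 0 1 \<in> null_sets ?M" by (auto simp: null_sets_def)
    qed auto
    show "0 \<le> s" by (rule s)
    fix y :: "real^'n" and r :: real assume r: "0 < r"
    have "emeasure ?M (ball y r) = ennreal ?a * ennreal (measure M (ball (x0 + R *\<^sub>R y) (R * r)))"
      by (subst emeasure_normalized[OF sets_eq]) (simp_all only: ms emeasure_eq_measure, simp)
    also have "\<dots> \<le> ennreal ?a * ennreal (c * (R * r) powr s)"
      using r R by (intro mult_left_mono ennreal_leI le) auto
    also have "\<dots> = ennreal (?a * (c * (R * r) powr s))" using a c by (intro ennreal_mult[symmetric]) auto
    also have "?a * (c * (R * r) powr s) = r powr s" using c R r by (simp add: powr_mult)
    finally show "emeasure ?M (ball y r) \<le> ennreal (r powr s)" .
  qed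
qed

text \<open>The exponent is ln 2 / (p (ln 2 + ln Q)): division by p secures (p - 1) t \<le> 1, and
  the logarithm of Q secures Q^t \<le> 2.\<close>

lemma small_power_le_2:
  assumes "1 \<le> (Q::real)" "1 < p"
  shows "\<exists>t. 0 < t \<and> t \<le> 1 \<and> (p - 1) * t \<le> 1 \<and> Q powr t \<le> 2"
proof -
  define s where "s = ln 2 / (ln 2 + ln Q)"
  have lnQ: "0 \<le> ln Q" and l2: "0 < ln (2::real)" using assms by simp_all
  then have pos: "0 < ln 2 + ln Q" by linarith
  have s: "0 < s" "s \<le> 1" using lnQ l2 pos by (auto simp: s_def)
  have "s * ln Q \<le> s * (ln 2 + ln Q)" using s l2 by (intro mult_left_mono) auto
  also have "\<dots> = ln 2" using pos by (simp add: s_def)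
  finally have sQ: "s * ln Q \<le> ln 2" .
  define t where "t = s / p"
  have t: "0 < t" "t \<le> s" using s assms by (auto simp: t_def field_simps)
  have "(p - 1) * t = s - t" using assms by (simp add: t_def field_simps)
  then have "(p - 1) * t \<le> 1" using s t by simp
  moreover have "Q powr t \<le> 2"
  proof -
    have "t * ln Q \<le> ln 2" using sQ mult_right_mono[OF t(2) lnQ] by linarith
    then have "exp (t * ln Q) \<le> exp (ln 2)" by (simp only: exp_le_cancel_iff)
    then show ?thesis using assms by (simp add: powr_def)
  qed
  ultimately show ?thesis using t s by (intro exI[of _ t]) auto
qed

section \<open>The pushforward under rescaling and the final estimate\<close>

context sphere_blocks
begin

lemma Lp_norm_pushforward_null:
  assumes M: "sets M = sets borel" "emeasure M UNIV = 0" and p: "0 < p"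
  shows "ennreal_powr (Lp_norm_measure p SPH (radial_pushforward l b y M)) p = 0"
proof -
  have sp: "space M = UNIV" using sets_eq_imp_space_eq[OF M(1)] by simp
  have "radial_pushforward l b y M = density SPH (\<lambda>_. ennreal 0)"
  proof (rule measure_eqI)
    fix E assume "E \<in> sets (radial_pushforward l b y M)"
    then have E: "E \<in> sets SPH" by (simp add: sets_radial_pushforward)
    have "emeasure M {x. x - y \<in> nondeg \<and> tup (dir (x - y)) \<in> E} \<le> emeasure M (space M)"
      by (rule emeasure_space)
    then show "emeasure (radial_pushforward l b y M) E = emeasure (density SPH (\<lambda>_. ennreal 0)) E"
      using E M sp by (simp add: emeasure_radial_pushforward emeasure_density)
  qed (simp add: sets_radial_pushforward)
  from Lp_norm_measure_powr_le[OF p _ _ this] show ?thesis using p by simp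
qed

text \<open>Directions are unchanged when x and y undergo the same translation and dilation, so only
  the mass factor c appears.\<close>

lemma radial_pushforward_normalized:
  assumes M: "sets M = sets borel" and R: "0 < R" and c: "0 < c" and E: "E \<in> sets SPH"
  shows "emeasure (radial_pushforward l b y M) E
    = ennreal c * emeasure (radial_pushforward l b ((1 / R) *\<^sub>R (y - x0)) (normalized x0 R (1 / c) M)) E"
proof -
  let ?T = "\<lambda>x. (1 / R) *\<^sub>R (x - x0)"
  let ?A = "{x. x - y \<in> nondeg \<and> tup (dir (x - y)) \<in> E}"
  let ?B = "{x. x - ?T y \<in> nondeg \<and> tup (dir (x - ?T y)) \<in> E}"
  have "?T x - ?T y = bscale b (\<lambda>_. 1 / R) (x - y)" for x
    by (simp add: vec_eq_iff algebra_simps diff_divide_distrib)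
  then have AB: "{x. ?T x \<in> ?B} = ?A"
    using R by (simp add: bscale_in_nondeg_iff dir_bscale)
  let ?S = "nondeg \<inter> dir -` {v \<in> product_sphere. tup v \<in> E}"
  have eq: "?B = (\<lambda>x. x - ?T y) -` ?S"
    by (auto intro: dir_in_product_sphere)
  have S: "?S \<in> sets borel"
    using sets_nondeg measurable_sets_borel[OF borel_measurable_dir sets_tup_preimage[OF E]] by (rule sets.Int)
  have "(\<lambda>x. x - ?T y) \<in> borel_measurable borel" by measurable
  then have B: "?B \<in> sets borel"
    unfolding eq using S by (rule measurable_sets_borel)
  have "emeasure (radial_pushforward l b (?T y) (normalized x0 R (1 / c) M)) E = ennreal (1 / c) * emeasure M ?A"
    using emeasure_normalized[OF M B, of x0 R "1 / c"] unfolding AB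
    by (simp add: emeasure_radial_pushforward E)
  moreover have "ennreal c * ennreal (1 / c) = 1" using c by (simp add: ennreal_mult'[symmetric])
  ultimately show ?thesis using M E by (simp add: emeasure_radial_pushforward mult.assoc[symmetric])
qed

lemma radial_projection_bound:
  assumes \<alpha>: "real CARD('n) - 1 < \<alpha>" and \<beta>: "2 * (real CARD('n) - 1) - \<alpha> < \<beta>"
  shows "\<exists>p>1. \<forall>(M :: (real^'n) measure) N c c'.
    radon_compact_support M \<and> radon_compact_support N \<and>
    (\<forall>x r. 0 < r \<longrightarrow> measure M (ball x r) \<le> c * r powr \<alpha>) \<and>
    (\<forall>x r. 0 < r \<longrightarrow> measure N (ball x r) \<le> c' * r powr \<beta>) \<longrightarrow>
    (\<integral>\<^sup>+ y. ennreal_powr (Lp_norm_measure p SPH (radial_pushforward l b y M)) p \<partial>N)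
      \<le> ennreal (4 * (\<bar>diameter (msupport M \<union> msupport N)\<bar> + 1) ^ (3 * CARD('n)) * c powr p * c')"
proof -
  let ?d = "real CARD('n)"
  obtain k0 :: 'n where True by simp
  have "2 \<le> block_dim b (b k0)" by (rule two_le[OF b_less])
  also have "\<dots> \<le> CARD('n)" unfolding block_dim_def by (rule card_mono) auto
  finally have d2: "2 \<le> ?d" by simp
  have \<alpha>0: "0 \<le> \<alpha>" using \<alpha> d2 by simp
  define Psi where "Psi p M y = ennreal_powr (Lp_norm_measure p SPH (radial_pushforward l b y M)) p"
    for p and M :: "(real^'n) measure" and y
  have null: "(\<integral>\<^sup>+ y. Psi p M y \<partial>N) \<le> z"
    if "1 < p" "sets M = sets borel" "sets N = sets borel" "emeasure M UNIV = 0 \<or> emeasure N UNIV = 0" for p M N z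
    using that(4)
  proof
    assume "emeasure M UNIV = 0"
    then show ?thesis using that Lp_norm_pushforward_null[of M p] by (simp add: Psi_def)
  next
    assume "emeasure N UNIV = 0"
    then have "space N \<in> null_sets N" using sets_eq_imp_space_eq[OF that(3)] that(3) by (simp add: null_sets_def)
    then have "AE y in N. Psi p M y = 0" by (intro AE_I'[where N="space N"]) auto
    then have "(\<integral>\<^sup>+ y. Psi p M y \<partial>N) = (\<integral>\<^sup>+ y. 0 \<partial>N)" by (rule nn_integral_cong_AE)
    then show ?thesis by simp
  qed
  \<comment> \<open>Outside these degenerate situations both measures can be rescaled to the unit ball with Frostman
    constant 1, so that no constant below depends on the measures.\<close>
  have reduce: "(\<integral>\<^sup>+ y. Psi p M y \<partial>N) \<le> z \<or>
      (\<exists>x0 R. R = \<bar>diameter (msupport M \<union> msupport N)\<bar> + 1 \<and> 0 < c \<and> 0 < c' \<and>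
        finite_borel M \<and> finite_borel N \<and> (AE y in N. y \<in> ball x0 R) \<and>
        frostman (normalized x0 R (1 / (c * R powr \<alpha>)) M) \<alpha> \<and> \<alpha> \<le> ?d \<and>
        (0 \<le> \<beta> \<longrightarrow> frostman (normalized x0 R (1 / (c' * R powr \<beta>)) N) \<beta> \<and> \<beta> \<le> ?d))"
    if p: "1 < p" and M: "radon_compact_support M" and N: "radon_compact_support N"
      and cM: "\<And>x r. 0 < r \<Longrightarrow> measure M (ball x r) \<le> c * r powr \<alpha>"
      and cN: "\<And>x r. 0 < r \<Longrightarrow> measure N (ball x r) \<le> c' * r powr \<beta>" for p M N c c' z
  proof (rule ccontr)
    assume "\<not> ?thesis"
    then have big: "\<not> (\<integral>\<^sup>+ y. Psi p M y \<partial>N) \<le> z" and no: "\<not> (\<exists>x0 R. R = \<bar>diameter (msupport M \<union> msupport N)\<bar> + 1 \<and> 0 < c \<and> 0 < c' \<and>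
        finite_borel M \<and> finite_borel N \<and> (AE y in N. y \<in> ball x0 R) \<and>
        frostman (normalized x0 R (1 / (c * R powr \<alpha>)) M) \<alpha> \<and> \<alpha> \<le> ?d \<and>
        (0 \<le> \<beta> \<longrightarrow> frostman (normalized x0 R (1 / (c' * R powr \<beta>)) N) \<beta> \<and> \<beta> \<le> ?d))" by blast+
    note M' = radon_compact_supportD[OF M] and N' = radon_compact_supportD[OF N]
    have sM: "sets M = sets borel" and sN: "sets N = sets borel"
      using M N by (auto simp: radon_compact_support_def)
    have nz: "emeasure M UNIV \<noteq> 0" "emeasure N UNIV \<noteq> 0" using big null[OF p sM sN] by blast+
    let ?S = "msupport M \<union> msupport N"
    \<comment> \<open>The added 1 puts both supports into the open ball about any support point of
      M, and makes R \<ge> 1, so that powers of R increase with the exponent.\<close>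
    define R where "R = \<bar>diameter ?S\<bar> + 1"
    have R: "R > 0" by (simp add: R_def)
    have "msupport M \<noteq> {}"
    proof
      assume "msupport M = {}"
      then have "AE x in M. x \<in> ({} :: (real^'n) set)" using M'(2) by simp
      then have "emeasure M UNIV = emeasure M {}" using sM by (intro emeasure_eq_AE) auto
      then show False using nz by simp
    qed
    then obtain x0 where x0: "x0 \<in> msupport M" by blast
    have bd: "bounded ?S" using M N by (auto simp: radon_compact_support_def intro: compact_imp_bounded)
    have inb: "x \<in> ball x0 R" if "x \<in> ?S" for x
      using diameter_bounded_bound[OF bd _ that, of x0] x0 by (simp add: R_def)
    have bM: "AE x in M. x \<in> ball x0 R" using M'(2) by eventually_elim (rule inb, simp)
    have bN: "AE x in N. x \<in> ball x0 R" using N'(2) by eventually_elim (rule inb, simp)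
    have c: "c > 0"
    proof (rule ccontr)
      assume "\<not> c > 0"
      then have "measure M (ball x0 R) \<le> 0" using cM[OF R, of x0] by (smt (verit) mult_nonpos_nonneg powr_ge_zero)
      then show False using finite_borel_null[OF M'(1) bM] nz by simp
    qed
    have c': "c' > 0"
    proof (rule ccontr)
      assume "\<not> c' > 0"
      then have "measure N (ball x0 R) \<le> 0" using cN[OF R, of x0] by (smt (verit) mult_nonpos_nonneg powr_ge_zero)
      then show False using finite_borel_null[OF N'(1) bN] nz by simp
    qed
    have scale: "emeasure K UNIV = 0" if K: "sets K = sets borel" "emeasure (normalized x0 R (1 / a) K) UNIV = 0" "0 < a"
      for K :: "(real^'n) measure" and a
      using emeasure_normalized[OF K(1), of UNIV x0 R "1 / a"] K by (simp add: ennreal_eq_0_iff)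
    have fM: "frostman (normalized x0 R (1 / (c * R powr \<alpha>)) M) \<alpha>"
      by (rule frostman_normalized[OF M'(1) bM R c \<alpha>0 cM])
    have \<alpha>d: "\<alpha> \<le> ?d"
      using frostman.null_of_large_exponent[OF fM] scale[OF sM, of "c * R powr \<alpha>"] nz c R by (simp add: not_less[symmetric]) blast
    have "frostman (normalized x0 R (1 / (c' * R powr \<beta>)) N) \<beta> \<and> \<beta> \<le> ?d" if \<beta>0: "0 \<le> \<beta>"
    proof -
      have fN: "frostman (normalized x0 R (1 / (c' * R powr \<beta>)) N) \<beta>"
        by (rule frostman_normalized[OF N'(1) bN R c' \<beta>0 cN])
      moreover have "\<beta> \<le> ?d"
        using frostman.null_of_large_exponent[OF fN] scale[OF sN, of "c' * R powr \<beta>"] nz c' R by (simp add: not_less[symmetric]) blast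
      ultimately show ?thesis by simp
    qed
    then show False using no R_def c c' M'(1) N'(1) bN fM \<alpha>d by blast
  qed
  show ?thesis
  proof (cases "\<alpha> \<le> ?d")
    \<comment> \<open>For \<alpha> > d the first measure vanishes, and any exponent p > 1 serves; 2
      is taken.\<close>
    case False
    have triv: "(\<integral>\<^sup>+ y. Psi 2 M y \<partial>N) \<le> z"
      if "radon_compact_support M" "radon_compact_support N" "\<And>x r. 0 < r \<Longrightarrow> measure M (ball x r) \<le> c * r powr \<alpha>"
      "\<And>x r. 0 < r \<Longrightarrow> measure N (ball x r) \<le> c' * r powr \<beta>" for M N c c' z
      using reduce[of 2 M N c c' z] that False by auto
    show ?thesis
      by (intro exI[of _ 2] conjI allI impI) (simp, rule triv[unfolded Psi_def], blast+)
  next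
    case \<alpha>d: True
    \<comment> \<open>From \<beta> > 2 (d - 1) - \<alpha> \<ge> d - 2 \<ge> 0.\<close>
    have \<beta>0: "0 \<le> \<beta>" using \<beta> \<alpha>d d2 by simp
    obtain p \<kappa> where p: "1 < p" and \<kappa>: "0 \<le> \<kappa>"
      and bound: "\<And>\<mu> \<nu>. blocks_pair l b \<mu> \<alpha> \<nu> \<beta> \<Longrightarrow>
        (\<integral>\<^sup>+ y. \<integral>\<^sup>+ u. ennreal (wt u) * ennreal_powr (blocks_frostman.Xsup l b \<mu> y u) p \<partial>lborel \<partial>\<nu>) \<le> ennreal \<kappa>"
      using Xsup_integral_bound[OF \<alpha> \<alpha>d \<beta>] by blast
    define P where "P = push_const p"
    have P: "0 \<le> P" by (simp add: P_def push_const_def)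
    \<comment> \<open>The bound P \<kappa> for the p-th power depends on \<alpha> and \<beta>. An
      exponent q close enough to 1 makes its influence at most a factor 2, at the price of a smaller
      exponent, which is allowed to depend on \<alpha> and \<beta>.\<close>
    define Q where "Q = max 1 (P * \<kappa>)"
    have Q: "1 \<le> Q" "P * \<kappa> \<le> Q" by (auto simp: Q_def)
    obtain t where t: "0 < t" "t \<le> 1" "(p - 1) * t \<le> 1" "Q powr t \<le> 2"
      using small_power_le_2[OF Q(1) p] by blast
    define q where "q = 1 + (p - 1) * t"
    have q: "1 < q" "q \<le> p" "q \<le> 2"
    proof -
      show "1 < q" "q \<le> 2" using t p by (auto simp: q_def)
      have "(p - 1) * t \<le> (p - 1) * 1" using t p by (intro mult_left_mono) auto
      then show "q \<le> p" by (simp add: q_def)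
    qed
    \<comment> \<open>The threshold that balances the interpolation: L^(q-1) = Q^t \<le> 2, and
      L^(q-p) = L^(q-1) / Q cancels P \<kappa>. The two summands add up to the constant 4.\<close>
    define L where "L = Q powr (1 / (p - 1))"
    have L: "0 < L" using Q by (simp add: L_def)
    have L1: "L powr (q - 1) \<le> 2" using t p by (simp add: L_def powr_powr q_def)
    have L2: "L powr (q - p) * (P * \<kappa>) \<le> 2"
    proof -
      have "L powr (q - p) = L powr (q - 1) * L powr (- (p - 1))" by (simp add: powr_add[symmetric])
      also have "L powr (- (p - 1)) = 1 / Q"
      proof -
        have "1 / (p - 1) * (- (p - 1)) = - 1" using p by (simp add: divide_eq_eq)
        then have "L powr (- (p - 1)) = Q powr - 1" unfolding L_def powr_powr by (rule arg_cong)
        then show ?thesis using Q by (simp add: powr_minus_divide)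
      qed
      finally have "L powr (q - p) * (P * \<kappa>) = L powr (q - 1) * ((P * \<kappa>) / Q)" by simp
      also have "\<dots> \<le> 2 * 1" using L1 Q P \<kappa> by (intro mult_mono) auto
      finally show ?thesis by simp
    qed
    have main: "(\<integral>\<^sup>+ y. Psi q M y \<partial>N)
        \<le> ennreal (4 * (\<bar>diameter (msupport M \<union> msupport N)\<bar> + 1) ^ (3 * CARD('n)) * c powr q * c')" (is "_ \<le> ?rhs")
      if M: "radon_compact_support M" and N: "radon_compact_support N"
        and cM: "\<And>x r. 0 < r \<Longrightarrow> measure M (ball x r) \<le> c * r powr \<alpha>"
        and cN: "\<And>x r. 0 < r \<Longrightarrow> measure N (ball x r) \<le> c' * r powr \<beta>" for M N c c'
    proof -
      consider "(\<integral>\<^sup>+ y. Psi q M y \<partial>N) \<le> ?rhs"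
        | x0 R where "R = \<bar>diameter (msupport M \<union> msupport N)\<bar> + 1" "0 < c" "0 < c'"
          "finite_borel M" "finite_borel N" "AE y in N. y \<in> ball x0 R"
          "frostman (normalized x0 R (1 / (c * R powr \<alpha>)) M) \<alpha>"
          "frostman (normalized x0 R (1 / (c' * R powr \<beta>)) N) \<beta>" "\<beta> \<le> ?d"
        using reduce[OF q(1) M N cM cN, of ?rhs] \<beta>0 by blast
      then show ?thesis
      proof cases
        case (2 x0 R)
        have R: "1 \<le> R" "0 < R" using 2(1) by auto
        define a where "a = c * R powr \<alpha>"
        define a' where "a' = c' * R powr \<beta>"
        have a: "0 < a" and a': "0 < a'" using 2 R by (auto simp: a_def a'_def)
        define \<mu> where "\<mu> = normalized x0 R (1 / a) M"
        define \<nu> where "\<nu> = normalized x0 R (1 / a') N"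
        interpret m: frostman \<mu> \<alpha> using 2 by (simp add: \<mu>_def a_def)
        interpret n: frostman \<nu> \<beta> using 2 by (simp add: \<nu>_def a'_def)
        interpret sphere_frostman l b \<mu> \<alpha> ..
        interpret blocks_pair l b \<mu> \<alpha> \<nu> \<beta> ..
        have sM: "sets M = sets borel" and sN: "sets N = sets borel"
          using M N by (auto simp: radon_compact_support_def)
        note [measurable_cong] = sN
        let ?T = "\<lambda>x. (1 / R) *\<^sub>R (x - x0)"
        have Gm[measurable]: "sup_moment p \<in> borel_measurable borel" unfolding sup_moment_def by measurable
        have pull: "(\<integral>\<^sup>+ y. H (?T y) \<partial>N) = ennreal a' * (\<integral>\<^sup>+ y. H y \<partial>\<nu>)" if H: "H \<in> borel_measurable borel" for H
        proof -
          have "ennreal a' * (\<integral>\<^sup>+ y. H y \<partial>\<nu>) = (ennreal a' * ennreal (1 / a')) * (\<integral>\<^sup>+ y. H (?T y) \<partial>N)"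
            unfolding \<nu>_def by (simp add: nn_integral_normalized[OF sN H] mult.assoc)
          then show ?thesis using a' by (simp add: ennreal_mult'[symmetric])
        qed
        have "(\<integral>\<^sup>+ y. sup_moment p y \<partial>\<nu>) \<le> ennreal \<kappa>"
          unfolding sup_moment_def by (rule bound) (rule blocks_pair_axioms)
        then have G: "(\<integral>\<^sup>+ y. sup_moment p (?T y) \<partial>N) \<le> ennreal a' * ennreal \<kappa>"
          unfolding pull[OF Gm] by (rule mult_left_mono) simp
        have N1: "emeasure N (space N) \<le> ennreal a'"
        proof -
          have "emeasure N (space N) = (\<integral>\<^sup>+ y. 1 \<partial>N)" by simp
          also have "\<dots> = ennreal a' * (\<integral>\<^sup>+ y. 1 \<partial>\<nu>)" by (rule pull) simp
          also have "\<dots> \<le> ennreal a' * 1" using n.emeasure_UNIV_le by (intro mult_left_mono) auto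
          finally show ?thesis by simp
        qed
        have Gfin: "AE y in N. sup_moment p (?T y) \<noteq> \<infinity>"
        proof (rule nn_integral_PInf_AE)
          show "(\<lambda>y. sup_moment p (?T y)) \<in> borel_measurable N" by measurable
          show "(\<integral>\<^sup>+ y. sup_moment p (?T y) \<partial>N) \<noteq> \<infinity>"
            using G by (auto simp: top_unique ennreal_mult_eq_top_iff)
        qed
        have "AE y in N. Psi q M y \<le> ennreal (a powr q) * (ennreal (L powr (q - 1)) + ennreal (L powr (q - p) * P) * sup_moment p (?T y))"
          using Gfin 2(6)
        proof eventually_elim
          case (elim y)
          have "\<bar>?T y $ k\<bar> \<le> 1" for k
          proof -
            have "\<bar>(y - x0) $ k\<bar> \<le> norm (y - x0)" by (rule component_le_norm_cart)
            also have "\<dots> \<le> R" using elim(2) by (simp add: dist_norm norm_minus_commute)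
            finally show ?thesis using R by (simp add: abs_mult field_simps)
          qed
          moreover have "sup_moment p (?T y) < \<infinity>" using elim(1) by (simp add: less_top)
          ultimately obtain f where f: "f \<in> borel_measurable SPH" "\<And>\<theta>. 0 \<le> f \<theta>"
            "radial_pushforward l b (?T y) \<mu> = density SPH (\<lambda>\<theta>. ennreal (f \<theta>))"
            "(\<integral>\<^sup>+ \<theta>. ennreal (f \<theta>) \<partial>SPH) \<le> 1"
            "(\<integral>\<^sup>+ \<theta>. ennreal (f \<theta> powr p) \<partial>SPH) \<le> ennreal P * sup_moment p (?T y)"
            using pushforward_density[OF p, of "?T y"] unfolding P_def by blast
          note [measurable] = f(1)
          \<comment> \<open>Undoing the normalization multiplies the density seen from the rescaled
            point by a.\<close>
          have "radial_pushforward l b y M = density SPH (\<lambda>\<theta>. ennreal (a * f \<theta>))"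
          proof (rule measure_eqI)
            fix E assume "E \<in> sets (radial_pushforward l b y M)"
            then have E[measurable]: "E \<in> sets SPH" by (simp add: sets_radial_pushforward)
            have "emeasure (radial_pushforward l b y M) E = ennreal a * (\<integral>\<^sup>+ \<theta>. ennreal (f \<theta>) * indicator E \<theta> \<partial>SPH)"
              using radial_pushforward_normalized[OF sM R(2) a E, of y x0] f(3)
              by (simp add: \<mu>_def emeasure_density)
            also have "\<dots> = (\<integral>\<^sup>+ \<theta>. ennreal (a * f \<theta>) * indicator E \<theta> \<partial>SPH)"
              using a f(2) by (subst nn_integral_cmult[symmetric]) (auto simp: ennreal_mult mult.assoc)
            finally show "emeasure (radial_pushforward l b y M) E = emeasure (density SPH (\<lambda>\<theta>. ennreal (a * f \<theta>))) E"
              by (simp add: emeasure_density)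
          qed (simp add: sets_radial_pushforward)
          then have "Psi q M y \<le> (\<integral>\<^sup>+ \<theta>. ennreal ((a * f \<theta>) powr q) \<partial>SPH)"
            unfolding Psi_def using q a f(2) by (intro Lp_norm_measure_powr_le) auto
          also have "\<dots> \<le> (\<integral>\<^sup>+ \<theta>. ennreal (a powr q) * (ennreal (L powr (q - 1)) * ennreal (f \<theta>) + ennreal (L powr (q - p)) * ennreal (f \<theta> powr p)) \<partial>SPH)"
          proof (rule nn_integral_mono)
            fix \<theta>
            have "(a * f \<theta>) powr q = a powr q * f \<theta> powr q" using a f(2) by (simp add: powr_mult)
            also have "\<dots> \<le> a powr q * (L powr (q - 1) * f \<theta> + L powr (q - p) * f \<theta> powr p)"
              using q L f(2) by (intro mult_left_mono powr_interpolate) auto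
            finally have "ennreal ((a * f \<theta>) powr q) \<le> ennreal (a powr q * (L powr (q - 1) * f \<theta> + L powr (q - p) * f \<theta> powr p))"
              by (rule ennreal_leI)
            also have "\<dots> = ennreal (a powr q) * (ennreal (L powr (q - 1)) * ennreal (f \<theta>) + ennreal (L powr (q - p)) * ennreal (f \<theta> powr p))"
              using f(2) by (simp add: ennreal_mult)
            finally show "ennreal ((a * f \<theta>) powr q) \<le> \<dots>" .
          qed
          also have "\<dots> = ennreal (a powr q) * (ennreal (L powr (q - 1)) * (\<integral>\<^sup>+ \<theta>. ennreal (f \<theta>) \<partial>SPH)
              + ennreal (L powr (q - p)) * (\<integral>\<^sup>+ \<theta>. ennreal (f \<theta> powr p) \<partial>SPH))"
            by (simp add: nn_integral_cmult nn_integral_add)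
          also have "\<dots> \<le> ennreal (a powr q) * (ennreal (L powr (q - 1)) * 1 + ennreal (L powr (q - p)) * (ennreal P * sup_moment p (?T y)))"
            by (intro mult_left_mono add_mono f) auto
          also have "\<dots> = ennreal (a powr q) * (ennreal (L powr (q - 1)) + ennreal (L powr (q - p) * P) * sup_moment p (?T y))"
            using P by (simp add: ennreal_mult mult.assoc)
          finally show ?case .
        qed
        then have "(\<integral>\<^sup>+ y. Psi q M y \<partial>N)
           \<le> (\<integral>\<^sup>+ y. ennreal (a powr q) * (ennreal (L powr (q - 1)) + ennreal (L powr (q - p) * P) * sup_moment p (?T y)) \<partial>N)"
          by (rule nn_integral_mono_AE)
        also have "\<dots> = ennreal (a powr q) * (ennreal (L powr (q - 1)) * emeasure N (space N)
            + ennreal (L powr (q - p) * P) * (\<integral>\<^sup>+ y. sup_moment p (?T y) \<partial>N))"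
        proof -
          have [measurable]: "(\<lambda>y. sup_moment p (?T y)) \<in> borel_measurable N" by measurable
          show ?thesis by (simp add: nn_integral_cmult nn_integral_add)
        qed
        also have "\<dots> \<le> ennreal (a powr q) * (ennreal (L powr (q - 1)) * ennreal a'
            + ennreal (L powr (q - p) * P) * (ennreal a' * ennreal \<kappa>))"
          by (intro mult_left_mono add_mono N1 G) auto
        also have "\<dots> = ennreal (a powr q * (L powr (q - 1) * a' + L powr (q - p) * P * (a' * \<kappa>)))"
          using a' P \<kappa> by (simp add: ennreal_mult)
        also have "\<dots> \<le> ?rhs"
        proof (rule ennreal_leI)
          have "L powr (q - 1) * a' + L powr (q - p) * P * (a' * \<kappa>) = (L powr (q - 1) + L powr (q - p) * (P * \<kappa>)) * a'"
            by (simp add: algebra_simps)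
          also have "\<dots> \<le> 4 * a'" using L1 L2 a' by (intro mult_right_mono) auto
          finally have "a powr q * (L powr (q - 1) * a' + L powr (q - p) * P * (a' * \<kappa>)) \<le> a powr q * (4 * a')"
            by (rule mult_left_mono) simp
          also have "\<dots> = 4 * c powr q * c' * R powr (\<alpha> * q + \<beta>)"
            using 2 R by (simp add: a_def a'_def powr_mult powr_powr powr_add mult_ac)
          also have "\<dots> \<le> 4 * c powr q * c' * R ^ (3 * CARD('n))"
          proof (rule mult_left_mono)
            \<comment> \<open>Since q \<le> 2 and both exponents are at most d, the power of R is at
              most 3 d, whatever \<alpha> and \<beta> are.\<close>
            have "\<alpha> * q \<le> ?d * 2" using \<alpha>d \<alpha>0 q by (intro mult_mono) auto
            then have "\<alpha> * q + \<beta> \<le> real (3 * CARD('n))" using 2 by simp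
            then have "R powr (\<alpha> * q + \<beta>) \<le> R powr real (3 * CARD('n))" using R by (intro powr_mono) auto
            then show "R powr (\<alpha> * q + \<beta>) \<le> R ^ (3 * CARD('n))" using R(2) by (simp only: powr_realpow)
          qed (use 2 in simp)
          finally show "a powr q * (L powr (q - 1) * a' + L powr (q - p) * P * (a' * \<kappa>))
             \<le> 4 * (\<bar>diameter (msupport M \<union> msupport N)\<bar> + 1) ^ (3 * CARD('n)) * c powr q * c'"
            unfolding 2(1)[symmetric] by (simp add: mult_ac)
        qed
        finally show ?thesis .
      qed
    qed
    show ?thesis
      by (intro exI[of _ q] conjI allI impI) (rule q(1), rule main[unfolded Psi_def], blast+)
  qed
qed

end

theorem theorem1p2:
  shows "\<exists>C :: real \<Rightarrow> real.
    \<forall>(l::nat) (b :: 'n::finite \<Rightarrow> nat).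
      1 \<le> l \<and> (\<forall>k. b k < l) \<and> (\<forall>i<l. 2 \<le> block_dim b i) \<longrightarrow>
      (\<forall>(\<alpha>::real) (\<beta>::real).
        \<alpha> > real CARD('n) - 1 \<and> \<beta> > 2 * (real CARD('n) - 1) - \<alpha> \<longrightarrow>
        (\<exists>p::real. p > 1 \<and>
          (\<forall>(\<mu> :: (real^'n) measure) (\<nu> :: (real^'n) measure) (C\<mu>::real) (C\<nu>::real).
            radon_compact_support \<mu> \<and> radon_compact_support \<nu> \<and>
            (\<forall>i<l. block_proj b i ` msupport \<mu> \<inter> block_proj b i ` msupport \<nu> = {}) \<and>
            (\<forall>x r. r > 0 \<longrightarrow> measure \<mu> (ball x r) \<le> C\<mu> * r powr \<alpha>) \<and>
            (\<forall>x r. r > 0 \<longrightarrow> measure \<nu> (ball x r) \<le> C\<nu> * r powr \<beta>) \<longrightarrow>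
            (\<integral>\<^sup>+ y. ennreal_powr
                      (Lp_norm_measure p (product_sphere_measure l b) (radial_pushforward l b y \<mu>)) p \<partial>\<nu>)
              \<le> ennreal (C (diameter (msupport \<mu> \<union> msupport \<nu>)) * C\<mu> powr p * C\<nu>))))"
\<comment> \<open>The witness sees only the diameter and, through the type \<open>'n\<close>, the
  dimension; it is chosen before l, b, \<alpha> and \<beta>. The absolute value keeps it positive at
  every real argument.\<close>
proof (intro exI[of _ "\<lambda>D. 4 * (\<bar>D\<bar> + 1) ^ (3 * CARD('n))"] allI impI)
  fix l :: nat and b :: "'n \<Rightarrow> nat" and \<alpha> \<beta> :: real
  assume b: "1 \<le> l \<and> (\<forall>k. b k < l) \<and> (\<forall>i<l. 2 \<le> block_dim b i)"
    and \<alpha>\<beta>: "\<alpha> > real CARD('n) - 1 \<and> \<beta> > 2 * (real CARD('n) - 1) - \<alpha>"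
  interpret sphere_blocks l b
  proof
    show "b k < l" for k using b by blast
    show "\<exists>k. b k = i" if "i < l" for i
    proof (rule ccontr)
      assume "\<not> ?thesis"
      then have "block_dim b i = 0" by (simp add: block_dim_def)
      then show False using b that by fastforce
    qed
    show "2 \<le> block_dim b i" if "i < l" for i using b that by blast
  qed
  show "\<exists>p::real. p > 1 \<and>
          (\<forall>(\<mu> :: (real^'n) measure) (\<nu> :: (real^'n) measure) (C\<mu>::real) (C\<nu>::real).
            radon_compact_support \<mu> \<and> radon_compact_support \<nu> \<and>
            (\<forall>i<l. block_proj b i ` msupport \<mu> \<inter> block_proj b i ` msupport \<nu> = {}) \<and>
            (\<forall>x r. r > 0 \<longrightarrow> measure \<mu> (ball x r) \<le> C\<mu> * r powr \<alpha>) \<and>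
            (\<forall>x r. r > 0 \<longrightarrow> measure \<nu> (ball x r) \<le> C\<nu> * r powr \<beta>) \<longrightarrow>
            (\<integral>\<^sup>+ y. ennreal_powr
                      (Lp_norm_measure p (product_sphere_measure l b) (radial_pushforward l b y \<mu>)) p \<partial>\<nu>)
              \<le> ennreal (4 * (\<bar>diameter (msupport \<mu> \<union> msupport \<nu>)\<bar> + 1) ^ (3 * CARD('n)) * C\<mu> powr p * C\<nu>))"
    using radial_projection_bound[of \<alpha> \<beta>] \<alpha>\<beta> by blast
qed

end
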